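(* For every integer $d\ge 2$ there is a constant $c_d$ depending only on $d$ such that the following holds for all integers $n\ge d$ and $m\ge 2$. Let $S$ be the number of urns containing exactly $d$ balls when $n$ balls are uniformly (and independently) distributed among $m$ urns. Then $$d_{\mathrm{TV}}\bigl(\mathcal{L}(S),N^d(\mu,\sigma^2)\bigr)\le\frac{c_d\bigl(1+(n/m)^3\bigr)}{\sigma},$$ where $\mu$ and $\sigma^2$ are the mean and variance of $S$, given by $$\mu=m\binom{n}{d}\frac{1}{m^d}\Bigl(1-\frac1m\Bigr)^{n-d},\qquad \sigma^2=\mu-\mu^2+m(m-1)\binom{n}{d,d,n-2d}\frac{1}{m^{2d}}\Bigl(1-\frac2m\Bigr)^{n-2d}.$$
   Context: $\binom{n}{d,d,n-2d}=\frac{n!}{d!\,d!\,(n-2d)!}$ is the multinomial coefficient, with the corresponding term being $0$ when $n<2d$ (and $0^0=1$). $\mathcal{L}(X)$ denotes the distribution of a random variable $X$. The total variation distance is $d_{\mathrm{TV}}(\mathcal{L}(X),\mathcal{L}(Y))=\sup_{A\subset\mathbb{R}}|\mathbb{P}(X\in A)-\mathbb{P}(Y\in A)|$ (supremum over measurable $A$). Discretized normal distribution: $N^d(\mu,\sigma^2)$ is the distribution supported on $\mathbb{Z}$ with probability mass function at $z\in\mathbb{Z}$ equal to $\mathbb{P}(z-\tfrac12\le Z_{\mu,\sigma^2}<z+\tfrac12)$, where $Z_{\mu,\sigma^2}$ is a Gaussian variable with mean $\mu$ and variance $\sigma^2$. The superscript $d$ in $N^d$ stands for "discretized" and is unrelated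 to the occupancy number $d$. *)

theory Defs
  imports "HOL-Probability.Probability"
begin

definition tv_dist :: "real measure \<Rightarrow> real measure \<Rightarrow> real" where
  "tv_dist M N = (SUP A \<in> sets borel. \<bar>measure M A - measure N A\<bar>)"

text \<open>
  The second parameter is the variance. Only \<open>v > 0\<close> is meaningful: otherwise the masses do not
  add up to one and \<^const>\<open>embed_pmf\<close> is unspecified; for \<open>v > 0\<close> see \<open>pmf_discretized_normal\<close> below.
\<close>

definition discretized_normal :: "real \<Rightarrow> real \<Rightarrow> int pmf" where
  "discretized_normal \<mu> v = embed_pmf (\<lambda>z. measure (density lborel (normal_density \<mu> (sqrt v)))
     {real_of_int z - 1/2 ..< real_of_int z + 1/2})"

lemma pmf_discretized_normal:
  assumes "v > 0"
  shows "pmf (discretized_normal \<mu> v) z = measure (density lborel (normal_density \<mu> (sqrt v)))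
     {real_of_int z - 1/2 ..< real_of_int z + 1/2}"
proof -
  define N where "N = density lborel (normal_density \<mu> (sqrt v))"
  define X where "X = (\<lambda>z::int. {real_of_int z - 1/2 ..< real_of_int z + 1/2})"
  interpret prob_space N
    unfolding N_def using assms by (intro prob_space_normal_density) simp
  have sets: "X z \<in> sets N" for z by (simp add: N_def X_def)
  have "disjoint_family X"
    unfolding disjoint_family_on_def
  proof safe
    fix z w x assume "z \<noteq> w" "x \<in> X z" "x \<in> X w"
    then have "\<lfloor>x + 1/2\<rfloor> = z" "\<lfloor>x + 1/2\<rfloor> = w"
      by (auto simp: X_def intro!: floor_unique)
    with \<open>z \<noteq> w\<close> show "x \<in> {}" by simp
  qed
  then have "emeasure N (\<Union>z. X z) = (\<integral>\<^sup>+z. emeasure N (X z) \<partial>count_space UNIV)"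
    using sets by (intro emeasure_UN_countable) auto
  moreover have "(\<Union>z. X z) = space N"
  proof -
    have "x \<in> X \<lfloor>x + 1/2\<rfloor>" for x
      using of_int_floor_le[of "x + 1/2"] real_of_int_floor_add_one_gt[of "x + 1/2"]
      by (simp add: X_def) linarith
    then show ?thesis by (auto simp: N_def)
  qed
  ultimately have "(\<integral>\<^sup>+z. ennreal (measure N (X z)) \<partial>count_space UNIV) = 1"
    by (simp add: emeasure_eq_measure prob_space)
  then show ?thesis
    unfolding discretized_normal_def N_def X_def by (intro pmf_embed_pmf) auto
qed

text \<open>
  Balls and urns are numbered from 0; an outcome maps each ball \<open>b < n\<close> to its urn. The dummy
  value 0 which \<^const>\<open>Pi_pmf\<close> assigns to arguments \<open>b \<ge> n\<close> is never inspected.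
\<close>

definition allocation_pmf :: "nat \<Rightarrow> nat \<Rightarrow> (nat \<Rightarrow> nat) pmf" where
  "allocation_pmf n m = Pi_pmf {..<n} 0 (\<lambda>_. pmf_of_set {..<m})"

definition urns_with_exactly :: "nat \<Rightarrow> nat \<Rightarrow> nat \<Rightarrow> (nat \<Rightarrow> nat) \<Rightarrow> nat" where
  "urns_with_exactly d n m \<omega> = card {u. u < m \<and> card {b. b < n \<and> \<omega> b = u} = d}"

definition multinomial_dd :: "nat \<Rightarrow> nat \<Rightarrow> real" where
  "multinomial_dd n d =
     (if n < 2 * d then 0 else fact n / (fact d * fact d * fact (n - 2 * d)))"

end

theory Submission
  imports Defs
begin

text \<open>
  Stein's method, driven by moving a single ball. Let \<open>S\<close> be the number of urns with \<open>d\<close> balls among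
  \<open>n\<close> balls, \<open>Y\<close> the configuration of the first \<open>n - 1\<close> balls and \<open>T\<close> its number of urns with \<open>d\<close>
  balls. If \<open>\<delta>\<close> solves the Stein equation of the binomial law of one urn with the indicator of \<open>d\<close> on the
  right-hand side, then \<open>E (S - \<mu>) f(S)\<close> equals \<open>n\<close> times the mean of the covariance, over a random urn
  \<open>v\<close> with \<open>M v\<close> balls in \<open>Y\<close>, of \<open>\<delta> (M v)\<close> and \<open>f\<close> of the count after adding a ball to \<open>v\<close>. This is a
  combination of \<open>f(T + 1) - f(T)\<close> and \<open>f(T) - f(T - 1)\<close> whose random coefficients concentrate, so that
  up to errors of order \<open>1/\<sigma>\<close> it may be replaced by \<open>\<sigma>\<^sup>2 E (f(T + 1) - f(T))\<close>; here \<open>f\<close> is the solution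
  of the normal Stein equation for the indicator of a union of unit cells around integers.

  As \<open>f'\<close> jumps between cells, one needs \<open>d\<^sub>T\<^sub>V(T, T + 1) = O(1/\<sigma>)\<close>. This comes from reversibility:
  averaging over moves that change the count by \<open>+1\<close> or \<open>-1\<close> gives \<open>E (up g(T)) = E (down g(T - 1))\<close>
  with concentrated rates of equal mean. Taking \<open>g\<close> linear, the same identity bounds \<open>\<sigma>\<close> from below.
\<close>

subsection \<open>Expectations over occupancy counts\<close>

text \<open>The difference of the means of the two coefficients is exactly the variance, but each
  mean is controlled only up to a factor of order \<open>(1 + n / m)^2\<close> times the variance.
  Replacing the coefficients by their means therefore leaves a large multiple of a second difference
  of \<open>f\<close>. That difference is not small pointwise; it is small in mean because the law
  of \<open>T\<close> is smooth, and this is why the shift bound is indispensable.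

  The shift bound needs rates whose mean is of the order of the mean count, so the occupancies
  \<open>d - 1\<close> and \<open>d\<close> must not carry almost all the mass of the binomial law
  of one urn. When there are few balls per urn, the missing mass sits at \<open>d - 2\<close>, which
  exists because \<open>d \<ge> 2\<close>.

  The lower bound for \<sigma> loses a factor \<open>sqrt (1 + n / m)\<close> against the square
  root of the mean. Together with the size of the coefficients this gives the power 5/2 of
  \<open>1 + n / m\<close>, rounded up to the cube. With few balls, few urns, a small mean or a
  small variance, \<sigma> is bounded in terms of \<open>d\<close>, and the claim follows from the
  trivial bound 1 on the distance.\<close>

lemma expectation_bind_finite:
  fixes h :: "'b \<Rightarrow> real"
  assumes "finite (set_pmf p)" and "\<And>x. finite (set_pmf (f x))"
  shows "measure_pmf.expectation (bind_pmf p f) h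
    = measure_pmf.expectation p (\<lambda>x. measure_pmf.expectation (f x) h)"
  using assms by (subst pmf_expectation_bind[of "set_pmf p"], simp_all)
    (subst integral_measure_pmf[of "set_pmf p"], simp_all)

locale urns =
  fixes m :: nat
  assumes m_ge_2: "2 \<le> m"
begin

definition avg :: "(nat \<Rightarrow> real) \<Rightarrow> real" where
  "avg F = (\<Sum>v<m. F v) / real m"

definition add_ball :: "(nat \<Rightarrow> nat) \<Rightarrow> nat \<Rightarrow> nat \<Rightarrow> nat" where
  "add_ball M v = M(v := Suc (M v))"

text \<open>Conditioning on all balls but the last: the occupancy vector arises by throwing one ball
  at a time into a uniform urn. With this finite recursion linear properties become inductions;
  \<open>expectation_allocation\<close> ties it to the original model.\<close>

primrec expect :: "nat \<Rightarrow> ((nat \<Rightarrow> nat) \<Rightarrow> real) \<Rightarrow> real" where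
  "expect 0 H = H (\<lambda>_. 0)"
| "expect (Suc n) H = expect n (\<lambda>M. avg (\<lambda>v. H (add_ball M v)))"

lemma m_pos [simp]: "0 < m" "m \<noteq> 0" "1 \<le> m" "Suc 0 \<le> m"
  using m_ge_2 by auto

lemma avg_const [simp]: "avg (\<lambda>_. c) = c"
  by (simp add: avg_def)

lemma avg_add: "avg (\<lambda>v. F v + G v) = avg F + avg G"
  by (simp add: avg_def sum.distrib add_divide_distrib)

lemma avg_diff: "avg (\<lambda>v. F v - G v) = avg F - avg G"
  by (simp add: avg_def sum_subtractf diff_divide_distrib)

lemma avg_cmult: "avg (\<lambda>v. c * F v) = c * avg F"
  by (simp add: avg_def sum_distrib_left)

lemma avg_mult: "avg (\<lambda>v. F v * c) = avg F * c"
  by (simp add: avg_def sum_distrib_right)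

lemma avg_mono: "(\<And>v. v < m \<Longrightarrow> F v \<le> G v) \<Longrightarrow> avg F \<le> avg G"
  unfolding avg_def by (intro divide_right_mono sum_mono) auto

lemma avg_cong: "(\<And>v. v < m \<Longrightarrow> F v = G v) \<Longrightarrow> avg F = avg G"
  by (simp add: avg_def)

lemma avg_commute: "avg (\<lambda>v. avg (\<lambda>w. F v w)) = avg (\<lambda>w. avg (\<lambda>v. F v w))"
  unfolding avg_def sum_divide_distrib by (rule sum.swap)

lemma avg_sum: "avg (\<lambda>v. \<Sum>u\<in>A. F v u) = (\<Sum>u\<in>A. avg (\<lambda>v. F v u))"
  unfolding avg_def sum_divide_distrib by (rule sum.swap)

lemma avg_delta: "u < m \<Longrightarrow> avg (\<lambda>v. if v = u then x v else 0) = x u / m"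
  by (simp add: avg_def)

lemma avg_abs: "\<bar>avg F\<bar> \<le> avg (\<lambda>v. \<bar>F v\<bar>)"
  unfolding avg_def by (auto intro!: divide_right_mono)

lemma avg_abs_le: "(\<And>v. v < m \<Longrightarrow> \<bar>F v\<bar> \<le> c) \<Longrightarrow> \<bar>avg F\<bar> \<le> c"
  using avg_abs[of F] avg_mono[of "\<lambda>v. \<bar>F v\<bar>" "\<lambda>_. c"] by simp

lemma sum_add_ball: "v < m \<Longrightarrow> (\<Sum>u<m. add_ball M v u) = Suc (\<Sum>u<m. M u)"
proof -
  assume v: "v < m"
  have "(\<Sum>u<m. add_ball M v u) = (\<Sum>u<m. M u + (if u = v then 1 else 0))"
    by (intro sum.cong) (auto simp: add_ball_def)
  also have "\<dots> = Suc (\<Sum>u<m. M u)" using v by (simp add: sum.distrib)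
  finally show ?thesis .
qed

text \<open>Restricting the premise to configurations with \<open>n\<close> balls lets later
  pointwise estimates use the total.\<close>

lemma expect_mono:
  "(\<And>M. (\<Sum>u<m. M u) = n \<Longrightarrow> F M \<le> G M) \<Longrightarrow> expect n F \<le> expect n G"
proof (induction n arbitrary: F G)
  case (Suc n)
  show ?case unfolding expect.simps
    by (intro Suc.IH avg_mono Suc.prems) (simp add: sum_add_ball)
qed simp

lemma expect_cong:
  "(\<And>M. (\<Sum>u<m. M u) = n \<Longrightarrow> F M = G M) \<Longrightarrow> expect n F = expect n G"
  by (intro antisym expect_mono) auto

lemma expect_const [simp]: "expect n (\<lambda>_. c) = c"
  by (induction n) auto

lemma expect_add: "expect n (\<lambda>M. F M + G M) = expect n F + expect n G"
  by (induction n arbitrary: F G) (auto simp: avg_add)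

lemma expect_diff: "expect n (\<lambda>M. F M - G M) = expect n F - expect n G"
  by (induction n arbitrary: F G) (auto simp: avg_diff)

lemma expect_cmult: "expect n (\<lambda>M. c * F M) = c * expect n F"
  by (induction n arbitrary: F) (auto simp: avg_cmult)

lemma expect_mult: "expect n (\<lambda>M. F M * c) = expect n F * c"
  by (induction n arbitrary: F) (auto simp: avg_mult)

lemma expect_divide: "expect n (\<lambda>M. F M / c) = expect n F / c"
  using expect_mult[of n F "inverse c"] by (simp add: divide_inverse)

lemma expect_sum: "expect n (\<lambda>M. \<Sum>u\<in>A. F M u) = (\<Sum>u\<in>A. expect n (\<lambda>M. F M u))"
  by (induction n arbitrary: F) (auto simp: avg_sum)

lemma expect_avg: "expect n (\<lambda>M. avg (F M)) = avg (\<lambda>v. expect n (\<lambda>M. F M v))"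
  by (simp add: avg_def expect_sum expect_divide)

lemma expect_nonneg: "(\<And>M. (\<Sum>u<m. M u) = n \<Longrightarrow> 0 \<le> F M) \<Longrightarrow> 0 \<le> expect n F"
  using expect_mono[of n "\<lambda>_. 0" F] by simp

lemma expect_abs: "\<bar>expect n F\<bar> \<le> expect n (\<lambda>M. \<bar>F M\<bar>)"
proof -
  have "expect n F \<le> expect n (\<lambda>M. \<bar>F M\<bar>)" "expect n (\<lambda>M. - 1 * F M) \<le> expect n (\<lambda>M. \<bar>F M\<bar>)"
    by (intro expect_mono; simp)+
  then show ?thesis unfolding expect_cmult by simp
qed

lemma expect_Cauchy_Schwarz:
  "\<bar>expect n (\<lambda>M. F M * G M)\<bar> \<le> sqrt (expect n (\<lambda>M. (F M)\<^sup>2)) * sqrt (expect n (\<lambda>M. (G M)\<^sup>2))"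
proof -
  define a b c where "a = expect n (\<lambda>M. (F M)\<^sup>2)" and "b = expect n (\<lambda>M. (G M)\<^sup>2)"
    and "c = expect n (\<lambda>M. F M * G M)"
  have *: "0 \<le> x\<^sup>2 * a - 2 * (x * y) * c + y\<^sup>2 * b" for x y
  proof -
    have "0 \<le> expect n (\<lambda>M. (x * F M - y * G M)\<^sup>2)" by (intro expect_nonneg) simp
    also have "\<dots> = expect n (\<lambda>M. x\<^sup>2 * (F M)\<^sup>2 - 2 * (x * y) * (F M * G M) + y\<^sup>2 * (G M)\<^sup>2)"
      by (intro expect_cong) (simp add: power2_eq_square algebra_simps)
    finally show ?thesis by (simp add: expect_add expect_diff expect_cmult a_def b_def c_def)
  qed
  have "0 \<le> a" "0 \<le> b" unfolding a_def b_def by (intro expect_nonneg; simp)+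
  have "c\<^sup>2 \<le> a * b"
  proof (cases "b = 0")
    case True
    have "c = 0"
    proof (rule ccontr)
      assume "c \<noteq> 0"
      \<comment> \<open>With \<open>b = 0\<close> the form is affine in \<open>y\<close>, and this
        \<open>y\<close> makes it equal to \<open>-1\<close>.\<close>
      have "0 \<le> a - 2 * ((a + 1) / (2 * c)) * c" using *[of 1 "(a + 1) / (2 * c)"] True by simp
      with \<open>c \<noteq> 0\<close> show False by simp
    qed
    with \<open>0 \<le> a\<close> \<open>0 \<le> b\<close> show ?thesis by simp
  next
    case False
    have "0 \<le> b * (a * b - c\<^sup>2)" using *[of b c] by (simp add: power2_eq_square algebra_simps)
    with False \<open>0 \<le> b\<close> show ?thesis by (simp add: zero_le_mult_iff)
  qed
  then have "sqrt (c\<^sup>2) \<le> sqrt (a * b)" by (rule real_sqrt_le_mono)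
  then show ?thesis by (simp add: a_def b_def c_def real_sqrt_mult)
qed

lemma expect_abs_le_sqrt: "expect n (\<lambda>M. \<bar>F M\<bar>) \<le> sqrt (expect n (\<lambda>M. (F M)\<^sup>2))"
  using expect_Cauchy_Schwarz[of n "\<lambda>M. \<bar>F M\<bar>" "\<lambda>_. 1"] by simp

text \<open>The mean is the best constant predictor in mean square, so later variance bounds may be
  computed around an explicit centre instead of the exact mean.\<close>

lemma expect_deviation_mono:
  assumes "a = expect n F"
  shows "expect n (\<lambda>M. (F M - a)\<^sup>2) \<le> expect n (\<lambda>M. (F M - b)\<^sup>2)"
proof -
  have "expect n (\<lambda>M. (F M - b)\<^sup>2)
    = expect n (\<lambda>M. (F M - a)\<^sup>2 + (2 * (a - b)) * (F M - a) + (a - b)\<^sup>2)"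
    by (intro expect_cong) (simp add: power2_eq_square algebra_simps)
  also have "\<dots> = expect n (\<lambda>M. (F M - a)\<^sup>2) + (a - b)\<^sup>2"
    by (simp add: expect_add expect_diff expect_cmult assms)
  finally show ?thesis by simp
qed

text \<open>The left side sums \<open>\<Psi>\<close> over the balls, each contributing through the
  urn that holds it. Balls are exchangeable, so each of the \<open>Suc n\<close> may be regarded as
  the last one thrown. In the induction the newest ball supplies one term; the others come from the
  hypothesis for \<open>\<Psi>\<close> averaged over the newest ball.\<close>

lemma expect_transport:
  "expect (Suc n) (\<lambda>M. \<Sum>u<m. real (M u) * \<Psi> M u)
    = real (Suc n) * expect n (\<lambda>M. avg (\<lambda>v. \<Psi> (add_ball M v) v))"
proof (induction n arbitrary: \<Psi>)
  case 0
  have "avg (\<lambda>v. \<Sum>u<m. real (add_ball (\<lambda>_. 0) v u) * \<Psi> (add_ball (\<lambda>_. 0) v) u)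
      = avg (\<lambda>v. \<Sum>u<m. if u = v then \<Psi> (add_ball (\<lambda>_. 0) v) v else 0)"
    by (intro avg_cong sum.cong) (auto simp: add_ball_def)
  also have "\<dots> = avg (\<lambda>v. \<Psi> (add_ball (\<lambda>_. 0) v) v)"
    by (intro avg_cong) simp
  finally show ?case by simp
next
  case (Suc n)
  let ?\<Psi>' = "\<lambda>M u. avg (\<lambda>v. \<Psi> (add_ball M v) u)"
  have swap: "add_ball (add_ball M v) w = add_ball (add_ball M w) v" for M v w
    by (auto simp: add_ball_def fun_eq_iff)
  have "expect (Suc (Suc n)) (\<lambda>M. \<Sum>u<m. real (M u) * \<Psi> M u)
     = expect (Suc n) (\<lambda>M. avg (\<lambda>v. \<Sum>u<m. real (add_ball M v u) * \<Psi> (add_ball M v) u))"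
    by simp
  also have "\<dots> = expect (Suc n) (\<lambda>M. avg (\<lambda>v. (\<Sum>u<m. real (M u) * \<Psi> (add_ball M v) u)
       + \<Psi> (add_ball M v) v))"
  proof (intro expect_cong avg_cong)
    fix M v assume "v < m"
    have "(\<Sum>u<m. real (add_ball M v u) * \<Psi> (add_ball M v) u)
       = (\<Sum>u<m. real (M u) * \<Psi> (add_ball M v) u + (if u = v then \<Psi> (add_ball M v) v else 0))"
      by (intro sum.cong) (auto simp: add_ball_def algebra_simps)
    with \<open>v < m\<close> show "(\<Sum>u<m. real (add_ball M v u) * \<Psi> (add_ball M v) u)
       = (\<Sum>u<m. real (M u) * \<Psi> (add_ball M v) u) + \<Psi> (add_ball M v) v"
      by (simp add: sum.distrib)
  qed
  also have "\<dots> = expect (Suc n) (\<lambda>M. \<Sum>u<m. real (M u) * ?\<Psi>' M u)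
      + expect (Suc n) (\<lambda>M. avg (\<lambda>v. \<Psi> (add_ball M v) v))"
    by (simp only: avg_add avg_sum avg_cmult expect_add)
  also have "expect (Suc n) (\<lambda>M. \<Sum>u<m. real (M u) * ?\<Psi>' M u)
     = real (Suc n) * expect n (\<lambda>M. avg (\<lambda>w. avg (\<lambda>v. \<Psi> (add_ball (add_ball M w) v) w)))"
    by (rule Suc.IH)
  also have "expect n (\<lambda>M. avg (\<lambda>w. avg (\<lambda>v. \<Psi> (add_ball (add_ball M w) v) w)))
     = expect (Suc n) (\<lambda>M. avg (\<lambda>v. \<Psi> (add_ball M v) v))"
    by (subst avg_commute) (simp add: swap)
  finally show ?case by (simp add: algebra_simps)
qed

text \<open>Martingale argument: conditioning on the balls one by one splits the variance into
  orthogonal increments, each at most \<open>c\<^sup>2\<close>.\<close>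

lemma expect_bounded_difference:
  assumes "\<And>M v w. v < m \<Longrightarrow> w < m \<Longrightarrow> \<bar>F (add_ball M v) - F (add_ball M w)\<bar> \<le> c"
  shows "expect n (\<lambda>M. (F M - expect n F)\<^sup>2) \<le> real n * c\<^sup>2"
  using assms
proof (induction n arbitrary: F)
  case (Suc n)
  define G where "G M = avg (\<lambda>v. F (add_ball M v))" for M
  have c: "0 \<le> c" using Suc.prems[of 0 0 undefined] by simp
  have dev: "\<bar>F (add_ball M v) - G M\<bar> \<le> c" if "v < m" for M v
  proof -
    have "F (add_ball M v) - G M = avg (\<lambda>w. F (add_ball M v) - F (add_ball M w))"
      by (simp add: avg_diff G_def)
    then show ?thesis using that Suc.prems by (auto intro!: avg_abs_le)
  qed
  have IH: "expect n (\<lambda>M. (G M - expect n G)\<^sup>2) \<le> real n * c\<^sup>2"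
  proof (rule Suc.IH)
    fix M v w assume vw: "v < m" "w < m"
    have swap: "add_ball (add_ball M v) x = add_ball (add_ball M x) v" for M v x
      by (auto simp: add_ball_def fun_eq_iff)
    show "\<bar>G (add_ball M v) - G (add_ball M w)\<bar> \<le> c"
      unfolding G_def avg_diff[symmetric] swap[of M v] swap[of M w]
      by (intro avg_abs_le Suc.prems vw)
  qed
  define a where "a = expect n G"
  have "avg (\<lambda>v. (F (add_ball M v) - a)\<^sup>2) \<le> (G M - a)\<^sup>2 + c\<^sup>2" for M
  proof -
    have "avg (\<lambda>v. (F (add_ball M v) - a)\<^sup>2)
       = avg (\<lambda>v. ((F (add_ball M v) - G M)\<^sup>2 + (2 * (G M - a)) * (F (add_ball M v) - G M)) + (G M - a)\<^sup>2)"
      by (intro avg_cong) (simp add: power2_eq_square algebra_simps)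
    \<comment> \<open>The cross term vanishes because \<open>G M\<close> is the mean over the last
      ball.\<close>
    also have "\<dots> = avg (\<lambda>v. (F (add_ball M v) - G M)\<^sup>2) + (G M - a)\<^sup>2"
      by (simp add: avg_add avg_cmult avg_diff G_def)
    also have "avg (\<lambda>v. (F (add_ball M v) - G M)\<^sup>2) \<le> avg (\<lambda>_. c\<^sup>2)"
      using dev c by (intro avg_mono) (simp add: abs_le_square_iff[symmetric])
    finally show ?thesis by simp
  qed
  then have "expect (Suc n) (\<lambda>M. (F M - a)\<^sup>2) \<le> expect n (\<lambda>M. (G M - a)\<^sup>2 + c\<^sup>2)"
    by (simp add: expect_mono)
  also have "\<dots> \<le> real n * c\<^sup>2 + c\<^sup>2" using IH by (simp add: expect_add a_def)
  finally show ?case by (simp add: a_def G_def[abs_def] algebra_simps)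
qed simp

lemma expectation_allocation:
  "measure_pmf.expectation (allocation_pmf n m) (\<lambda>\<omega>. H (\<lambda>u. card {b. b < n \<and> \<omega> b = u}))
    = expect n H"
proof (induction n arbitrary: H)
  case 0
  then show ?case by (simp add: allocation_pmf_def)
next
  case (Suc n)
  have fin: "finite (set_pmf (allocation_pmf n m))"
    unfolding allocation_pmf_def
    by (intro finite_subset[OF set_Pi_pmf_subset'] finite_PiE_dflt) (auto simp: lessThan_empty_iff)
  have count: "(\<lambda>u. card {b. b < Suc n \<and> (fun_upd \<omega> n v) b = u})
      = add_ball (\<lambda>u. card {b. b < n \<and> \<omega> b = u}) v" for \<omega> :: "nat \<Rightarrow> nat" and v
  proof
    fix u
    have "{b. b < Suc n \<and> (fun_upd \<omega> n v) b = u}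
      = (if u = v then insert n {b. b < n \<and> \<omega> b = u} else {b. b < n \<and> \<omega> b = u})"
      by (auto simp: less_Suc_eq)
    then show "card {b. b < Suc n \<and> (fun_upd \<omega> n v) b = u} = add_ball (\<lambda>u. card {b. b < n \<and> \<omega> b = u}) v u"
      by (simp add: add_ball_def)
  qed
  \<comment> \<open>\<open>Pi_pmf_insert\<close> draws the new ball first; commuting the independent
    draws puts it last, as in the recursion of \<open>expect\<close>.\<close>
  have "allocation_pmf (Suc n) m =
      bind_pmf (allocation_pmf n m) (\<lambda>\<omega>. map_pmf (\<lambda>v. fun_upd \<omega> n v) (pmf_of_set {..<m}))"
    unfolding allocation_pmf_def lessThan_Suc
    by (subst Pi_pmf_insert) (auto simp: pair_pmf_def map_bind_pmf bind_return_pmf map_pmf_def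
        bind_assoc_pmf bind_commute_pmf[of "pmf_of_set {..<m}"])
  then have "measure_pmf.expectation (allocation_pmf (Suc n) m)
       (\<lambda>\<omega>. H (\<lambda>u. card {b. b < Suc n \<and> \<omega> b = u}))
     = measure_pmf.expectation (allocation_pmf n m) (\<lambda>\<omega>.
         measure_pmf.expectation (map_pmf (\<lambda>v. fun_upd \<omega> n v) (pmf_of_set {..<m}))
         (\<lambda>\<omega>. H (\<lambda>u. card {b. b < Suc n \<and> \<omega> b = u})))"
    using fin by (simp only:) (rule expectation_bind_finite; simp add: lessThan_empty_iff)
  also have "\<dots> = measure_pmf.expectation (allocation_pmf n m) (\<lambda>\<omega>.
     avg (\<lambda>v. H (add_ball (\<lambda>u. card {b. b < n \<and> \<omega> b = u}) v)))"
    by (simp add: count avg_def integral_pmf_of_set lessThan_empty_iff del: fun_upd_apply)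
  also have "\<dots> = expect (Suc n) H"
    unfolding expect.simps by (rule Suc.IH)
  finally show ?case .
qed


subsection \<open>Occupancy of one and of two urns\<close>

definition share :: "nat \<Rightarrow> (nat \<Rightarrow> nat) \<Rightarrow> real" where
  "share j M = avg (\<lambda>u. of_bool (M u = j))"

definition occ_prob :: "nat \<Rightarrow> nat \<Rightarrow> real" where
  "occ_prob n j = real (n choose j) * (1 / real m) ^ j * (1 - 1 / real m) ^ (n - j)"

text \<open>Trinomial mass for two given urns. When \<open>n < i + j\<close> a binomial coefficient
  vanishes, so the truncated exponent does no harm.\<close>

definition occ_prob2 :: "nat \<Rightarrow> nat \<Rightarrow> nat \<Rightarrow> real" where
  "occ_prob2 n i j = real (n choose i) * real ((n - i) choose j) * (1 / real m) ^ (i + j)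
     * (1 - 2 / real m) ^ (n - (i + j))"

lemma share_nonneg: "0 \<le> share j M"
  using avg_mono[of "\<lambda>_. 0" "\<lambda>u. of_bool (M u = j)"] by (simp add: share_def)

lemma share_le_1: "share j M \<le> 1"
  using avg_mono[of "\<lambda>u. of_bool (M u = j)" "\<lambda>_. 1"] by (simp add: share_def)

lemma share_add_le_1: "i \<noteq> j \<Longrightarrow> share i M + share j M \<le> 1"
  unfolding share_def avg_add[symmetric]
  by (rule order_trans[OF avg_mono[of _ "\<lambda>_. 1"]]) auto

lemma share_eq_card: "real m * share j M = real (card {u. u < m \<and> M u = j})"
proof -
  have "(\<Sum>u<m. of_bool (M u = j) :: real) = real (card {u \<in> {..<m}. M u = j})"
    by (simp add: of_bool_def sum.If_cases Int_def)
  then show ?thesis by (simp add: share_def avg_def)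
qed

lemma occ_prob_nonneg: "0 \<le> occ_prob n j"
  unfolding occ_prob_def by (intro mult_nonneg_nonneg zero_le_power) auto

lemma occ_prob2_nonneg: "0 \<le> occ_prob2 n i j"
  using m_ge_2 unfolding occ_prob2_def by (intro mult_nonneg_nonneg zero_le_power) auto

lemma occ_prob_Suc:
  "occ_prob (Suc n) j
    = (1 / m) * (if j = 0 then 0 else occ_prob n (j - 1)) + (1 - 1 / m) * occ_prob n j"
proof (cases j)
  case (Suc i)
  define x y where "x = 1 / real m" and "y = 1 - 1 / real m"
  have occ: "occ_prob k j = real (k choose j) * x ^ j * y ^ (k - j)" for k j
    by (simp add: occ_prob_def x_def y_def)
  consider "i < n" | "i = n" | "n < i" by linarith
  then show ?thesis
  proof cases
    case 1
    then have *: "n - i = Suc (n - Suc i)" by simp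
    show ?thesis unfolding occ y_def[symmetric] unfolding x_def[symmetric] by (simp add: Suc * algebra_simps)
  qed (simp_all add: occ_prob_def Suc binomial_eq_0)
qed (simp add: occ_prob_def)

lemma avg_of_bool_eq: "u < m \<Longrightarrow> avg (\<lambda>v. of_bool (v = u)) = 1 / m"
  using avg_delta[of u "\<lambda>_. 1"] by (simp add: of_bool_def)

lemma expect_occupancy: "u < m \<Longrightarrow> expect n (\<lambda>M. of_bool (M u = j)) = occ_prob n j"
proof (induction n arbitrary: j)
  case 0
  then show ?case by (cases j) (simp_all add: occ_prob_def)
next
  case (Suc n)
  have "avg (\<lambda>v. of_bool (add_ball M v u = j))
     = avg (\<lambda>v. of_bool (v = u) * (of_bool (Suc (M u) = j) - of_bool (M u = j)) + of_bool (M u = j))"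
    for M by (intro avg_cong) (auto simp: add_ball_def)
  then have "expect (Suc n) (\<lambda>M. of_bool (M u = j))
     = expect n (\<lambda>M. (1 / m) * (of_bool (Suc (M u) = j) - of_bool (M u = j)) + of_bool (M u = j))"
    using Suc.prems by (simp add: avg_add avg_mult avg_of_bool_eq)
  also have "expect n (\<lambda>M. of_bool (Suc (M u) = j)) = (if j = 0 then 0 else occ_prob n (j - 1))"
    using Suc by (cases j) auto
  then have "expect n (\<lambda>M. (1 / m) * (of_bool (Suc (M u) = j) - of_bool (M u = j)) + of_bool (M u = j))
     = (1 / m) * ((if j = 0 then 0 else occ_prob n (j - 1)) - occ_prob n j) + occ_prob n j"
    using Suc by (simp add: expect_add expect_diff expect_divide)
  also have "\<dots> = occ_prob (Suc n) j" by (simp add: occ_prob_Suc algebra_simps diff_divide_distrib)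
  finally show ?case .
qed

lemma expect_share: "expect n (share j) = occ_prob n j"
proof -
  have "expect n (share j) = avg (\<lambda>u. occ_prob n j)"
    unfolding share_def[abs_def] expect_avg by (intro avg_cong) (simp add: expect_occupancy)
  then show ?thesis by simp
qed

lemma occ_prob_le_1: "occ_prob n j \<le> 1"
  using expect_mono[of n "share j" "\<lambda>_. 1"] by (simp add: share_le_1 expect_share)

text \<open>Condition on the last ball: it falls into the first urn, the second, or neither. The
  case distinctions only deal with truncated subtraction: wherever an exponent is cut off, a
  binomial coefficient is zero.\<close>

lemma occ_prob2_Suc:
  "occ_prob2 (Suc n) i j
    = (1 / m) * (if i = 0 then 0 else occ_prob2 n (i - 1) j)
      + (1 / m) * (if j = 0 then 0 else occ_prob2 n i (j - 1))
      + (1 - 2 / m) * occ_prob2 n i j"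
proof -
  define x y where "x = 1 / real m" and "y = 1 - 2 / real m"
  have occ: "occ_prob2 k i j = real (k choose i) * real (k - i choose j) * x ^ (i + j) * y ^ (k - (i + j))"
    for k i j by (simp add: occ_prob2_def x_def y_def)
  have "occ_prob2 (Suc n) i j
    = x * (if i = 0 then 0 else occ_prob2 n (i - 1) j)
      + x * (if j = 0 then 0 else occ_prob2 n i (j - 1)) + y * occ_prob2 n i j" (is ?goal)
  proof (cases i; cases j)
    assume "i = 0" "j = 0" then show ?goal by (simp add: occ)
  next
    fix k assume [simp]: "i = 0" "j = Suc k"
    show ?goal
    proof (cases "k < n")
      case True
      then have *: "n - k = Suc (n - Suc k)" by simp
      show ?goal by (simp add: occ * algebra_simps)
    qed (auto simp: occ binomial_eq_0 not_less le_less)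
  next
    fix k assume [simp]: "i = Suc k" "j = 0"
    show ?goal
    proof (cases "k < n")
      case True
      then have *: "n - k = Suc (n - Suc k)" by simp
      show ?goal by (simp add: occ * algebra_simps)
    qed (auto simp: occ binomial_eq_0 not_less le_less)
  next
    fix k l assume [simp]: "i = Suc k" "j = Suc l"
    have split: "real (Suc n choose Suc k) * real (n - k choose Suc l)
       = real (n choose k) * real (n - k choose Suc l) + real (n choose Suc k) * real (n - Suc k choose l)
         + real (n choose Suc k) * real (n - Suc k choose Suc l)"
    proof (cases "k < n")
      case True
      then have *: "n - k = Suc (n - Suc k)" by simp
      show ?thesis unfolding * by (simp add: algebra_simps)
    qed (simp add: binomial_eq_0)
    have "C * E * y ^ (n - (k + l + 1)) = C * E * (y * y ^ (n - (k + l + 2)))"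
      if "C = real (n choose Suc k)" "E = real (n - Suc k choose Suc l)" for C E
    proof (cases "k + l + 2 \<le> n")
      case True
      then have "n - (k + l + 1) = Suc (n - (k + l + 2))" by simp
      then show ?thesis by simp
    next
      case False
      then have "n < Suc k \<or> n - Suc k < Suc l" by linarith
      with that show ?thesis by (auto simp: binomial_eq_0)
    qed
    then have last: "x ^ (k + l + 2) * (real (n choose Suc k) * real (n - Suc k choose Suc l) * y ^ (n - (k + l + 1)))
        = y * occ_prob2 n i j" by (simp add: occ)
    have "occ_prob2 (Suc n) i j = (real (Suc n choose Suc k) * real (n - k choose Suc l))
        * (x ^ (k + l + 2) * y ^ (n - (k + l + 1)))"
      by (simp add: occ)
    also have "\<dots> = real (n choose k) * real (n - k choose Suc l) * (x ^ (k + l + 2) * y ^ (n - (k + l + 1)))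
      + real (n choose Suc k) * real (n - Suc k choose l) * (x ^ (k + l + 2) * y ^ (n - (k + l + 1)))
      + x ^ (k + l + 2) * (real (n choose Suc k) * real (n - Suc k choose Suc l) * y ^ (n - (k + l + 1)))"
      unfolding split by (simp only: distrib_right distrib_left mult_ac)
    also have "\<dots> = x * occ_prob2 n k j + x * occ_prob2 n i l + y * occ_prob2 n i j"
      unfolding last by (simp add: occ)
    finally show ?goal by simp
  qed
  then show ?thesis by (simp only: x_def y_def)
qed

lemma expect_occupancy2:
  "u < m \<Longrightarrow> w < m \<Longrightarrow> u \<noteq> w \<Longrightarrow>
    expect n (\<lambda>M. of_bool (M u = i) * of_bool (M w = j)) = occ_prob2 n i j"
proof (induction n arbitrary: i j)
  case 0
  then show ?case by (cases i; cases j) (simp_all add: occ_prob2_def)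
next
  case (Suc n)
  let ?a = "\<lambda>M. of_bool (M u = i) :: real" and ?a' = "\<lambda>M. of_bool (Suc (M u) = i) :: real"
  let ?b = "\<lambda>M. of_bool (M w = j) :: real" and ?b' = "\<lambda>M. of_bool (Suc (M w) = j) :: real"
  have "avg (\<lambda>v. of_bool (add_ball M v u = i) * of_bool (add_ball M v w = j))
     = avg (\<lambda>v. of_bool (v = u) * ((?a' M - ?a M) * ?b M) + of_bool (v = w) * (?a M * (?b' M - ?b M))
         + ?a M * ?b M)" for M
    using Suc.prems by (intro avg_cong) (auto simp: add_ball_def)
  then have "expect (Suc n) (\<lambda>M. ?a M * ?b M)
     = expect n (\<lambda>M. (1 / m) * (?a' M * ?b M) + (1 / m) * (?a M * ?b' M) + (1 - 2 / m) * (?a M * ?b M))"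
    using Suc.prems
    by (simp add: avg_add avg_mult avg_of_bool_eq) (simp add: algebra_simps add_divide_distrib diff_divide_distrib)
  also have "expect n (\<lambda>M. ?a' M * ?b M) = (if i = 0 then 0 else occ_prob2 n (i - 1) j)"
    using Suc by (cases i) auto
  moreover have "expect n (\<lambda>M. ?a M * ?b' M) = (if j = 0 then 0 else occ_prob2 n i (j - 1))"
    using Suc by (cases j) auto
  ultimately have "expect (Suc n) (\<lambda>M. ?a M * ?b M)
      = (1 / m) * (if i = 0 then 0 else occ_prob2 n (i - 1) j)
      + (1 / m) * (if j = 0 then 0 else occ_prob2 n i (j - 1)) + (1 - 2 / m) * occ_prob2 n i j"
    using Suc.IH[OF Suc.prems] by (simp only: expect_add expect_cmult)
  then show ?case by (simp add: occ_prob2_Suc)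
qed

lemma expect_share_square:
  "expect n (\<lambda>M. (share j M)\<^sup>2) = occ_prob n j / m + (1 - 1 / m) * occ_prob2 n j j"
proof -
  have "expect n (\<lambda>M. (share j M)\<^sup>2)
     = expect n (\<lambda>M. avg (\<lambda>u. avg (\<lambda>w. of_bool (M u = j) * of_bool (M w = j))))"
    by (simp add: power2_eq_square share_def avg_mult avg_cmult)
  also have "\<dots> = avg (\<lambda>u. avg (\<lambda>w. expect n (\<lambda>M. of_bool (M u = j) * of_bool (M w = j))))"
    by (simp only: expect_avg)
  also have "\<dots> = avg (\<lambda>u. avg (\<lambda>w. of_bool (w = u) * (occ_prob n j - occ_prob2 n j j) + occ_prob2 n j j))"
  proof (intro avg_cong)
    fix u w assume "u < m" "w < m"
    then show "expect n (\<lambda>M. of_bool (M u = j) * of_bool (M w = j))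
      = of_bool (w = u) * (occ_prob n j - occ_prob2 n j j) + occ_prob2 n j j"
      using expect_occupancy[of u n j] expect_occupancy2[of u w n j j] by (cases "w = u") (auto simp flip: of_bool_conj)
  qed
  also have "\<dots> = avg (\<lambda>u. (occ_prob n j - occ_prob2 n j j) / m + occ_prob2 n j j)"
    by (intro avg_cong) (simp add: avg_add avg_mult avg_of_bool_eq)
  also have "\<dots> = occ_prob n j / m + (1 - 1 / m) * occ_prob2 n j j"
    by (simp add: algebra_simps diff_divide_distrib)
  finally show ?thesis .
qed

lemma expect_share_variance:
  "expect n (\<lambda>M. (share j M - occ_prob n j)\<^sup>2)
    = occ_prob n j / m + (1 - 1 / m) * occ_prob2 n j j - (occ_prob n j)\<^sup>2"
proof -
  have "expect n (\<lambda>M. (share j M - occ_prob n j)\<^sup>2)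
     = expect n (\<lambda>M. (share j M)\<^sup>2 - (2 * occ_prob n j) * share j M + (occ_prob n j)\<^sup>2)"
    by (intro expect_cong) (simp add: power2_eq_square algebra_simps)
  also have "\<dots> = expect n (\<lambda>M. (share j M)\<^sup>2) - (2 * occ_prob n j) * occ_prob n j + (occ_prob n j)\<^sup>2"
    using expect_share[of n j] by (simp add: expect_add expect_diff expect_cmult)
  finally show ?thesis unfolding expect_share_square by (simp add: power2_eq_square)
qed

text \<open>Two urns are almost negatively correlated: \<open>1 - 2 / m\<close> is at most the
  square of \<open>1 - 1 / m\<close>, and the binomial coefficients compare the same way. The
  exponents \<open>2 * (n - 2 * j)\<close> and \<open>2 * (n - j)\<close> differ by
  \<open>2 * j\<close>, which is the extra power on the left.\<close>

lemma occ_prob2_le: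
  "occ_prob2 n j j * (1 - 1 / m) ^ (2 * j) \<le> (occ_prob n j)\<^sup>2"
proof (cases "2 * j \<le> n")
  case True
  define x where "x = 1 - 1 / real m"
  have x: "0 \<le> x" using m_ge_2 by (simp add: x_def)
  have "1 - 2 / real m \<le> x\<^sup>2" by (simp add: x_def power2_eq_square algebra_simps)
  then have "(1 - 2 / real m) ^ (n - 2 * j) \<le> (x\<^sup>2) ^ (n - 2 * j)"
    using m_ge_2 by (intro power_mono) auto
  then have "(1 - 2 / real m) ^ (n - 2 * j) * x ^ (2 * j) \<le> (x\<^sup>2) ^ (n - 2 * j) * x ^ (2 * j)"
    using x by (intro mult_right_mono) auto
  also have "\<dots> = x ^ (2 * (n - 2 * j) + 2 * j)" by (simp only: power_mult power_add)
  also have "2 * (n - 2 * j) + 2 * j = (n - j) + (n - j)" using True by simp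
  finally have pow: "(1 - 2 / real m) ^ (n - 2 * j) * x ^ (2 * j) \<le> x ^ (n - j) * x ^ (n - j)"
    by (simp only: power_add)
  have bin: "real (n - j choose j) \<le> real (n choose j)"
    by (simp add: binomial_right_mono)
  have "real (n choose j) * real (n - j choose j) * ((1 - 2 / real m) ^ (n - 2 * j) * x ^ (2 * j))
     \<le> real (n choose j) * real (n choose j) * (x ^ (n - j) * x ^ (n - j))"
    using x m_ge_2 by (intro mult_mono bin pow mult_nonneg_nonneg zero_le_power) auto
  then have "(1 / real m) ^ (j + j) * (real (n choose j) * real (n - j choose j) * ((1 - 2 / real m) ^ (n - 2 * j) * x ^ (2 * j)))
     \<le> (1 / real m) ^ (j + j) * (real (n choose j) * real (n choose j) * (x ^ (n - j) * x ^ (n - j)))"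
    by (intro mult_left_mono) auto
  then show ?thesis
    unfolding mult_2 power_add
    by (simp add: occ_prob2_def occ_prob_def x_def power2_eq_square power_add mult_ac)
next
  case False
  then show ?thesis by (simp add: occ_prob2_def binomial_eq_0)
qed

end

text \<open>The constant of \<open>share_variance_le\<close>: the 1 is the diagonal part of the
  variance, the rest is \<open>2 * j * 4 ^ j\<close> from \<open>power_one_plus_le\<close>, doubled
  by \<open>1 / (m - 1) \<le> 2 / m\<close>.\<close>

definition var_const :: "nat \<Rightarrow> real" where "var_const j = 1 + 4 * real j * 4 ^ j"

lemma var_const_ge_1: "1 \<le> var_const j"
  by (simp add: var_const_def)

lemma var_const_mono: "i \<le> j \<Longrightarrow> var_const i \<le> var_const j"
  unfolding var_const_def by (intro add_left_mono mult_mono power_increasing) auto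


lemma power_one_plus_le: "0 \<le> x \<Longrightarrow> x \<le> 1 \<Longrightarrow> (1 + x) ^ k \<le> 1 + real k * 2 ^ k * x" for x :: real
proof (induction k)
  case (Suc k)
  have "(1 + x) ^ k \<le> 2 ^ k" using Suc.prems by (intro power_mono) auto
  then have "x * (1 + x) ^ k \<le> x * 2 ^ k" using Suc.prems by (intro mult_left_mono)
  with Suc have "(1 + x) ^ Suc k \<le> 1 + real k * 2 ^ k * x + x * 2 ^ k"
    by (simp add: distrib_right)
  also have "\<dots> = 1 + real (Suc k) * 2 ^ k * x" by (simp add: algebra_simps)
  also have "real (Suc k) * 2 ^ k * x \<le> real (Suc k) * 2 ^ Suc k * x"
    using Suc.prems by (intro mult_right_mono mult_left_mono) auto
  finally show ?case by simp
qed simp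

section \<open>Variance of the shares and ratios of binomial masses\<close>

context urns
begin

text \<open>The diagonal pairs of urns contribute \<open>p / m\<close>. For distinct urns the excess
  over \<open>p\<^sup>2\<close> is a factor \<open>(1 + x) ^ (2 * j)\<close>, where \<open>x\<close>
  is chosen so that \<open>1 + x\<close> inverts \<open>1 - 1 / m\<close>; as \<open>x\<close> is of
  order \<open>1 / m\<close>, this excess is again of order \<open>p / m\<close>.\<close>

lemma share_variance_le:
  "expect n (\<lambda>M. (share j M - occ_prob n j)\<^sup>2) \<le> var_const j * occ_prob n j / m"
proof -
  define p where "p = occ_prob n j"
  define x where "x = 1 / (real m - 1)"
  have m: "2 \<le> real m" using m_ge_2 by simp
  have x: "0 \<le> x" "x \<le> 1" "x \<le> 2 / m" using m by (auto simp: x_def field_simps)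
  have p: "0 \<le> p" "p \<le> 1" by (simp_all add: p_def occ_prob_nonneg occ_prob_le_1)
  have inv: "(1 - 1 / real m) * (1 + x) = 1" using m by (simp add: x_def field_simps)
  have "(1 - 1 / real m) * occ_prob2 n j j \<le> occ_prob2 n j j"
    using m by (intro mult_left_le_one_le occ_prob2_nonneg) auto
  also have "\<dots> = occ_prob2 n j j * (1 - 1 / m) ^ (2 * j) * (1 + x) ^ (2 * j)"
    by (simp add: mult.assoc inv flip: power_mult_distrib)
  also have "\<dots> \<le> p\<^sup>2 * (1 + x) ^ (2 * j)"
    unfolding p_def using x by (intro mult_right_mono occ_prob2_le) auto
  also have "\<dots> \<le> p\<^sup>2 * (1 + real (2 * j) * 2 ^ (2 * j) * x)"
    using x by (intro mult_left_mono power_one_plus_le) auto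
  also have "(2::real) ^ (2 * j) = 4 ^ j" by (simp add: power_mult)
  also have "p\<^sup>2 * (1 + real (2 * j) * 4 ^ j * x) = p\<^sup>2 + p\<^sup>2 * (real (2 * j) * 4 ^ j * x)" 
    by (simp only: distrib_left mult_1_right)
  also have "p\<^sup>2 * (real (2 * j) * 4 ^ j * x) \<le> p * (real (2 * j) * 4 ^ j * (2 / m))"
    using p x by (intro mult_mono) (auto simp: power2_eq_square mult_left_le_one_le)
  finally show ?thesis
    unfolding expect_share_variance by (simp add: p_def var_const_def field_simps)
qed

text \<open>Multiplied out so that no mass is divided by; for \<open>j \<ge> n\<close> both sides
  vanish.\<close>

lemma occ_prob_ratio:
  "occ_prob n (Suc j) * (real (Suc j) * (real m - 1)) = occ_prob n j * (real n - real j)"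
proof (cases "j < n")
  case True
  define x y where "x = 1 / real m" and "y = 1 - 1 / real m"
  have occ: "occ_prob k j = real (k choose j) * x ^ j * y ^ (k - j)" for k j
    by (simp add: occ_prob_def x_def y_def)
  have xy: "x * (real m - 1) = y" by (simp add: x_def y_def field_simps)
  have "Suc j * (n choose Suc j) = (n - j) * (n choose j)"
    using binomial_absorption[of j n] binomial_absorb_comp[of n j] by simp
  then have bin: "real (Suc j) * real (n choose Suc j) = (real n - real j) * real (n choose j)"
    using True by (metis of_nat_mult of_nat_diff less_imp_le)
  have nj: "n - j = Suc (n - Suc j)" using True by simp
  have "occ_prob n (Suc j) * (real (Suc j) * (real m - 1))
     = (real (Suc j) * real (n choose Suc j)) * x ^ j * y ^ (n - Suc j) * (x * (real m - 1))"
    by (simp add: occ mult_ac)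
  also have "\<dots> = occ_prob n j * (real n - real j)"
    unfolding bin xy by (simp add: occ nj mult_ac)
  finally show ?thesis .
qed (auto simp: occ_prob_def binomial_eq_0 not_less le_less)

text \<open>In the ratio of consecutive masses the hypothesis gives
  \<open>n - i \<ge> n / 2\<close>. This charges errors caused by urns with one ball less to the
  mean count at \<open>Suc i\<close>.\<close>

lemma occ_prob_pred_le:
  assumes "2 * i \<le> n"
  shows "real n * occ_prob n i \<le> 2 * real (Suc i) * (real m * occ_prob n (Suc i))"
proof -
  have "real n * occ_prob n i \<le> 2 * (occ_prob n i * (real n - real i))"
    using assms mult_left_mono[of "real n" "2 * (real n - real i)" "occ_prob n i"] occ_prob_nonneg[of n i]
    by (simp add: algebra_simps)
  also have "\<dots> = 2 * real (Suc i) * ((real m - 1) * occ_prob n (Suc i))"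
    unfolding occ_prob_ratio[symmetric] by (simp only: mult_ac)
  also have "\<dots> \<le> 2 * real (Suc i) * (real m * occ_prob n (Suc i))"
    by (intro mult_left_mono mult_right_mono occ_prob_nonneg) auto
  finally show ?thesis .
qed

lemma occ_prob_Suc_le: "real m * occ_prob n (Suc j) \<le> 2 * (real n * occ_prob n j)"
proof -
  have "real m \<le> 2 * (real (Suc j) * (real m - 1))"
  proof -
    have "2 \<le> real m" using m_ge_2 by simp
    then have "real m \<le> 2 * (1 * (real m - 1))" by simp
    also have "\<dots> \<le> 2 * (real (Suc j) * (real m - 1))" by (intro mult_left_mono mult_right_mono) auto
    finally show ?thesis .
  qed
  then have "real m * occ_prob n (Suc j) \<le> 2 * (real (Suc j) * (real m - 1)) * occ_prob n (Suc j)"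
    by (intro mult_right_mono occ_prob_nonneg)
  also have "\<dots> = 2 * (occ_prob n j * (real n - real j))"
    unfolding occ_prob_ratio[symmetric] by (simp only: mult_ac)
  also have "\<dots> \<le> 2 * (real n * occ_prob n j)"
    using occ_prob_nonneg[of n j] by (simp add: algebra_simps)
  finally show ?thesis .
qed

lemma occ_prob_sum3_le_1:
  assumes "i \<noteq> j" "j \<noteq> k" "i \<noteq> k"
  shows "occ_prob n i + occ_prob n j + occ_prob n k \<le> 1"
proof -
  have "share i M + share j M + share k M \<le> 1" for M
    unfolding share_def avg_add[symmetric]
    by (rule order_trans[OF avg_mono[of _ "\<lambda>_. 1"]]) (use assms in auto)
  then have "expect n (\<lambda>M. share i M + share j M + share k M) \<le> expect n (\<lambda>_. 1)"
    by (rule expect_mono)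
  then show ?thesis using expect_share by (simp add: expect_add cong: expect_cong)
qed

text \<open>The two masses are comparable to one of their neighbours: to the one above when there are many
  balls per urn, and otherwise to the one below, which exists because \<open>i \<ge> 1\<close>.\<close>

lemma occ_prob_two_values_le:
  assumes "1 \<le> i"
  shows "(occ_prob n i + occ_prob n (Suc i)) * (1 + 1 / (real i + 2)\<^sup>2) \<le> 1"
proof -
  define D where "D = (real i + 2)\<^sup>2"
  have D: "0 < D" "4 \<le> D" using power_mono[of 2 "real i + 2" 2] by (auto simp: D_def)
  have m1: "0 < real m - 1" using m_ge_2 by simp
  \<comment> \<open>\<open>r\<close> will be the mass of a third occupancy value, bounding the other
    two up to the factor \<open>D\<close>.\<close>
  have main: "(occ_prob n i + occ_prob n (Suc i)) * (1 + 1 / D) \<le> 1"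
    if "occ_prob n i + occ_prob n (Suc i) \<le> D * r"
      and "occ_prob n i + occ_prob n (Suc i) + r \<le> 1" for r
  proof -
    have "(occ_prob n i + occ_prob n (Suc i)) / D \<le> r"
      using that(1) D by (simp add: divide_le_eq mult.commute)
    with that(2) show ?thesis by (simp add: distrib_left)
  qed
  show ?thesis
  proof (cases "real m - 1 \<le> real n - real (Suc i)")
    case True
    have "occ_prob n (Suc i) * (real m - 1) \<le> occ_prob n (Suc i) * (real n - real (Suc i))"
      by (intro mult_left_mono True occ_prob_nonneg)
    also have "\<dots> = (real (Suc (Suc i)) * occ_prob n (Suc (Suc i))) * (real m - 1)"
      unfolding occ_prob_ratio[symmetric] by (simp only: mult_ac)
    finally have 1: "occ_prob n (Suc i) \<le> real (i + 2) * occ_prob n (Suc (Suc i))"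
      using m1 by (simp add: mult_le_cancel_right)
    have "occ_prob n i * (real m - 1) \<le> occ_prob n i * (real n - real i)"
      using True by (intro mult_left_mono occ_prob_nonneg) auto
    also have "\<dots> = (real (Suc i) * occ_prob n (Suc i)) * (real m - 1)"
      unfolding occ_prob_ratio[symmetric] by (simp only: mult_ac)
    finally have "occ_prob n i \<le> real (Suc i) * occ_prob n (Suc i)"
      using m1 by (simp add: mult_le_cancel_right)
    then have "occ_prob n i + occ_prob n (Suc i) \<le> (real i + 2) * occ_prob n (Suc i)"
      by (simp add: algebra_simps)
    also have "\<dots> \<le> (real i + 2) * (real (i + 2) * occ_prob n (Suc (Suc i)))"
      by (intro mult_left_mono 1) auto
    also have "\<dots> = D * occ_prob n (Suc (Suc i))" by (simp add: D_def power2_eq_square)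
    finally show ?thesis
      using main[of "occ_prob n (Suc (Suc i))"] occ_prob_sum3_le_1[of i "Suc i" "Suc (Suc i)" n]
      by (simp add: D_def)
  next
    case False
    obtain k where k: "i = Suc k" using assms by (cases i) auto
    have small: "n + 1 \<le> i + m" using False m_ge_2 by linarith
    then have small': "real n - real i \<le> real m - 1" "real n - real k \<le> 2 * (real m - 1)"
      using m_ge_2 k by auto
    have "(real (Suc i) * occ_prob n (Suc i)) * (real m - 1) = occ_prob n i * (real n - real i)"
      unfolding occ_prob_ratio[symmetric] by (simp only: mult_ac)
    also have "\<dots> \<le> occ_prob n i * (real m - 1)"
      by (intro mult_left_mono small' occ_prob_nonneg)
    finally have "real (Suc i) * occ_prob n (Suc i) \<le> occ_prob n i"
      using m1 by (simp add: mult_le_cancel_right)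
    moreover have "1 * occ_prob n (Suc i) \<le> real (Suc i) * occ_prob n (Suc i)"
      by (intro mult_right_mono occ_prob_nonneg) auto
    ultimately have 1: "occ_prob n (Suc i) \<le> occ_prob n i" by simp
    have "(real (Suc k) * occ_prob n i) * (real m - 1) = occ_prob n k * (real n - real k)"
      unfolding occ_prob_ratio[symmetric] k by (simp only: mult_ac)
    also have "\<dots> \<le> occ_prob n k * (2 * (real m - 1))"
      by (intro mult_left_mono small' occ_prob_nonneg)
    also have "\<dots> = (2 * occ_prob n k) * (real m - 1)" by simp
    finally have "real (Suc k) * occ_prob n i \<le> 2 * occ_prob n k"
      using m1 by (simp only: mult_le_cancel_right_pos)
    moreover have "1 * occ_prob n i \<le> real (Suc k) * occ_prob n i"
      by (intro mult_right_mono occ_prob_nonneg) auto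
    ultimately have "occ_prob n i + occ_prob n (Suc i) \<le> 4 * occ_prob n k" using 1 by simp
    also have "\<dots> \<le> D * occ_prob n k" by (intro mult_right_mono D occ_prob_nonneg)
    finally show ?thesis
      using main[of "occ_prob n k"] occ_prob_sum3_le_1[of i "Suc i" k n] k by (simp add: D_def)
  qed
qed


definition num :: "nat \<Rightarrow> (nat \<Rightarrow> nat) \<Rightarrow> real" where
  "num j M = real m * share j M"

lemma num_eq_card: "num j M = real (card {u. u < m \<and> M u = j})"
  by (simp add: num_def share_eq_card)

lemma num_eq_sum: "num j M = (\<Sum>u<m. of_bool (M u = j))"
  by (simp add: num_def share_def avg_def)

lemma share_add_ball:
  assumes "v < m"
  shows "share j (add_ball M v) = share j M + (of_bool (Suc (M v) = j) - of_bool (M v = j)) / m"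
proof -
  have "share j (add_ball M v)
    = avg (\<lambda>u. of_bool (M u = j) + of_bool (u = v) * (of_bool (Suc (M v) = j) - of_bool (M v = j)))"
    unfolding share_def by (intro avg_cong) (auto simp: add_ball_def)
  then show ?thesis using assms by (simp add: avg_add avg_mult avg_of_bool_eq share_def)
qed

lemma num_add_ball:
  "v < m \<Longrightarrow> num j (add_ball M v) = num j M + of_bool (Suc (M v) = j) - of_bool (M v = j)"
  by (simp add: num_def share_add_ball algebra_simps)

lemma sum_count_eq: "(\<Sum>u<m. real (M u) * of_bool (M u = j)) = real j * num j M"
  unfolding num_eq_sum sum_distrib_left by (intro sum.cong) auto

lemma num_nonneg: "0 \<le> num j M"
  by (simp add: num_def share_nonneg)

lemma sum_two_counts_le:
  assumes "(\<Sum>u<m. M u) = n" "i \<noteq> j"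
  shows "real i * num i M + real j * num j M \<le> real n"
proof -
  have "real i * num i M + real j * num j M
     = (\<Sum>u<m. real (M u) * of_bool (M u = i) + real (M u) * of_bool (M u = j))"
    by (simp add: sum_count_eq sum.distrib)
  also have "\<dots> \<le> (\<Sum>u<m. real (M u))" using assms(2) by (intro sum_mono) auto
  also have "\<dots> = real n" by (simp flip: assms(1))
  finally show ?thesis .
qed

lemma expect_num: "expect n (num j) = real m * occ_prob n j"
  using expect_share[of n j] by (simp add: num_def[abs_def] expect_cmult)

subsection \<open>Exchanging the two ends of a single move\<close>

definition down_rate :: "nat \<Rightarrow> (nat \<Rightarrow> nat) \<Rightarrow> real" where
  "down_rate e M = real (Suc e) * num (Suc e) M * (1 - share e M - share (Suc e) M)"

text \<open>Sum over the balls in admissible urns of the fraction of target urns with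
  \<open>e\<close> balls. The final \<open>- e\<close> corrects for balls that already lie in an urn
  with \<open>e\<close> balls, since their own urn is not a target. In \<open>down_rate\<close> the
  source has \<open>Suc e\<close> balls and is excluded from the targets anyway.\<close>

definition up_rate :: "nat \<Rightarrow> nat \<Rightarrow> (nat \<Rightarrow> nat) \<Rightarrow> real" where
  "up_rate n e M = share e M * (real n - real (Suc e) * num (Suc e) M
      - real (Suc (Suc e)) * num (Suc (Suc e)) M - real e)"

text \<open>Moves that change the number of urns with \<open>Suc e\<close> balls by one are reversible: a ball leaves
  an urn with \<open>Suc e\<close> balls for one with neither \<open>e\<close> nor \<open>Suc e\<close> balls, or the other way round.
  Taking the moving ball out of the configuration gives the same average for both directions.\<close>

lemma expect_up_eq_down:
  assumes "0 < n"
  shows "expect n (\<lambda>M. up_rate n e M * g (num (Suc e) M))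
    = expect n (\<lambda>M. down_rate e M * g (num (Suc e) M - 1))"
proof -
  obtain k where k: "n = Suc k" using assms by (cases n) auto
  let ?d = "Suc e"
  define \<Psi> where "\<Psi> M v = of_bool (M v = ?d) * ((1 - share e M - share ?d M) * g (num ?d M - 1))" for M v
  define \<Phi> where "\<Phi> M v = of_bool (M v \<noteq> ?d \<and> M v \<noteq> Suc ?d) *
      ((share e M - of_bool (M v = e) / m) * g (num ?d M))" for M v
  \<comment> \<open>The common value in the configuration without the moving ball: one end of the
    move has \<open>e\<close> balls, the other neither \<open>e\<close> nor
    \<open>Suc e\<close>.\<close>
  define R where "R M = share e M * ((1 - share e M - share ?d M) * g (num ?d M))" for M
  have "(\<Sum>u<m. real (M u) * \<Psi> M u) = down_rate e M * g (num ?d M - 1)" for M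
    using sum_count_eq[of M ?d]
    by (simp add: \<Psi>_def down_rate_def flip: mult.assoc sum_distrib_right)
  then have down: "expect n (\<lambda>M. down_rate e M * g (num ?d M - 1))
      = real n * expect k (\<lambda>M. avg (\<lambda>v. \<Psi> (add_ball M v) v))"
    using expect_transport[of k \<Psi>] by (simp add: k)
  have "(\<Sum>u<m. real (M u) * \<Phi> M u) = up_rate n e M * g (num ?d M)" if "(\<Sum>u<m. M u) = n" for M
  proof -
    have "(\<Sum>u<m. real (M u) * \<Phi> M u) = (\<Sum>u<m. (share e M * (real (M u)
        - real (M u) * of_bool (M u = ?d) - real (M u) * of_bool (M u = Suc ?d))
        - real (M u) * of_bool (M u = e) * (1 / m)) * g (num ?d M))"
      unfolding \<Phi>_def by (intro sum.cong) (auto simp: algebra_simps)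
    also have "\<dots> = (share e M * ((\<Sum>u<m. real (M u)) - real ?d * num ?d M
        - real (Suc ?d) * num (Suc ?d) M) - real e * num e M * (1 / m)) * g (num ?d M)"
      unfolding sum_count_eq[symmetric] by (simp only: sum_distrib_right[symmetric] sum_distrib_left[symmetric] sum_subtractf)
    also have "(\<Sum>u<m. real (M u)) = real n" by (simp flip: that)
    also have "real e * num e M * (1 / m) = share e M * real e" by (simp add: num_def)
    finally show ?thesis by (simp only: up_rate_def right_diff_distrib)
  qed
  then have up: "expect n (\<lambda>M. up_rate n e M * g (num ?d M))
      = real n * expect k (\<lambda>M. avg (\<lambda>v. \<Phi> (add_ball M v) v))"
    using expect_transport[of k \<Phi>] unfolding k by (simp only: cong: expect_cong)
  have "avg (\<lambda>v. \<Psi> (add_ball M v) v) = R M" for M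
  proof -
    have "avg (\<lambda>v. \<Psi> (add_ball M v) v) = avg (\<lambda>v. of_bool (M v = e) * ((1 - share e M - share ?d M) * g (num ?d M)))"
    proof (intro avg_cong)
      fix v assume "v < m"
      then show "\<Psi> (add_ball M v) v = of_bool (M v = e) * ((1 - share e M - share ?d M) * g (num ?d M))"
        by (cases "M v = e") (simp_all add: \<Psi>_def share_add_ball num_add_ball, simp_all add: add_ball_def)
    qed
    then show ?thesis by (simp add: avg_mult share_def R_def)
  qed
  moreover have "avg (\<lambda>v. \<Phi> (add_ball M v) v) = R M" for M
  proof -
    have "avg (\<lambda>v. \<Phi> (add_ball M v) v) =
       avg (\<lambda>v. (1 - of_bool (M v = e) - of_bool (M v = ?d)) * (share e M * g (num ?d M)))"
    proof (intro avg_cong)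
      fix v assume "v < m"
      then show "\<Phi> (add_ball M v) v = (1 - of_bool (M v = e) - of_bool (M v = ?d)) * (share e M * g (num ?d M))"
        by (cases "M v = e"; cases "M v = ?d")
          (simp_all add: \<Phi>_def share_add_ball num_add_ball, simp_all add: add_ball_def)
    qed
    also have "\<dots> = (1 - share e M - share ?d M) * (share e M * g (num ?d M))"
      unfolding avg_mult avg_diff share_def by simp
    finally show ?thesis by (simp add: R_def mult_ac)
  qed
  ultimately show ?thesis by (simp add: up down)
qed

lemma square_diff3_le: "(x - y - z)\<^sup>2 \<le> 3 * (x\<^sup>2 + y\<^sup>2 + z\<^sup>2)" for x y z :: real
proof -
  have "0 \<le> (x + y)\<^sup>2 + (x + z)\<^sup>2 + (y - z)\<^sup>2" by simp
  then show ?thesis by (simp add: power2_eq_square algebra_simps)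
qed

lemma square_mult_le: "\<bar>a\<bar> \<le> c \<Longrightarrow> (a * x)\<^sup>2 \<le> c\<^sup>2 * x\<^sup>2" for a :: real
  unfolding power_mult_distrib by (intro mult_right_mono abs_le_square_iff[THEN iffD1]) auto

lemma share_variance_le':
  "j \<le> k \<Longrightarrow> expect n (\<lambda>M. (share j M - occ_prob n j)\<^sup>2) \<le> var_const k * occ_prob n j / m"
  using share_variance_le[of n j] var_const_mono[of j k] occ_prob_nonneg[of n j]
  by (elim order_trans) (intro divide_right_mono mult_right_mono, auto)

text \<open>The deviation from the product of means is linear in the deviations of the two shares,
  with random but bounded coefficients. The share with \<open>e\<close> balls enters only with the
  factor \<open>pd\<close>, so every term has a variance of order \<kappa>.\<close>

lemma down_rate_variance_le:
  fixes n e :: nat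
  defines "d \<equiv> Suc e"
  defines "\<kappa> \<equiv> real m * occ_prob n d"
  shows "expect n (\<lambda>M. (down_rate e M - expect n (down_rate e))\<^sup>2) \<le> 9 * (real d)\<^sup>2 * var_const (Suc d) * \<kappa>"
proof -
  define V where "V = var_const (Suc d)"
  define pe pd where "pe = occ_prob n e" and "pd = occ_prob n d"
  define c where "c = real d * real m * pd * (1 - pe - pd)"
  have p: "0 \<le> pe" "0 \<le> pd" "pe \<le> 1" "pd \<le> 1"
    by (simp_all add: pe_def pd_def occ_prob_nonneg occ_prob_le_1)
  have V: "1 \<le> V" by (simp add: V_def var_const_ge_1)
  define ve vd where "ve = expect n (\<lambda>M. (share e M - pe)\<^sup>2)" and "vd = expect n (\<lambda>M. (share d M - pd)\<^sup>2)"
  have ve: "ve \<le> V * pe / m" and vd: "vd \<le> V * pd / m"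
    by (auto simp: ve_def vd_def V_def pe_def pd_def d_def intro: share_variance_le')
  have pt: "(down_rate e M - c)\<^sup>2
     \<le> (real d * real m)\<^sup>2 * (3 * ((share d M - pd)\<^sup>2 + pd\<^sup>2 * (share e M - pe)\<^sup>2 + pd\<^sup>2 * (share d M - pd)\<^sup>2))" for M
  proof -
    have "down_rate e M - c = real d * real m * ((1 - share e M - share d M) * (share d M - pd)
        - pd * (share e M - pe) - pd * (share d M - pd))"
      by (simp add: down_rate_def c_def num_def d_def algebra_simps)
    then have "(down_rate e M - c)\<^sup>2 = (real d * real m)\<^sup>2 * ((1 - share e M - share d M) * (share d M - pd)
        - pd * (share e M - pe) - pd * (share d M - pd))\<^sup>2"
      by (simp only: power_mult_distrib)
    also have "\<dots> \<le> (real d * real m)\<^sup>2 * (3 * (((1 - share e M - share d M) * (share d M - pd))\<^sup>2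
        + (pd * (share e M - pe))\<^sup>2 + (pd * (share d M - pd))\<^sup>2))"
      by (intro mult_left_mono square_diff3_le) simp
    also have "((1 - share e M - share d M) * (share d M - pd))\<^sup>2 \<le> 1\<^sup>2 * (share d M - pd)\<^sup>2"
      using share_nonneg[of e M] share_nonneg[of d M] share_add_le_1[of e d M]
      by (intro square_mult_le) (auto simp: d_def abs_le_iff)
    finally show ?thesis by (simp add: power_mult_distrib mult_left_mono)
  qed
  have "expect n (\<lambda>M. (down_rate e M - expect n (down_rate e))\<^sup>2) \<le> expect n (\<lambda>M. (down_rate e M - c)\<^sup>2)"
    by (rule expect_deviation_mono) simp
  also have "\<dots> \<le> (real d * real m)\<^sup>2 * (3 * (vd + pd\<^sup>2 * ve + pd\<^sup>2 * vd))"
    using expect_mono[OF pt] by (simp add: expect_cmult expect_add ve_def vd_def)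
  also have "\<dots> \<le> (real d * real m)\<^sup>2 * (3 * (V * pd / m + pd * (V * 1 / m) + pd * (V * 1 / m)))"
  proof (intro mult_left_mono add_mono vd)
    have sq: "pd\<^sup>2 \<le> pd" using p by (simp add: power2_eq_square mult_left_le)
    have "ve \<le> V * 1 / m" "vd \<le> V * 1 / m"
      using p V by (auto intro!: order_trans[OF ve] order_trans[OF vd] divide_right_mono mult_left_mono)
    moreover have "0 \<le> ve" "0 \<le> vd" by (auto simp: ve_def vd_def intro: expect_nonneg)
    ultimately show "pd\<^sup>2 * ve \<le> pd * (V * 1 / m)" "pd\<^sup>2 * vd \<le> pd * (V * 1 / m)"
      using mult_mono[OF sq] p by blast+
  qed auto
  also have "\<dots> = 9 * (real d)\<^sup>2 * V * \<kappa>"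
    by (simp add: \<kappa>_def pd_def power2_eq_square field_simps)
  finally show ?thesis by (simp add: V_def)
qed

text \<open>The factor \<open>1 + n / m\<close> has two sources: the deviation of
  \<open>share e\<close> has a coefficient as large as \<open>n\<close>, giving
  \<open>(n / m) * (n * pe)\<close>, and the mean number of urns with \<open>Suc d\<close> balls may
  exceed \<kappa> by a factor of order \<open>n / m\<close>. The hypothesis on \<open>n\<close>
  serves to bound \<open>n * pe\<close> by \<kappa>.\<close>

lemma up_rate_variance_le:
  fixes n e :: nat
  defines "d \<equiv> Suc e"
  defines "\<kappa> \<equiv> real m * occ_prob n d"
  assumes n: "2 * d \<le> n"
  shows "expect n (\<lambda>M. (up_rate n e M - expect n (up_rate n e))\<^sup>2)
    \<le> 12 * (real d + 1)\<^sup>2 * var_const (Suc d) * (1 + real n / m) * \<kappa>"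
proof -
  define V where "V = var_const (Suc d)"
  define L where "L = real n / m"
  define pe pd pf where "pe = occ_prob n e" and "pd = occ_prob n d" and "pf = occ_prob n (Suc d)"
  define c where "c = pe * (real n - real d * real m * pd - real (Suc d) * real m * pf - real e)"
  have p: "0 \<le> pe" "0 \<le> pd" "pe \<le> 1" "pd \<le> 1" "0 \<le> pf"
    by (simp_all add: pe_def pd_def pf_def occ_prob_nonneg occ_prob_le_1)
  have V: "1 \<le> V" by (simp add: V_def var_const_ge_1)
  have L: "0 \<le> L" by (simp add: L_def)
  have \<kappa>: "0 \<le> \<kappa>" "\<kappa> = real m * pd" using p by (auto simp: \<kappa>_def pd_def)
  define ve vd vf where "ve = expect n (\<lambda>M. (share e M - pe)\<^sup>2)" and "vd = expect n (\<lambda>M. (share d M - pd)\<^sup>2)"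
    and "vf = expect n (\<lambda>M. (share (Suc d) M - pf)\<^sup>2)"
  have ve: "ve \<le> V * pe / m" and vd: "vd \<le> V * pd / m" and vf: "vf \<le> V * pf / m"
    by (auto simp: ve_def vd_def vf_def V_def pe_def pd_def pf_def d_def intro: share_variance_le')
  have pt: "(up_rate n e M - c)\<^sup>2
     \<le> 3 * ((real n)\<^sup>2 * (share e M - pe)\<^sup>2 + (real d * real m)\<^sup>2 * (share d M - pd)\<^sup>2
         + (real (Suc d) * real m)\<^sup>2 * (share (Suc d) M - pf)\<^sup>2)" if "(\<Sum>u<m. M u) = n" for M
  proof -
    define w where "w = real n - real d * num d M - real (Suc d) * num (Suc d) M - real e"
    have "real d * num d M + real (Suc d) * num (Suc d) M \<le> real n"
      by (rule sum_two_counts_le[OF that]) simp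
    moreover have "0 \<le> real d * num d M" "0 \<le> real (Suc d) * num (Suc d) M"
      by (intro mult_nonneg_nonneg num_nonneg; simp)+
    moreover have "real e \<le> real n" using n by (simp add: d_def)
    ultimately have w: "\<bar>w\<bar> \<le> real n" by (simp add: w_def abs_le_iff)
    have "up_rate n e M - c = w * (share e M - pe) - (pe * (real d * real m)) * (share d M - pd)
       - (pe * (real (Suc d) * real m)) * (share (Suc d) M - pf)"
      by (simp add: up_rate_def c_def w_def num_def d_def algebra_simps)
    then have "(up_rate n e M - c)\<^sup>2 \<le> 3 * ((w * (share e M - pe))\<^sup>2
       + ((pe * (real d * real m)) * (share d M - pd))\<^sup>2
       + ((pe * (real (Suc d) * real m)) * (share (Suc d) M - pf))\<^sup>2)"
      by (simp only: square_diff3_le)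
    also have "\<dots> \<le> 3 * ((real n)\<^sup>2 * (share e M - pe)\<^sup>2 + (real d * real m)\<^sup>2 * (share d M - pd)\<^sup>2
         + (real (Suc d) * real m)\<^sup>2 * (share (Suc d) M - pf)\<^sup>2)"
      using p w by (intro mult_left_mono add_mono square_mult_le) (auto simp: abs_mult mult_left_le_one_le)
    finally show ?thesis .
  qed
  have "expect n (\<lambda>M. (up_rate n e M - expect n (up_rate n e))\<^sup>2) \<le> expect n (\<lambda>M. (up_rate n e M - c)\<^sup>2)"
    by (rule expect_deviation_mono) simp
  also have "\<dots> \<le> 3 * ((real n)\<^sup>2 * ve + (real d * real m)\<^sup>2 * vd + (real (Suc d) * real m)\<^sup>2 * vf)"
    using expect_mono[OF pt] by (simp add: expect_cmult expect_add ve_def vd_def vf_def)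
  also have "\<dots> \<le> 3 * ((real n)\<^sup>2 * (V * pe / m) + (real d * real m)\<^sup>2 * (V * pd / m)
      + (real (Suc d) * real m)\<^sup>2 * (V * pf / m))"
    by (intro mult_left_mono add_mono ve vd vf) auto
  also have "\<dots> = 3 * V * (L * (real n * pe) + (real d)\<^sup>2 * \<kappa> + (real (Suc d))\<^sup>2 * (real m * pf))"
    by (simp add: \<kappa> L_def power2_eq_square field_simps)
  also have "\<dots> \<le> 3 * V * (L * (2 * real d * \<kappa>) + (real d)\<^sup>2 * \<kappa> + (real (Suc d))\<^sup>2 * (2 * L * \<kappa>))"
  proof (intro mult_left_mono add_mono order_refl L)
    show "real n * pe \<le> 2 * real d * \<kappa>"
      unfolding pe_def \<kappa> pd_def d_def using n by (intro occ_prob_pred_le) (auto simp: d_def)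
    show "real m * pf \<le> 2 * L * \<kappa>"
      using occ_prob_Suc_le[of n d] by (simp add: pf_def L_def \<kappa> pd_def)
  qed (use V in auto)
  also have "\<dots> = 3 * V * \<kappa> * (2 * real d * L + (real d)\<^sup>2 + 2 * (real d + 1)\<^sup>2 * L)"
    by (simp add: algebra_simps)
  also have "\<dots> \<le> 3 * V * \<kappa> * (4 * (real d + 1)\<^sup>2 * (1 + L))"
  proof (rule mult_left_mono)
    have "2 * real d \<le> 2 * (real d + 1)\<^sup>2" by (simp add: power2_eq_square algebra_simps)
    then have "2 * real d * L \<le> 2 * (real d + 1)\<^sup>2 * L" using L by (intro mult_right_mono)
    moreover have "(real d)\<^sup>2 \<le> 4 * (real d + 1)\<^sup>2" by (simp add: power2_eq_square algebra_simps)
    ultimately show "2 * real d * L + (real d)\<^sup>2 + 2 * (real d + 1)\<^sup>2 * L \<le> 4 * (real d + 1)\<^sup>2 * (1 + L)"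
      by (simp add: algebra_simps)
  qed (use V \<kappa> in auto)
  finally show ?thesis by (simp add: V_def L_def mult_ac)
qed

end

text \<open>Chosen so that the covariance and variance terms in \<open>expect_down_rate_ge\<close>
  use up exactly half of the lower bound \<open>1 / ((d + 1)\<^sup>2 + 1)\<close> for
  \<open>1 - pe - pd\<close>.\<close>

definition threshold :: "nat \<Rightarrow> real" where
  "threshold d = 2 * var_const (Suc d) * (2 * real d + 1) * ((real d + 1)\<^sup>2 + 1)"

text \<open>Twice the deviation bound \<open>B\<close> of a rate, divided by the lower bound for the
  mean rate; see \<open>smoothing_const_eq\<close>.\<close>

definition smooth_const :: "nat \<Rightarrow> real" where
  "smooth_const d = 16 * (real d + 1) * ((real d + 1)\<^sup>2 + 1) * sqrt (var_const (Suc d))"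

lemma threshold_ge: "2 * real d + 1 \<le> threshold d"
proof -
  have "1 * 1 \<le> (2 * var_const (Suc d)) * ((real d + 1)\<^sup>2 + 1)"
    using var_const_ge_1[of "Suc d"] by (intro mult_mono) auto
  then have "(2 * real d + 1) * 1 \<le> (2 * real d + 1) * ((2 * var_const (Suc d)) * ((real d + 1)\<^sup>2 + 1))"
    by (intro mult_left_mono) auto
  then show ?thesis by (simp add: threshold_def mult_ac)
qed

lemma le_divide_sqrt_iff: "0 < k \<Longrightarrow> x \<le> c / sqrt k \<longleftrightarrow> k * x \<le> c * sqrt k"
proof -
  assume k: "0 < k"
  have "x \<le> c / sqrt k \<longleftrightarrow> (x * sqrt k) * sqrt k \<le> c * sqrt k"
    using k by (simp only: pos_le_divide_eq real_sqrt_gt_zero mult_le_cancel_right_pos)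
  also have "(x * sqrt k) * sqrt k = k * x" using k by simp
  finally show ?thesis .
qed

section \<open>Smoothness of the count under unit shifts and lower bound for its variance\<close>

context urns
begin

text \<open>Up to the factor \<open>d * m\<close>, the mean rate is
  \<open>pd * (1 - pe - pd)\<close> minus a covariance and a variance. The main part is bounded
  below by \<open>occ_prob_two_values_le\<close> at \<open>i = e\<close>, hence the assumption
  \<open>1 \<le> e\<close>; the other two are small for many balls and urns.\<close>

lemma expect_down_rate_ge:
  fixes n e :: nat
  defines "d \<equiv> Suc e"
  defines "\<kappa> \<equiv> real m * occ_prob n d"
  assumes e: "1 \<le> e" and n: "threshold d \<le> real n" and m: "threshold d \<le> real m"
  shows "\<kappa> / (2 * ((real d + 1)\<^sup>2 + 1)) \<le> expect n (down_rate e)"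
proof -
  define V where "V = var_const (Suc d)"
  define K where "K = threshold d"
  define D where "D = (real d + 1)\<^sup>2"
  define pe pd where "pe = occ_prob n e" and "pd = occ_prob n d"
  have p: "0 \<le> pe" "0 \<le> pd"
    by (simp_all add: pe_def pd_def occ_prob_nonneg)
  have V: "1 \<le> V" by (simp add: V_def var_const_ge_1)
  have D: "0 < D" by (simp add: D_def)
  have K: "2 * real d + 1 \<le> K" using threshold_ge by (simp add: K_def)
  then have K0: "0 < K" by linarith
  define ve vd cv where "ve = expect n (\<lambda>M. (share e M - pe)\<^sup>2)" and "vd = expect n (\<lambda>M. (share d M - pd)\<^sup>2)"
    and "cv = expect n (\<lambda>M. (share d M - pd) * (share e M - pe))"
  have ve: "ve \<le> V * pe / m" and vd: "vd \<le> V * pd / m"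
    by (auto simp: ve_def vd_def V_def pe_def pd_def d_def intro: share_variance_le')
  have v0: "0 \<le> ve" "0 \<le> vd" by (auto simp: ve_def vd_def intro: expect_nonneg)
  have npos: "0 < real n" "0 < real m" using n m K0 by (auto simp: K_def)
  \<comment> \<open>Trading \<open>pe\<close> for a multiple of \<open>pd\<close> makes the
    Cauchy-Schwarz bound on the covariance linear in \<open>pd\<close>, so that it can be absorbed
    into the main part.\<close>
  have "real n * pe \<le> 2 * real d * (real m * pd)"
    unfolding pe_def pd_def d_def
    using n K by (intro occ_prob_pred_le) (simp add: K_def d_def)
  then have pe: "pe \<le> 2 * real d * (real m * pd) / n" using npos by (simp add: field_simps)
  have "vd * ve \<le> (V * pd / m) * (V * pe / m)"
    using p V v0 by (intro mult_mono vd ve) auto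
  also have "\<dots> \<le> (V * pd / m) * (V * (2 * real d * (real m * pd) / n) / m)"
    using p V by (intro mult_left_mono divide_right_mono pe) auto
  also have "\<dots> = (V * pd)\<^sup>2 * (2 * real d) / (real n * real m)"
    by (simp add: power2_eq_square mult_ac)
  \<comment> \<open>\<open>n\<close> and \<open>m\<close> are at least \<open>K\<close>; squaring
    \<open>2 * d\<close> turns the bound into a perfect square.\<close>
  also have "\<dots> \<le> (V * pd)\<^sup>2 * (2 * real d)\<^sup>2 / (K * K)"
  proof (intro frac_le mult_left_mono mult_mono)
    have "2 * real d * 1 \<le> 2 * real d * (2 * real d)" unfolding d_def by (intro mult_left_mono) auto
    then show "2 * real d \<le> (2 * real d)\<^sup>2" by (simp add: power2_eq_square)
  qed (use n m K0 in \<open>auto simp: K_def\<close>)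
  also have "\<dots> = (V * pd * (2 * real d) / K)\<^sup>2"
    by (simp add: power_divide power_mult_distrib power2_eq_square)
  finally have "sqrt (vd * ve) \<le> V * pd * (2 * real d) / K"
    using p V K0 by (intro real_le_lsqrt) auto
  then have cv: "cv \<le> V * pd * (2 * real d) / K"
    using expect_Cauchy_Schwarz[of n "\<lambda>M. share d M - pd" "\<lambda>M. share e M - pe"]
    by (simp add: cv_def vd_def ve_def real_sqrt_mult)
  have vd': "vd \<le> V * pd / K"
    using p V K0 m by (intro order_trans[OF vd] divide_left_mono) (auto simp: K_def npos)
  have down: "down_rate e M = real d * real m * (pd * (1 - pe - pd) + (1 - pe - pd - pd) * (share d M - pd)
      - pd * (share e M - pe) - (share d M - pd) * (share e M - pe) - (share d M - pd)\<^sup>2)" for M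
    by (simp add: down_rate_def num_def d_def power2_eq_square algebra_simps)
  have "expect n (\<lambda>M. share j M - occ_prob n j) = 0" for j
    using expect_share[of n j] by (simp add: expect_diff)
  then have E: "expect n (down_rate e) = real d * real m * (pd * (1 - pe - pd) - cv - vd)"
    unfolding down[abs_def] by (simp add: expect_cmult expect_add expect_diff cv_def vd_def pd_def pe_def)
  have "(pe + pd) * (1 + 1 / D) \<le> 1"
    using occ_prob_two_values_le[OF e, of n] by (simp add: pe_def pd_def D_def d_def algebra_simps)
  then have "(pe + pd) * (D + 1) \<le> D" using D by (simp add: field_simps)
  then have "1 / (D + 1) \<le> 1 - pe - pd" using D by (simp add: divide_le_eq) (simp add: algebra_simps)
  have aux: "a \<le> b - cv - vd"
    if "t \<le> b" "u + w = a" "t = a + a" "cv \<le> u" "vd \<le> w" for a b t u w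
    using that by linarith
  from \<open>1 / (D + 1) \<le> 1 - pe - pd\<close> have "pd * (1 / (D + 1)) \<le> pd * (1 - pe - pd)" using p by (intro mult_left_mono)
  moreover have "V * pd * (2 * real d) / K + V * pd / K = pd * (1 / (2 * (D + 1)))"
  proof -
    have "V * pd * (2 * real d) / K + V * pd / K = pd * (V * (2 * real d + 1) / K)"
      by (simp add: algebra_simps add_divide_distrib)
    also have "V * (2 * real d + 1) / K = 1 / (2 * (D + 1))"
    proof -
      have K_eq: "K = (V * (2 * real d + 1)) * (2 * (D + 1))" by (simp add: K_def threshold_def V_def D_def)
      have "V * (2 * real d + 1) \<noteq> 0" using V by auto
      then show ?thesis unfolding K_eq by simp
    qed
    finally show ?thesis .
  qed
  moreover have "pd * (1 / (D + 1)) = pd * (1 / (2 * (D + 1))) + pd * (1 / (2 * (D + 1)))"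
  proof -
    have "pd * x = pd * (x / 2) + pd * (x / 2)" for x by simp
    from this[of "1 / (D + 1)"] show ?thesis by (simp only: divide_divide_eq_left mult.commute[of 2])
  qed
  ultimately have "pd * (1 / (2 * (D + 1))) \<le> pd * (1 - pe - pd) - cv - vd"
    using cv vd' aux by blast
  then have "real d * real m * (pd * (1 / (2 * (D + 1)))) \<le> expect n (down_rate e)"
    unfolding E by (intro mult_left_mono) auto
  moreover have "1 * (real m * (pd * (1 / (2 * (D + 1))))) \<le> real d * (real m * (pd * (1 / (2 * (D + 1)))))"
    using p D by (intro mult_right_mono) (auto simp: d_def)
  ultimately show ?thesis by (simp add: \<kappa>_def pd_def D_def mult_ac)
qed

lemma rate_deviation_le:
  fixes n e :: nat
  defines "d \<equiv> Suc e"
  defines "\<kappa> \<equiv> real m * occ_prob n d"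
  defines "B \<equiv> 4 * (real d + 1) * sqrt (var_const (Suc d)) * sqrt ((1 + real n / m) * \<kappa>)"
  assumes n: "threshold d \<le> real n"
  shows "sqrt (expect n (\<lambda>M. (down_rate e M - expect n (down_rate e))\<^sup>2)) \<le> B"
    and "sqrt (expect n (\<lambda>M. (up_rate n e M - expect n (up_rate n e))\<^sup>2)) \<le> B"
proof -
  define V where "V = var_const (Suc d)"
  define L where "L = 1 + real n / m"
  have V: "1 \<le> V" by (simp add: V_def var_const_ge_1)
  have L: "1 \<le> L" by (simp add: L_def)
  have \<kappa>: "0 \<le> \<kappa>" by (simp add: \<kappa>_def occ_prob_nonneg)
  have B: "0 \<le> B" using V L \<kappa> by (auto simp: B_def V_def L_def)
  have B2: "B\<^sup>2 = 16 * (real d + 1)\<^sup>2 * V * (L * \<kappa>)"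
    unfolding B_def power_mult_distrib using V L \<kappa> by (simp add: V_def L_def)
  have n2: "2 * d \<le> n" using n threshold_ge[of d] by linarith
  have "9 * (real d)\<^sup>2 * V * \<kappa> \<le> 16 * (real d + 1)\<^sup>2 * V * (L * \<kappa>)"
  proof -
    have "9 * (real d)\<^sup>2 \<le> 16 * (real d + 1)\<^sup>2" by (simp add: power2_eq_square algebra_simps)
    moreover have "1 * \<kappa> \<le> L * \<kappa>" using L \<kappa> by (intro mult_right_mono)
    ultimately show ?thesis using V \<kappa> by (intro mult_mono) auto
  qed
  then have "expect n (\<lambda>M. (down_rate e M - expect n (down_rate e))\<^sup>2) \<le> B\<^sup>2"
    using down_rate_variance_le[of n e] by (simp add: B2 V_def \<kappa>_def d_def)
  then show "sqrt (expect n (\<lambda>M. (down_rate e M - expect n (down_rate e))\<^sup>2)) \<le> B"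
    using B by (intro real_le_lsqrt) (auto intro: expect_nonneg)
  have "12 * (real d + 1)\<^sup>2 * V * L * \<kappa> \<le> 16 * (real d + 1)\<^sup>2 * V * (L * \<kappa>)"
    using V L \<kappa> by (simp add: mult_ac)
  moreover have "expect n (\<lambda>M. (up_rate n e M - expect n (up_rate n e))\<^sup>2)
      \<le> 12 * (real d + 1)\<^sup>2 * V * L * \<kappa>"
    using up_rate_variance_le[of e n] n2 by (simp only: V_def \<kappa>_def d_def L_def)
  ultimately have "expect n (\<lambda>M. (up_rate n e M - expect n (up_rate n e))\<^sup>2) \<le> B\<^sup>2"
    unfolding B2 by linarith
  then show "sqrt (expect n (\<lambda>M. (up_rate n e M - expect n (up_rate n e))\<^sup>2)) \<le> B"
    using B by (intro real_le_lsqrt) (auto intro: expect_nonneg)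
qed

lemma expect_up_rate: "0 < n \<Longrightarrow> expect n (up_rate n e) = expect n (down_rate e)"
  using expect_up_eq_down[of n e "\<lambda>_. 1"] by simp

lemma smoothing_const_eq:
  fixes n e :: nat
  defines "d \<equiv> Suc e"
  defines "\<kappa> \<equiv> real m * occ_prob n d"
  defines "B \<equiv> 4 * (real d + 1) * sqrt (var_const (Suc d)) * sqrt ((1 + real n / m) * \<kappa>)"
  shows "2 * B * (2 * ((real d + 1)\<^sup>2 + 1)) = smooth_const d * sqrt (1 + real n / m) * sqrt \<kappa>"
  unfolding B_def smooth_const_def real_sqrt_mult by algebra

text \<open>Both rates deviate by at most \<open>B\<close>, of order
  \<open>sqrt ((1 + n / m) * \<kappa>)\<close>, from a common mean \<nu> of order at least \<kappa>.
  Replacing them by \<nu> in the exchange identity costs \<open>B\<close> on each side; division by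
  \<nu> gives the bound.\<close>

lemma expect_shift_le:
  fixes n e :: nat
  defines "d \<equiv> Suc e"
  defines "\<kappa> \<equiv> real m * occ_prob n d"
  assumes e: "1 \<le> e" and n: "threshold d \<le> real n" and m: "threshold d \<le> real m"
    and \<kappa>: "0 < \<kappa>" and g: "\<And>x. \<bar>g x\<bar> \<le> 1"
  shows "\<bar>expect n (\<lambda>M. g (num d M)) - expect n (\<lambda>M. g (num d M - 1))\<bar>
    \<le> smooth_const d * sqrt (1 + real n / m) / sqrt \<kappa>"
proof -
  define B where "B = 4 * (real d + 1) * sqrt (var_const (Suc d)) * sqrt ((1 + real n / m) * \<kappa>)"
  define D where "D = 2 * ((real d + 1)\<^sup>2 + 1)"
  define \<nu> where "\<nu> = expect n (down_rate e)"
  have n0: "0 < n" using n threshold_ge[of d] by (cases n) auto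
  have up: "expect n (up_rate n e) = \<nu>" using expect_up_rate[OF n0] by (simp add: \<nu>_def)
  have D: "0 < D" unfolding D_def by (intro mult_pos_pos add_nonneg_pos) auto
  have \<nu>: "\<kappa> / D \<le> \<nu>"
    using expect_down_rate_ge[OF e] n m by (simp add: \<nu>_def D_def \<kappa>_def d_def)
  have \<nu>0: "0 < \<nu>" by (rule less_le_trans[OF _ \<nu>]) (use \<kappa> D in auto)
  have g2: "sqrt (expect n (\<lambda>M. (g (f M))\<^sup>2)) \<le> 1" for f
  proof -
    have "expect n (\<lambda>M. (g (f M))\<^sup>2) \<le> expect n (\<lambda>_. 1)"
      by (intro expect_mono) (use g in \<open>simp add: abs_square_le_1\<close>)
    then show ?thesis by simp
  qed
  have cs: "\<bar>expect n (\<lambda>M. (r M - \<nu>) * g (f M))\<bar> \<le> B"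
    if "sqrt (expect n (\<lambda>M. (r M - \<nu>)\<^sup>2)) \<le> B" for r f
  proof -
    have "\<bar>expect n (\<lambda>M. (r M - \<nu>) * g (f M))\<bar>
       \<le> sqrt (expect n (\<lambda>M. (r M - \<nu>)\<^sup>2)) * sqrt (expect n (\<lambda>M. (g (f M))\<^sup>2))"
      by (rule expect_Cauchy_Schwarz)
    also have "\<dots> \<le> B * 1" 
      by (intro mult_mono that g2 order_trans[OF _ that]) (auto intro: expect_nonneg)
    finally show ?thesis by simp
  qed
  have "expect n (\<lambda>M. (up_rate n e M - \<nu>) * g (num d M)) + \<nu> * expect n (\<lambda>M. g (num d M))
     = expect n (\<lambda>M. up_rate n e M * g (num d M))"
    by (simp add: left_diff_distrib expect_diff expect_cmult)
  also have "\<dots> = expect n (\<lambda>M. down_rate e M * g (num d M - 1))"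
    unfolding d_def by (rule expect_up_eq_down[OF n0])
  also have "\<dots> = expect n (\<lambda>M. (down_rate e M - \<nu>) * g (num d M - 1)) + \<nu> * expect n (\<lambda>M. g (num d M - 1))"
    by (simp add: left_diff_distrib expect_diff expect_cmult)
  finally have "\<nu> * (expect n (\<lambda>M. g (num d M)) - expect n (\<lambda>M. g (num d M - 1)))
     = expect n (\<lambda>M. (down_rate e M - \<nu>) * g (num d M - 1)) - expect n (\<lambda>M. (up_rate n e M - \<nu>) * g (num d M))"
    by (simp add: algebra_simps)
  moreover have "\<bar>expect n (\<lambda>M. (down_rate e M - \<nu>) * g (num d M - 1))\<bar> \<le> B"
    by (rule cs) (use rate_deviation_le(1)[of e n] n in \<open>simp add: B_def \<kappa>_def d_def \<nu>_def\<close>)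
  moreover have "\<bar>expect n (\<lambda>M. (up_rate n e M - \<nu>) * g (num d M))\<bar> \<le> B"
    by (rule cs) (use rate_deviation_le(2)[of e n] n in \<open>simp add: B_def \<kappa>_def d_def flip: up\<close>)
  ultimately have "\<bar>\<nu> * (expect n (\<lambda>M. g (num d M)) - expect n (\<lambda>M. g (num d M - 1)))\<bar> \<le> 2 * B"
    by linarith
  then have "\<nu> * \<bar>expect n (\<lambda>M. g (num d M)) - expect n (\<lambda>M. g (num d M - 1))\<bar> \<le> 2 * B"
    using \<nu>0 by (simp add: abs_mult)
  moreover have "\<kappa> / D * \<bar>expect n (\<lambda>M. g (num d M)) - expect n (\<lambda>M. g (num d M - 1))\<bar>
     \<le> \<nu> * \<bar>expect n (\<lambda>M. g (num d M)) - expect n (\<lambda>M. g (num d M - 1))\<bar>"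
    by (intro mult_right_mono \<nu>) auto
  ultimately have "\<kappa> * \<bar>expect n (\<lambda>M. g (num d M)) - expect n (\<lambda>M. g (num d M - 1))\<bar> / D \<le> 2 * B"
    by simp
  then have "\<kappa> * \<bar>expect n (\<lambda>M. g (num d M)) - expect n (\<lambda>M. g (num d M - 1))\<bar> \<le> 2 * B * D"
    using D by (simp add: pos_divide_le_eq)
  also have "2 * B * D = smooth_const d * sqrt (1 + real n / m) * sqrt \<kappa>"
    using smoothing_const_eq[of e n] by (simp add: B_def D_def \<kappa>_def d_def)
  finally show ?thesis by (rule le_divide_sqrt_iff[OF \<kappa>, THEN iffD2])
qed

text \<open>With the linear test function the shift by one leaves the mean rate \<nu> as a separate
  term. It equals a difference of covariances of the rates with the count, hence is at most
  \<open>2 * B * s\<close> with \<open>s\<close> the standard deviation; \<nu> is at least of order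
  \<kappa> and \<open>B\<close> only of order \<open>sqrt \<kappa>\<close>.\<close>

lemma num_variance_ge:
  fixes n e :: nat
  defines "d \<equiv> Suc e"
  defines "\<kappa> \<equiv> real m * occ_prob n d"
  assumes e: "1 \<le> e" and n: "threshold d \<le> real n" and m: "threshold d \<le> real m"
  shows "sqrt \<kappa> \<le> smooth_const d * sqrt (1 + real n / m) * sqrt (expect n (\<lambda>M. (num d M - \<kappa>)\<^sup>2))"
proof (cases "\<kappa> = 0")
  case True
  have "0 \<le> smooth_const d" using var_const_ge_1[of "Suc d"] by (simp add: smooth_const_def)
  with True show ?thesis by (auto intro!: mult_nonneg_nonneg expect_nonneg)
next
  case False
  then have \<kappa>: "0 < \<kappa>" using occ_prob_nonneg[of n d] by (auto simp: \<kappa>_def less_le)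
  define B where "B = 4 * (real d + 1) * sqrt (var_const (Suc d)) * sqrt ((1 + real n / m) * \<kappa>)"
  define D where "D = 2 * ((real d + 1)\<^sup>2 + 1)"
  define \<nu> where "\<nu> = expect n (down_rate e)"
  define s where "s = sqrt (expect n (\<lambda>M. (num d M - \<kappa>)\<^sup>2))"
  have s: "0 \<le> s" unfolding s_def by (intro real_sqrt_ge_zero expect_nonneg) simp
  have n0: "0 < n" using n threshold_ge[of d] by (cases n) auto
  have up: "expect n (up_rate n e) = \<nu>" using expect_up_rate[OF n0] by (simp add: \<nu>_def)
  have D: "0 < D" unfolding D_def by (intro mult_pos_pos add_nonneg_pos) auto
  have \<nu>: "\<kappa> / D \<le> \<nu>"
    using expect_down_rate_ge[OF e] n m by (simp add: \<nu>_def D_def \<kappa>_def d_def)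
  have cs: "\<bar>expect n (\<lambda>M. (r M - \<nu>) * (num d M - \<kappa>))\<bar> \<le> B * s"
    if "sqrt (expect n (\<lambda>M. (r M - \<nu>)\<^sup>2)) \<le> B" for r
    unfolding s_def
    by (rule order_trans[OF expect_Cauchy_Schwarz]) (intro mult_right_mono that real_sqrt_ge_zero expect_nonneg, simp)
  have "expect n (\<lambda>M. num d M - \<kappa>) = 0"
    using expect_num[of n d] by (simp add: expect_diff \<kappa>_def)
  then have *: "expect n (\<lambda>M. r M * (num d M - \<kappa>)) = expect n (\<lambda>M. (r M - \<nu>) * (num d M - \<kappa>))" for r
    by (simp add: left_diff_distrib expect_diff expect_cmult)
  have "expect n (\<lambda>M. up_rate n e M * (num d M - \<kappa>)) = expect n (\<lambda>M. down_rate e M * (num d M - 1 - \<kappa>))"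
    unfolding d_def by (rule expect_up_eq_down[OF n0])
  also have "\<dots> = expect n (\<lambda>M. down_rate e M * (num d M - \<kappa>) - down_rate e M)"
    by (intro expect_cong) (simp add: algebra_simps)
  also have "\<dots> = expect n (\<lambda>M. down_rate e M * (num d M - \<kappa>)) - \<nu>"
    by (simp add: expect_diff \<nu>_def)
  finally have "\<nu> = expect n (\<lambda>M. (down_rate e M - \<nu>) * (num d M - \<kappa>))
      - expect n (\<lambda>M. (up_rate n e M - \<nu>) * (num d M - \<kappa>))"
    using *[of "up_rate n e"] *[of "down_rate e"] by linarith
  moreover have "\<bar>expect n (\<lambda>M. (down_rate e M - \<nu>) * (num d M - \<kappa>))\<bar> \<le> B * s"
    by (rule cs) (use rate_deviation_le(1)[of e n] n in \<open>simp add: B_def \<kappa>_def d_def \<nu>_def\<close>)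
  moreover have "\<bar>expect n (\<lambda>M. (up_rate n e M - \<nu>) * (num d M - \<kappa>))\<bar> \<le> B * s"
    by (rule cs) (use rate_deviation_le(2)[of e n] n in \<open>simp add: B_def \<kappa>_def d_def flip: up\<close>)
  ultimately have "\<nu> \<le> 2 * B * s" by linarith
  with \<nu> have "\<kappa> / D \<le> 2 * B * s" by simp
  then have "\<kappa> \<le> (2 * B * D) * s" using D by (simp add: field_simps)
  also have "2 * B * D = smooth_const d * sqrt (1 + real n / m) * sqrt \<kappa>"
    using smoothing_const_eq[of e n] by (simp add: B_def D_def \<kappa>_def d_def)
  finally have "\<kappa> * 1 \<le> (smooth_const d * sqrt (1 + real n / m) * s) * sqrt \<kappa>"
    by (simp add: mult_ac)
  then have "1 \<le> (smooth_const d * sqrt (1 + real n / m) * s) / sqrt \<kappa>"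
    by (rule le_divide_sqrt_iff[OF \<kappa>, THEN iffD2])
  then show ?thesis using \<kappa> by (simp add: s_def)
qed

lemma num_variance_le:
  "expect n (\<lambda>M. (num j M - real m * occ_prob n j)\<^sup>2) \<le> var_const j * (real m * occ_prob n j)"
proof -
  have "expect n (\<lambda>M. (num j M - real m * occ_prob n j)\<^sup>2)
     = expect n (\<lambda>M. (real m)\<^sup>2 * (share j M - occ_prob n j)\<^sup>2)"
    by (intro expect_cong) (simp add: num_def power2_eq_square algebra_simps)
  also have "\<dots> \<le> (real m)\<^sup>2 * (var_const j * occ_prob n j / m)"
    unfolding expect_cmult by (intro mult_left_mono share_variance_le) auto
  finally show ?thesis by (simp add: power2_eq_square mult_ac)
qed


subsection \<open>Stein identity for the number of urns\<close>

lemma occ_prob_pos: "j \<le> n \<Longrightarrow> 0 < occ_prob n j"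
  using m_ge_2 unfolding occ_prob_def by (intro mult_pos_pos zero_less_power) auto

lemma sum_occ_prob: "(\<Sum>j\<le>n. occ_prob n j) = 1"
  using binomial_ring[of "1 / real m" "1 - 1 / real m" n] by (simp add: occ_prob_def)

lemma occ_prob_eq_0: "n < j \<Longrightarrow> occ_prob n j = 0"
  by (simp add: occ_prob_def binomial_eq_0)

text \<open>The ratio of mass \<open>j + 1\<close> to mass \<open>j\<close> is
  \<open>(n - j) / ((j + 1) * (m - 1))\<close>, which decreases in \<open>j\<close>.\<close>

lemma occ_prob_log_concave:
  assumes "a \<le> b"
  shows "occ_prob n a * occ_prob n (b + i) \<le> occ_prob n (a + i) * occ_prob n b"
proof (induction i)
  case (Suc i)
  let ?\<pi> = "occ_prob n"
  show ?case
  proof (cases "b + i < n")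
    case False
    then show ?thesis by (simp add: occ_prob_eq_0 occ_prob_nonneg)
  next
    case True
    define c where "c = real (Suc (b + i)) * (real m - 1)"
    have c: "0 < c" using m_ge_2 by (simp add: c_def)
    have "(?\<pi> a * ?\<pi> (b + Suc i)) * c = (?\<pi> a * ?\<pi> (b + i)) * (real n - real (b + i))"
      using occ_prob_ratio[of n "b + i"] by (simp add: c_def mult_ac)
    also have "\<dots> \<le> (?\<pi> (a + i) * ?\<pi> b) * (real n - real (a + i))"
      using True assms by (intro mult_mono Suc.IH) (auto intro!: mult_nonneg_nonneg occ_prob_nonneg)
    also have "\<dots> = (?\<pi> (a + Suc i) * ?\<pi> b) * (real (Suc (a + i)) * (real m - 1))"
      using occ_prob_ratio[of n "a + i"] by (simp add: mult_ac)
    also have "\<dots> \<le> (?\<pi> (a + Suc i) * ?\<pi> b) * c"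
      unfolding c_def using assms m_ge_2
      by (intro mult_left_mono mult_right_mono mult_nonneg_nonneg occ_prob_nonneg) auto
    finally show ?thesis using c by (simp only: mult_le_cancel_right_pos)
  qed
qed (simp add: mult.commute)

text \<open>The negative of the partial sum up to \<open>k\<close> of the Stein right-hand side
  \<open>of_bool (j = d) - occ_prob n d\<close>, weighted with the binomial masses.\<close>

definition flux :: "nat \<Rightarrow> nat \<Rightarrow> nat \<Rightarrow> real" where
  "flux n d k = occ_prob n d * ((\<Sum>j\<le>k. occ_prob n j) - of_bool (d \<le> k))"

text \<open>Solution of the binomial Stein recursion by summation. For \<open>k \<ge> n\<close> the
  denominator is zero and the slope is 0 by the convention on division.\<close>

definition slope :: "nat \<Rightarrow> nat \<Rightarrow> nat \<Rightarrow> real" where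
  "slope n d k = flux n d k / (occ_prob n (Suc k) * (real (Suc k) * (1 - 1 / m)))"

lemma sum_occ_prob_le_1: "finite J \<Longrightarrow> (\<Sum>j\<in>J. occ_prob n j) \<le> 1"
proof -
  assume J: "finite J"
  have "(\<Sum>j\<in>J. occ_prob n j) = (\<Sum>j\<in>J \<inter> {..n}. occ_prob n j)"
    using J occ_prob_eq_0[of n] by (intro sum.mono_neutral_right) (auto simp: not_le[symmetric])
  also have "\<dots> \<le> (\<Sum>j\<le>n. occ_prob n j)"
    by (intro sum_mono2) (auto simp: occ_prob_nonneg)
  finally show ?thesis by (simp add: sum_occ_prob)
qed

lemma sum_occ_prob_ge: "n \<le> k \<Longrightarrow> (\<Sum>j\<le>k. occ_prob n j) = 1"
  unfolding sum_occ_prob[of n, symmetric]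
  by (intro sum.mono_neutral_right) (auto simp: occ_prob_eq_0)

text \<open>Log-concavity moves each product of \<open>occ_prob n d\<close> with a mass in the
  relevant tail to \<open>occ_prob n (Suc k)\<close> times another mass. The resulting indices are
  distinct, so the other masses add up to at most 1. The lower tail is used for \<open>k < d\<close>
  and the upper tail for \<open>k \<ge> d\<close>.\<close>

lemma abs_flux_le: "\<bar>flux n d k\<bar> \<le> occ_prob n (Suc k)"
proof (cases "d \<le> k")
  case False
  let ?\<pi> = "occ_prob n"
  have "flux n d k = (\<Sum>j\<le>k. ?\<pi> j * ?\<pi> d)"
    using False by (simp add: flux_def sum_distrib_left mult.commute)
  also have "\<dots> \<le> (\<Sum>j\<le>k. ?\<pi> (Suc k) * ?\<pi> (d - (Suc k - j)))"
  proof (intro sum_mono)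
    fix j assume "j \<in> {..k}"
    then show "?\<pi> j * ?\<pi> d \<le> ?\<pi> (Suc k) * ?\<pi> (d - (Suc k - j))"
      using occ_prob_log_concave[of j "d - (Suc k - j)" n "Suc k - j"] False by simp
  qed
  also have "\<dots> = ?\<pi> (Suc k) * (\<Sum>j\<in>(\<lambda>j. d - (Suc k - j)) ` {..k}. ?\<pi> j)"
  proof -
    have "inj_on (\<lambda>j. d - (Suc k - j)) {..k}" using False by (intro inj_onI) auto
    from sum.reindex[OF this, of ?\<pi>] show ?thesis by (simp only: o_def sum_distrib_left)
  qed
  also have "\<dots> \<le> ?\<pi> (Suc k) * 1"
    by (intro mult_left_mono sum_occ_prob_le_1 occ_prob_nonneg) simp
  finally have "flux n d k \<le> ?\<pi> (Suc k)" by simp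
  moreover have "0 \<le> flux n d k"
    using False by (simp add: flux_def occ_prob_nonneg sum_nonneg)
  ultimately show ?thesis by simp
next
  case True
  let ?\<pi> = "occ_prob n"
  define K where "K = max n k"
  have "{..K} = {..k} \<union> {Suc k..K}" by (auto simp: K_def)
  then have "(\<Sum>j\<le>K. ?\<pi> j) = (\<Sum>j\<le>k. ?\<pi> j) + (\<Sum>j\<in>{Suc k..K}. ?\<pi> j)"
    by (simp add: sum.union_disjoint)
  then have tail: "1 - (\<Sum>j\<le>k. ?\<pi> j) = (\<Sum>j\<in>{Suc k..K}. ?\<pi> j)"
    by (simp add: sum_occ_prob_ge K_def)
  have "- flux n d k = ?\<pi> d * (1 - (\<Sum>j\<le>k. ?\<pi> j))"
    using True by (simp add: flux_def algebra_simps)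
  then have flux: "- flux n d k = (\<Sum>j\<in>{Suc k..K}. ?\<pi> d * ?\<pi> j)"
    by (simp add: tail sum_distrib_left)
  also have "\<dots> \<le> (\<Sum>j\<in>{Suc k..K}. ?\<pi> (Suc k) * ?\<pi> (d + (j - Suc k)))"
  proof (intro sum_mono)
    fix j assume "j \<in> {Suc k..K}"
    then show "?\<pi> d * ?\<pi> j \<le> ?\<pi> (Suc k) * ?\<pi> (d + (j - Suc k))"
      using occ_prob_log_concave[of d "Suc k" n "j - Suc k"] True by (simp add: mult.commute)
  qed
  also have "\<dots> = ?\<pi> (Suc k) * (\<Sum>j\<in>(\<lambda>j. d + (j - Suc k)) ` {Suc k..K}. ?\<pi> j)"
  proof -
    have "inj_on (\<lambda>j. d + (j - Suc k)) {Suc k..K}" by (intro inj_onI) auto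
    from sum.reindex[OF this, of ?\<pi>] show ?thesis by (simp only: o_def sum_distrib_left)
  qed
  also have "\<dots> \<le> ?\<pi> (Suc k) * 1"
    by (intro mult_left_mono sum_occ_prob_le_1 occ_prob_nonneg) simp
  finally have "- flux n d k \<le> ?\<pi> (Suc k)" by simp
  moreover have "0 \<le> - flux n d k"
    unfolding flux by (intro sum_nonneg mult_nonneg_nonneg occ_prob_nonneg)
  ultimately show ?thesis by simp
qed

text \<open>The mass in the denominator cancels the bound on the flux, and the remaining factor is
  at least 1/2. The bound is uniform in all parameters.\<close>

lemma abs_slope_le: "\<bar>slope n d k\<bar> \<le> 2"
proof (cases "occ_prob n (Suc k) = 0")
  case False
  then have pos: "0 < occ_prob n (Suc k)" using occ_prob_nonneg[of n "Suc k"] by simp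
  have c: "1 * (1 / 2) \<le> real (Suc k) * (1 - 1 / m)"
    using m_ge_2 by (intro mult_mono) auto
  have "\<bar>flux n d k\<bar> \<le> occ_prob n (Suc k) * 1" using abs_flux_le by simp
  also have "\<dots> \<le> occ_prob n (Suc k) * (2 * (real (Suc k) * (1 - 1 / m)))"
    using c pos by (intro mult_left_mono) linarith+
  finally have "\<bar>flux n d k\<bar> \<le> 2 * (occ_prob n (Suc k) * (real (Suc k) * (1 - 1 / m)))"
    by (simp only: mult_ac)
  moreover have "0 < occ_prob n (Suc k) * (real (Suc k) * (1 - 1 / m))"
    by (rule mult_pos_pos[OF pos]) (use c in linarith)
  ultimately show ?thesis
    by (simp only: slope_def abs_divide abs_of_pos pos_divide_le_eq)
qed (simp add: slope_def)

lemma slope_flux_Suc: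
  assumes "k < n"
  shows "slope n d k * (occ_prob n (Suc k) * (real (Suc k) * (1 - 1 / m))) = flux n d k"
proof -
  have "0 < occ_prob n (Suc k)" using assms by (intro occ_prob_pos) simp
  moreover have "0 < real (Suc k) * (1 - 1 / m)" using m_ge_2 by (intro mult_pos_pos) auto
  ultimately have "0 < occ_prob n (Suc k) * (real (Suc k) * (1 - 1 / m))" by (rule mult_pos_pos)
  then have "occ_prob n (Suc k) * (real (Suc k) * (1 - 1 / m)) \<noteq> 0" by linarith
  then show ?thesis unfolding slope_def
    by (simp only: times_divide_eq_left nonzero_mult_div_cancel_right not_False_eq_True)
qed

text \<open>Detailed balance of the binomial masses rewrites the denominator. At
  \<open>k = n\<close> the factor \<open>n - k\<close> vanishes, and so does the flux.\<close>

lemma slope_flux: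
  assumes "k \<le> n"
  shows "slope n d k * (occ_prob n k * ((real n - real k) / m)) = flux n d k"
proof (cases "k = n")
  case True
  then show ?thesis
    using occ_prob_eq_0[of n d] by (cases "d \<le> n") (simp_all add: flux_def sum_occ_prob)
next
  case False
  have "occ_prob n k * ((real n - real k) / m) = occ_prob n (Suc k) * (real (Suc k) * (1 - 1 / m))"
    using occ_prob_ratio[of n k] by (simp add: field_simps)
  with False assms show ?thesis by (simp only: slope_flux_Suc)
qed

text \<open>Multiplied by the mass at \<open>k\<close>, the two terms become the fluxes at
  \<open>k - 1\<close> and \<open>k\<close>, which differ by one summand. At \<open>k = 0\<close>
  the truncated argument \<open>k - 1\<close> is harmless because of the factor
  \<open>k\<close>.\<close>

lemma slope_equation:
  assumes "k \<le> n" "0 < d"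
  shows "(1 - 1 / m) * real k * slope n d (k - 1) - (real n - real k) / m * slope n d k
    = of_bool (k = d) - occ_prob n d"
proof -
  let ?\<pi> = "occ_prob n"
  have pos: "0 < ?\<pi> k" using assms by (intro occ_prob_pos)
  have "?\<pi> k * ((1 - 1 / m) * real k * slope n d (k - 1) - (real n - real k) / m * slope n d k)
     = ?\<pi> k * (of_bool (k = d) - ?\<pi> d)"
  proof (cases k)
    case 0
    then show ?thesis using slope_flux[of 0 n d] assms by (simp add: flux_def mult_ac)
  next
    case (Suc i)
    have "?\<pi> k * ((1 - 1 / m) * real k * slope n d (k - 1) - (real n - real k) / m * slope n d k)
      = flux n d i - flux n d k"
      using slope_flux[of k n d] slope_flux_Suc[of i n d] assms Suc by (simp add: algebra_simps)
    also have "\<dots> = ?\<pi> d * (of_bool (k = d) - ?\<pi> k)"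
      using Suc by (simp add: flux_def algebra_simps of_bool_def)
    also have "\<dots> = ?\<pi> k * (of_bool (k = d) - ?\<pi> d)"
      by (cases "k = d") (auto simp: algebra_simps)
    finally show ?thesis .
  qed
  with pos show ?thesis by (metis less_irrefl mult_cancel_left)
qed

lemma avg_zero_one_split:
  "avg (\<lambda>v. a v * F (num (Suc e) (add_ball M v))) =
     avg a * F (num (Suc e) M)
     + avg (\<lambda>v. a v * of_bool (M v = e)) * (F (num (Suc e) M + 1) - F (num (Suc e) M))
     + avg (\<lambda>v. a v * of_bool (M v = Suc e)) * (F (num (Suc e) M - 1) - F (num (Suc e) M))"
proof -
  have "avg (\<lambda>v. a v * F (num (Suc e) (add_ball M v))) =
     avg (\<lambda>v. a v * F (num (Suc e) M)
     + a v * of_bool (M v = e) * (F (num (Suc e) M + 1) - F (num (Suc e) M))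
     + a v * of_bool (M v = Suc e) * (F (num (Suc e) M - 1) - F (num (Suc e) M)))"
  proof (intro avg_cong)
    fix v assume "v < m"
    then show "a v * F (num (Suc e) (add_ball M v)) = a v * F (num (Suc e) M)
     + a v * of_bool (M v = e) * (F (num (Suc e) M + 1) - F (num (Suc e) M))
     + a v * of_bool (M v = Suc e) * (F (num (Suc e) M - 1) - F (num (Suc e) M))"
      by (cases "M v = e"; cases "M v = Suc e") (simp_all add: num_add_ball algebra_simps)
  qed
  then show ?thesis by (simp only: avg_add avg_mult)
qed

lemma expect_num_Suc:
  "expect (Suc k) (\<lambda>M. F (num (Suc e) M)) = expect k (\<lambda>M. F (num (Suc e) M)
     + share e M * (F (num (Suc e) M + 1) - F (num (Suc e) M))
     + share (Suc e) M * (F (num (Suc e) M - 1) - F (num (Suc e) M)))"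
  using avg_zero_one_split[of "\<lambda>_. 1" F e] by (simp add: share_def)

definition mean_slope :: "nat \<Rightarrow> nat \<Rightarrow> (nat \<Rightarrow> nat) \<Rightarrow> real" where
  "mean_slope n d M = avg (\<lambda>u. slope n d (M u))"

text \<open>The covariance, over a uniform urn \<open>v\<close>, of the slope at \<open>M v\<close>
  and the indicator of \<open>M v = j\<close>.\<close>

definition tilted_share :: "nat \<Rightarrow> nat \<Rightarrow> nat \<Rightarrow> (nat \<Rightarrow> nat) \<Rightarrow> real" where
  "tilted_share n d j M = (slope n d j - mean_slope n d M) * share j M"

text \<open>The slope solves the Stein equation of the binomial distribution with the indicator of \<open>d\<close> as
  right-hand side. Summed over the urns it is the discrete gradient of a function \<open>G\<close> of the
  configuration whose mean change under a uniformly random single-ball move is proportional to the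
  centred count; the covariances on the right come from the two ends of that move.\<close>

lemma stein_identity:
  fixes e k :: nat and F :: "real \<Rightarrow> real"
  defines "d \<equiv> Suc e" and "n \<equiv> Suc k"
  shows "expect n (\<lambda>M. (num d M - real m * occ_prob n d) * F (num d M))
    = real n * expect k (\<lambda>M. tilted_share n d e M * (F (num d M + 1) - F (num d M)))
    - real n * expect k (\<lambda>M. tilted_share n d d M * (F (num d M) - F (num d M - 1)))"
proof -
  let ?\<delta> = "slope n d"
  define \<Psi> where "\<Psi> M v = ?\<delta> (M v - 1) * F (num d M)" for M v
  \<comment> \<open>\<open>M u - of_bool (u = v)\<close> is the content of \<open>u\<close> after
    the moving ball has left \<open>v\<close>; the average runs over its new urn.\<close>
  define \<Phi> where "\<Phi> M v = avg (\<lambda>u. ?\<delta> (M u - of_bool (u = v))) * F (num d M)" for M v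
  have "(num d M - real m * occ_prob n d) * F (num d M)
     = (\<Sum>u<m. real (M u) * \<Psi> M u) - (\<Sum>v<m. real (M v) * \<Phi> M v)" if M: "(\<Sum>u<m. M u) = n" for M
  proof -
    have "(\<Sum>v<m. real (M v) * avg (\<lambda>u. ?\<delta> (M u - of_bool (u = v))))
      = avg (\<lambda>u. \<Sum>v<m. real (M v) * ?\<delta> (M u - of_bool (u = v)))"
      by (simp add: avg_sum avg_cmult)
    also have "\<dots> = avg (\<lambda>u. real (M u) * ?\<delta> (M u - 1) + (real n - real (M u)) * ?\<delta> (M u))"
    proof (intro avg_cong)
      fix u assume u: "u < m"
      have "(\<Sum>v<m. real (M v) * ?\<delta> (M u - of_bool (u = v)))
        = (\<Sum>v<m. real (M v) * ?\<delta> (M u) + (if v = u then real (M u) * (?\<delta> (M u - 1) - ?\<delta> (M u)) else 0))"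
        by (intro sum.cong) (auto simp: algebra_simps)
      also have "\<dots> = real n * ?\<delta> (M u) + real (M u) * (?\<delta> (M u - 1) - ?\<delta> (M u))"
        using u by (simp add: sum.distrib flip: sum_distrib_right M)
      finally show "(\<Sum>v<m. real (M v) * ?\<delta> (M u - of_bool (u = v)))
        = real (M u) * ?\<delta> (M u - 1) + (real n - real (M u)) * ?\<delta> (M u)"
        by (simp add: algebra_simps)
    qed
    also have "\<dots> = (\<Sum>u<m. (real (M u) * ?\<delta> (M u - 1) + (real n - real (M u)) * ?\<delta> (M u)) / m)"
      by (simp add: avg_def sum_divide_distrib)
    finally have \<Phi>: "(\<Sum>v<m. real (M v) * \<Phi> M v)
      = (\<Sum>u<m. (real (M u) * ?\<delta> (M u - 1) + (real n - real (M u)) * ?\<delta> (M u)) / m) * F (num d M)"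
      by (simp add: \<Phi>_def flip: mult.assoc sum_distrib_right)
    have \<Psi>: "(\<Sum>u<m. real (M u) * \<Psi> M u) = (\<Sum>u<m. real (M u) * ?\<delta> (M u - 1)) * F (num d M)"
      by (simp only: \<Psi>_def sum_distrib_right mult.assoc)
    have "(\<Sum>u<m. real (M u) * ?\<delta> (M u - 1))
        - (\<Sum>u<m. (real (M u) * ?\<delta> (M u - 1) + (real n - real (M u)) * ?\<delta> (M u)) / m)
      = (\<Sum>u<m. of_bool (M u = d) - occ_prob n d)"
      unfolding sum_subtractf[symmetric]
    proof (intro sum.cong refl)
      fix u assume "u \<in> {..<m}"
      then have "M u \<le> n" using member_le_sum[of u "{..<m}" M] M by simp
      then have "(1 - 1 / m) * real (M u) * ?\<delta> (M u - 1) - (real n - real (M u)) / m * ?\<delta> (M u)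
          = of_bool (M u = d) - occ_prob n d"
        by (intro slope_equation) (simp_all add: d_def)
      then show "real (M u) * ?\<delta> (M u - 1)
         - (real (M u) * ?\<delta> (M u - 1) + (real n - real (M u)) * ?\<delta> (M u)) / m
         = of_bool (M u = d) - occ_prob n d"
        by (simp add: algebra_simps add_divide_distrib diff_divide_distrib)
    qed
    also have "\<dots> = num d M - real m * occ_prob n d"
      by (simp add: sum_subtractf num_eq_sum)
    finally show ?thesis unfolding \<Phi> \<Psi> by (simp flip: left_diff_distrib)
  qed
  then have "expect n (\<lambda>M. (num d M - real m * occ_prob n d) * F (num d M))
      = expect n (\<lambda>M. \<Sum>u<m. real (M u) * \<Psi> M u) - expect n (\<lambda>M. \<Sum>v<m. real (M v) * \<Phi> M v)"
    unfolding expect_diff[symmetric] by (rule expect_cong)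
  also have "\<dots> = real n * expect k (\<lambda>M. avg (\<lambda>v. \<Psi> (add_ball M v) v) - avg (\<lambda>v. \<Phi> (add_ball M v) v))"
    unfolding n_def expect_transport expect_diff right_diff_distrib ..
  finally have main: "expect n (\<lambda>M. (num d M - real m * occ_prob n d) * F (num d M))
     = real n * expect k (\<lambda>M. avg (\<lambda>v. \<Psi> (add_ball M v) v) - avg (\<lambda>v. \<Phi> (add_ball M v) v))" .
  have step: "avg (\<lambda>v. \<Psi> (add_ball M v) v) - avg (\<lambda>v. \<Phi> (add_ball M v) v)
     = tilted_share n d e M * (F (num d M + 1) - F (num d M))
       - tilted_share n d d M * (F (num d M) - F (num d M - 1))" for M
  proof -
    \<comment> \<open>Once the moving ball is taken out, its new urn is independent of the old one:
      \<open>\<Phi>\<close> becomes the mean slope times \<open>F\<close>, and the difference from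
      \<open>\<Psi>\<close> is a covariance.\<close>
    define W where "W = mean_slope n d M"
    have "\<Phi> (add_ball M v) v = W * F (num d (add_ball M v))" for v
      unfolding \<Phi>_def W_def mean_slope_def
      by (intro arg_cong2[of _ _ _ _ "(*)"] avg_cong) (auto simp: add_ball_def)
    moreover have "\<Psi> (add_ball M v) v = ?\<delta> (M v) * F (num d (add_ball M v))" for v
      by (simp add: \<Psi>_def add_ball_def)
    ultimately have "avg (\<lambda>v. \<Psi> (add_ball M v) v) - avg (\<lambda>v. \<Phi> (add_ball M v) v)
       = avg (\<lambda>v. (?\<delta> (M v) - W) * F (num d (add_ball M v)))"
      by (simp add: left_diff_distrib flip: avg_diff)
    also have "\<dots> = avg (\<lambda>v. ?\<delta> (M v) - W) * F (num d M)
      + avg (\<lambda>v. (?\<delta> (M v) - W) * of_bool (M v = e)) * (F (num d M + 1) - F (num d M))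
      + avg (\<lambda>v. (?\<delta> (M v) - W) * of_bool (M v = d)) * (F (num d M - 1) - F (num d M))"
      unfolding d_def by (rule avg_zero_one_split)
    also have "avg (\<lambda>v. ?\<delta> (M v) - W) = 0"
      by (simp add: avg_diff W_def mean_slope_def)
    finally have diff: "avg (\<lambda>v. \<Psi> (add_ball M v) v) - avg (\<lambda>v. \<Phi> (add_ball M v) v)
       = 0 * F (num d M)
      + avg (\<lambda>v. (?\<delta> (M v) - W) * of_bool (M v = e)) * (F (num d M + 1) - F (num d M))
      + avg (\<lambda>v. (?\<delta> (M v) - W) * of_bool (M v = d)) * (F (num d M - 1) - F (num d M))" .
    have tilt: "avg (\<lambda>v. (?\<delta> (M v) - W) * of_bool (M v = j)) = tilted_share n d j M" for j
    proof -
      have "avg (\<lambda>v. (?\<delta> (M v) - W) * of_bool (M v = j)) = avg (\<lambda>v. (?\<delta> j - W) * of_bool (M v = j))"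
        by (intro avg_cong) auto
      then show ?thesis by (simp add: avg_cmult tilted_share_def W_def share_def)
    qed
    show ?thesis unfolding diff tilt by (simp add: algebra_simps)
  qed
  show ?thesis unfolding main step by (simp only: expect_diff right_diff_distrib)
qed

section \<open>Concentration of the Stein coefficients\<close>

lemma abs_mean_slope_le: "\<bar>mean_slope n d M\<bar> \<le> 2"
  unfolding mean_slope_def by (intro avg_abs_le abs_slope_le)

lemma abs_tilt_le: "\<bar>slope n d j - mean_slope n d M\<bar> \<le> 4"
  using abs_slope_le[of n d j] abs_mean_slope_le[of n d M] by linarith

lemma mean_slope_variance_le:
  "expect k (\<lambda>M. (mean_slope n d M - expect k (mean_slope n d))\<^sup>2) \<le> real k * (8 / m)\<^sup>2"
proof (rule expect_bounded_difference)
  fix M v w assume vw: "v < m" "w < m"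
  have step: "\<bar>mean_slope n d (add_ball M v) - mean_slope n d M\<bar> \<le> 4 / m" if "v < m" for v
  proof -
    have "mean_slope n d (add_ball M v) - mean_slope n d M
      = avg (\<lambda>u. of_bool (u = v) * (slope n d (Suc (M v)) - slope n d (M v)))"
      unfolding mean_slope_def avg_diff[symmetric] by (intro avg_cong) (auto simp: add_ball_def)
    also have "\<dots> = (slope n d (Suc (M v)) - slope n d (M v)) / m"
      using that by (simp add: avg_mult avg_of_bool_eq)
    also have "\<bar>\<dots>\<bar> \<le> 4 / m"
      using abs_slope_le[of n d "Suc (M v)"] abs_slope_le[of n d "M v"]
      unfolding abs_divide by (intro frac_le) auto
    finally show ?thesis .
  qed
  from step[OF vw(1)] step[OF vw(2)]
  show "\<bar>mean_slope n d (add_ball M v) - mean_slope n d (add_ball M w)\<bar> \<le> 8 / m"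
    by linarith
qed

text \<open>The deviation splits into that of the share, with a coefficient at most 4, and that of
  the mean slope, with the factor \<open>p\<close>. The first has variance of order
  \<open>p / m\<close>; bounded differences give the second
  \<open>p\<^sup>2 * k / m\<^sup>2\<close>, the source of \<open>1 + k / m\<close>.\<close>

lemma tilted_share_variance_le:
  assumes "j \<le> i"
  shows "expect k (\<lambda>M. (tilted_share n d j M - expect k (tilted_share n d j))\<^sup>2)
    \<le> 128 * var_const i * (1 + real k / m) * (occ_prob k j / m)"
proof -
  define p where "p = occ_prob k j"
  define V where "V = var_const i"
  define w where "w = expect k (mean_slope n d)"
  define c where "c = (slope n d j - w) * p"
  have p: "0 \<le> p" "p \<le> 1" by (simp_all add: p_def occ_prob_nonneg occ_prob_le_1)
  have V: "1 \<le> V" by (simp add: V_def var_const_ge_1)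
  have sq: "(x - y)\<^sup>2 \<le> 2 * (x\<^sup>2 + y\<^sup>2)" for x y :: real
    using zero_le_power2[of "x + y"] by (simp add: power2_eq_square algebra_simps)
  have "(tilted_share n d j M - c)\<^sup>2
      \<le> 2 * (4\<^sup>2 * (share j M - p)\<^sup>2 + p\<^sup>2 * (mean_slope n d M - w)\<^sup>2)" for M
  proof -
    have "tilted_share n d j M - c
      = (slope n d j - mean_slope n d M) * (share j M - p) - p * (mean_slope n d M - w)"
      by (simp add: tilted_share_def c_def algebra_simps)
    then have "(tilted_share n d j M - c)\<^sup>2
      \<le> 2 * (((slope n d j - mean_slope n d M) * (share j M - p))\<^sup>2 + (p * (mean_slope n d M - w))\<^sup>2)"
      by (simp only: sq)
    also have "\<dots> \<le> 2 * (4\<^sup>2 * (share j M - p)\<^sup>2 + p\<^sup>2 * (mean_slope n d M - w)\<^sup>2)"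
      using p by (intro mult_left_mono add_mono square_mult_le abs_tilt_le) auto
    finally show ?thesis .
  qed
  then have "expect k (\<lambda>M. (tilted_share n d j M - c)\<^sup>2)
     \<le> expect k (\<lambda>M. 2 * (4\<^sup>2 * (share j M - p)\<^sup>2 + p\<^sup>2 * (mean_slope n d M - w)\<^sup>2))"
    by (rule expect_mono)
  also have "\<dots> = 2 * (4\<^sup>2 * expect k (\<lambda>M. (share j M - p)\<^sup>2)
      + p\<^sup>2 * expect k (\<lambda>M. (mean_slope n d M - w)\<^sup>2))"
    by (simp add: expect_cmult expect_add)
  also have "\<dots> \<le> 2 * (4\<^sup>2 * (V * p / m) + p\<^sup>2 * (real k * (8 / m)\<^sup>2))"
    unfolding p_def V_def w_def using assms
    by (intro mult_left_mono add_mono share_variance_le' mean_slope_variance_le) auto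
  also have "\<dots> = (p / m) * (32 * V + 128 * (p * (real k / m)))"
    by (simp add: power2_eq_square algebra_simps)
  also have "\<dots> \<le> (p / m) * (128 * V * (1 + real k / m))"
  proof (rule mult_left_mono)
    have "p * (real k / m) \<le> V * (real k / m)" using p V by (intro mult_right_mono) auto
    then show "32 * V + 128 * (p * (real k / m)) \<le> 128 * V * (1 + real k / m)"
      using V by (simp add: distrib_left)
  qed (use p in auto)
  finally have "expect k (\<lambda>M. (tilted_share n d j M - c)\<^sup>2) \<le> 128 * V * (1 + real k / m) * (p / m)"
    by (simp add: mult_ac)
  with expect_deviation_mono[of "expect k (tilted_share n d j)" k "tilted_share n d j" c]
  show ?thesis by (simp add: p_def V_def)
qed

lemma abs_expect_tilted_share_le: "\<bar>expect k (tilted_share n d j)\<bar> \<le> 4 * occ_prob k j"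
proof -
  have "\<bar>expect k (tilted_share n d j)\<bar> \<le> expect k (\<lambda>M. \<bar>tilted_share n d j M\<bar>)" by (rule expect_abs)
  also have "\<dots> \<le> expect k (\<lambda>M. 4 * share j M)"
    unfolding tilted_share_def abs_mult
    by (intro expect_mono mult_mono abs_tilt_le) (auto simp: share_nonneg)
  also have "\<dots> = 4 * occ_prob k j" using expect_share[of k j] by (simp add: expect_cmult)
  finally show ?thesis .
qed

end

subsection \<open>The normal Stein equation for unions of unit cells\<close>

lemma has_real_derivative_normal_density:
  assumes "0 < \<sigma>"
  shows "(normal_density \<mu> \<sigma> has_real_derivative - ((x - \<mu>) / \<sigma>\<^sup>2) * normal_density \<mu> \<sigma> x) (at x)"
proof -
  have eq: "(\<lambda>x. - (x - \<mu>)\<^sup>2 / (2 * \<sigma>\<^sup>2)) = (\<lambda>x. - (1 / (2 * \<sigma>\<^sup>2)) * (x - \<mu>)\<^sup>2)"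
    by (simp add: fun_eq_iff)
  have "((\<lambda>x. (x - \<mu>)\<^sup>2) has_real_derivative 2 * (x - \<mu>)) (at x)"
    by (auto intro!: derivative_eq_intros)
  then have "((\<lambda>x. - (x - \<mu>)\<^sup>2 / (2 * \<sigma>\<^sup>2)) has_real_derivative
      - (1 / (2 * \<sigma>\<^sup>2)) * (2 * (x - \<mu>))) (at x)"
    unfolding eq by (rule DERIV_cmult)
  moreover have "- (1 / (2 * \<sigma>\<^sup>2)) * (2 * (x - \<mu>)) = - ((x - \<mu>) / \<sigma>\<^sup>2)"
    using assms by (simp add: field_simps)
  ultimately have "((\<lambda>x. - (x - \<mu>)\<^sup>2 / (2 * \<sigma>\<^sup>2)) has_real_derivative - ((x - \<mu>) / \<sigma>\<^sup>2)) (at x)"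
    by (simp only:)
  from DERIV_cmult[OF DERIV_fun_exp[OF this], of "1 / sqrt (2 * pi * \<sigma>\<^sup>2)"]
  show ?thesis by (simp add: normal_density_def[abs_def] mult_ac)
qed

lemma normal_density_reflect: "normal_density \<mu> \<sigma> (2 * \<mu> - x) = normal_density \<mu> \<sigma> x"
  by (simp add: normal_density_def power2_commute[of \<mu> x])

lemma normal_density_tendsto_0:
  assumes "0 < \<sigma>"
  shows "(normal_density \<mu> \<sigma> \<longlongrightarrow> 0) at_top"
proof -
  have "filterlim (\<lambda>x. x - \<mu>) at_top at_top"
    using filterlim_tendsto_add_at_top[OF tendsto_const[of "-\<mu>"] filterlim_ident] by simp
  then have "filterlim (\<lambda>x. (x - \<mu>)\<^sup>2) at_top at_top"
    by (intro filterlim_pow_at_top) auto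
  then have "filterlim (\<lambda>x. (x - \<mu>)\<^sup>2 * (1 / (2 * \<sigma>\<^sup>2))) at_top at_top"
    using assms by (intro filterlim_at_top_mult_tendsto_pos[OF tendsto_const]) auto
  then have "filterlim (\<lambda>x. - ((x - \<mu>)\<^sup>2 * (1 / (2 * \<sigma>\<^sup>2)))) at_bot at_top"
    by (simp add: filterlim_uminus_at_top)
  then have "((\<lambda>x. exp (- ((x - \<mu>)\<^sup>2 * (1 / (2 * \<sigma>\<^sup>2))))) \<longlongrightarrow> 0) at_top"
    by (rule filterlim_compose[OF exp_at_bot])
  from tendsto_mult_left[OF this, of "1 / sqrt (2 * pi * \<sigma>\<^sup>2)"]
  show ?thesis by (simp add: normal_density_def[abs_def])
qed

locale normal_stein =
  fixes \<mu> \<sigma> :: real and A :: "int set"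
  assumes \<sigma>_pos: "0 < \<sigma>"
begin

abbreviation \<phi> :: "real \<Rightarrow> real" where "\<phi> \<equiv> normal_density \<mu> \<sigma>"

definition N :: "real measure" where "N = density lborel \<phi>"

text \<open>The union of the cells \<open>{z - 1/2 ..< z + 1/2}\<close> with \<open>z\<close> in
  \<open>A\<close>, so that \<beta> is the mass of \<open>A\<close> under the discretized normal
  law.\<close>

definition B :: "real set" where "B = {x. \<lfloor>x + 1 / 2\<rfloor> \<in> A}"

definition h :: "int \<Rightarrow> real" where "h k = of_bool (k \<in> A)"

definition \<beta> :: real where "\<beta> = measure N B"

definition I :: "real \<Rightarrow> real" where "I x = measure N (B \<inter> {..<x}) - \<beta> * measure N {..<x}"

text \<open>The standard solution of \<open>\<sigma>\<^sup>2 * f' x - (x - \<mu>) * f x = indicator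
  B x - \<beta>\<close> away from cell boundaries: \<open>I\<close> integrates the right-hand side
  against the density from minus infinity.\<close>

definition f :: "real \<Rightarrow> real" where "f x = I x / (\<sigma>\<^sup>2 * \<phi> x)"

sublocale N: prob_space N
  unfolding N_def by (rule prob_space_normal_density[OF \<sigma>_pos])

lemma sets_N [measurable_cong, simp]: "sets N = sets borel" and space_N [simp]: "space N = UNIV"
  by (simp_all add: N_def)

lemma \<phi>_pos [simp]: "0 < \<phi> x"
  using \<sigma>_pos by (rule normal_density_pos)

lemma sets_B [measurable]: "B \<in> sets borel"
proof -
  have "B = (\<lambda>x::real. \<lfloor>x + 1 / 2\<rfloor>) -` A \<inter> space borel" by (auto simp: B_def)
  also have "\<dots> \<in> sets borel" by (rule measurable_sets[of _ _ "count_space UNIV"]) auto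
  finally show ?thesis .
qed

lemma \<beta>_bounds: "0 \<le> \<beta>" "\<beta> \<le> 1"
  by (simp_all add: \<beta>_def)

lemma h_minus_\<beta>: "\<bar>h k - \<beta>\<bar> \<le> 1"
  using \<beta>_bounds by (auto simp: h_def)

lemma measure_Ico:
  assumes "a \<le> x"
  shows "measure N {a..<x} = integral {a..x} \<phi>"
proof -
  have int: "set_integrable lborel {a..<x} \<phi>"
    unfolding set_integrable_def
    by (intro integrable_mult_indicator integrable_normal_density \<sigma>_pos) auto
  have "emeasure N {a..<x} = (\<integral>\<^sup>+t. ennreal (indicator {a..<x} t * \<phi> t) \<partial>lborel)"
    unfolding N_def by (subst emeasure_density) (auto intro!: nn_integral_cong split: split_indicator)
  also have "\<dots> = ennreal (LINT t:{a..<x}|lborel. \<phi> t)"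
    using int unfolding set_lebesgue_integral_def set_integrable_def real_scaleR_def
    by (intro nn_integral_eq_integral) simp_all
  finally have "emeasure N {a..<x} = ennreal (LINT t:{a..<x}|lborel. \<phi> t)" .
  moreover have "0 \<le> (LINT t:{a..<x}|lborel. \<phi> t)"
    unfolding set_lebesgue_integral_def by (intro integral_nonneg_AE) simp
  ultimately have "measure N {a..<x} = (LINT t:{a..<x}|lborel. \<phi> t)"
    by (simp add: measure_def)
  also have "\<dots> = integral {a..<x} \<phi>" by (rule set_borel_integral_eq_integral(2)[OF int])
  also have "\<dots> = integral {a..x} \<phi>"
  proof (rule integral_spike_set)
    show "negligible {t \<in> {a..<x} - {a..x}. \<phi> t \<noteq> 0}"
      by (rule negligible_subset[of "{}"]) auto
    show "negligible {t \<in> {a..x} - {a..<x}. \<phi> t \<noteq> 0}"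
      by (rule negligible_subset[of "{x}"]) auto
  qed
  finally show ?thesis .
qed

lemma measure_lessThan_diff:
  assumes "S \<in> sets borel" "x \<le> y"
  shows "measure N (S \<inter> {..<y}) - measure N (S \<inter> {..<x}) = measure N (S \<inter> {x..<y})"
proof -
  have "S \<inter> {..<y} = (S \<inter> {..<x}) \<union> (S \<inter> {x..<y})" using assms(2) by auto
  moreover have "measure N ((S \<inter> {..<x}) \<union> (S \<inter> {x..<y})) = measure N (S \<inter> {..<x}) + measure N (S \<inter> {x..<y})"
    using assms by (intro N.finite_measure_Union) auto
  ultimately show ?thesis by simp
qed

section \<open>Distribution function and tails of the normal law\<close>

lemma has_real_derivative_cdf: "((\<lambda>x. measure N {..<x}) has_real_derivative \<phi> x) (at x)"
proof -
  define a b where "a = x - 1" and "b = x + 1"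
  have cont: "continuous_on {a..b} \<phi>"
    using has_real_derivative_normal_density[OF \<sigma>_pos] by (meson DERIV_isCont continuous_at_imp_continuous_on)
  have "((\<lambda>x. integral {a..x} \<phi>) has_real_derivative \<phi> x) (at x within {a..b})"
    by (rule integral_has_real_derivative[OF cont]) (auto simp: a_def b_def)
  moreover have "at x within {a..b} = at x"
    by (rule at_within_interior) (auto simp: a_def b_def interior_atLeastAtMost_real)
  ultimately have "((\<lambda>x. measure N {..<a} + integral {a..x} \<phi>) has_real_derivative \<phi> x) (at x)"
    by (auto intro!: derivative_eq_intros)
  moreover have "\<forall>\<^sub>F y in nhds x. measure N {..<y} = measure N {..<a} + integral {a..y} \<phi>"
  proof -
    have "measure N {..<y} = measure N {..<a} + integral {a..y} \<phi>" if "y > a" for y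
      using measure_lessThan_diff[of UNIV a y] measure_Ico[of a y] that by simp
    moreover have "\<forall>\<^sub>F y in nhds x. y > a"
      by (rule eventually_nhds_in_open[of "{a<..}" x, simplified greaterThan_iff]) (auto simp: a_def)
    ultimately show ?thesis by (auto elim: eventually_mono)
  qed
  ultimately show ?thesis
    by (subst DERIV_cong_ev[OF refl _ refl]) auto
qed

text \<open>Mills ratio bound: on the tail \<open>x - \<mu>\<close> is at most
  \<open>t - \<mu>\<close>, and \<open>(t - \<mu>) * \<phi> t\<close> has the antiderivative
  \<open>- (\<sigma>\<^sup>2 * \<phi> t)\<close>.\<close>

lemma upper_tail_le:
  assumes "\<mu> < x"
  shows "(x - \<mu>) * measure N {x..} \<le> \<sigma>\<^sup>2 * \<phi> x"
proof -
  have deriv: "((\<lambda>t. - (\<sigma>\<^sup>2 * \<phi> t)) has_real_derivative (t - \<mu>) * \<phi> t) (at t)" for t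
    using \<sigma>_pos by (auto intro!: derivative_eq_intros has_real_derivative_normal_density simp: field_simps)
  have lim: "((\<lambda>t. - (\<sigma>\<^sup>2 * \<phi> t)) \<longlongrightarrow> 0) at_top"
    using tendsto_minus[OF tendsto_mult_left[OF normal_density_tendsto_0[OF \<sigma>_pos, of \<mu>], of "\<sigma>\<^sup>2"]] by simp
  have "ennreal (x - \<mu>) * emeasure N {x..} = (\<integral>\<^sup>+t. ennreal ((x - \<mu>) * \<phi> t) * indicator {x..} t \<partial>lborel)"
    using assms unfolding N_def
    by (simp add: emeasure_density nn_integral_cmult ennreal_mult' mult.assoc)
  also have "\<dots> \<le> (\<integral>\<^sup>+t. ennreal ((t - \<mu>) * \<phi> t) * indicator {x..} t \<partial>lborel)"
    using assms by (intro nn_integral_mono) (auto split: split_indicator intro!: ennreal_leI mult_right_mono)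
  also have "\<dots> = 0 - (- (\<sigma>\<^sup>2 * \<phi> x))"
    using assms by (intro nn_integral_FTC_atLeast deriv lim) auto
  finally have "ennreal ((x - \<mu>) * measure N {x..}) \<le> ennreal (\<sigma>\<^sup>2 * \<phi> x)"
    using assms by (simp add: N.emeasure_eq_measure ennreal_mult')
  then show ?thesis by (simp add: ennreal_le_iff)
qed

lemma lower_tail_le:
  assumes "x < \<mu>"
  shows "(\<mu> - x) * measure N {..<x} \<le> \<sigma>\<^sup>2 * \<phi> x"
proof -
  have "emeasure N {..<x} = (\<integral>\<^sup>+t. ennreal (\<phi> t) * indicator {..<x} t \<partial>lborel)"
    unfolding N_def by (simp add: emeasure_density)
  also have "\<dots> = (\<integral>\<^sup>+t. ennreal (\<phi> (2 * \<mu> + (-1) * t)) * indicator {..<x} (2 * \<mu> + (-1) * t) \<partial>lborel)"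
    by (subst nn_integral_real_affine[where c = "-1" and t = "2 * \<mu>"]) auto
  also have "\<dots> \<le> (\<integral>\<^sup>+t. ennreal (\<phi> t) * indicator {2 * \<mu> - x..} t \<partial>lborel)"
    by (intro nn_integral_mono) (auto simp: normal_density_reflect split: split_indicator)
  also have "\<dots> = emeasure N {2 * \<mu> - x..}"
    unfolding N_def by (simp add: emeasure_density)
  finally have "measure N {..<x} \<le> measure N {2 * \<mu> - x..}"
    by (simp add: N.emeasure_eq_measure)
  then have "(\<mu> - x) * measure N {..<x} \<le> (\<mu> - x) * measure N {2 * \<mu> - x..}"
    using assms by (intro mult_left_mono) auto
  also have "\<dots> \<le> \<sigma>\<^sup>2 * \<phi> x"
    using upper_tail_le[of "2 * \<mu> - x"] assms by (simp add: normal_density_reflect)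
  finally show ?thesis .
qed

lemma abs_prob_product_le:
  assumes "L \<in> sets borel"
  shows "\<bar>measure N (B \<inter> L) - \<beta> * measure N L\<bar> \<le> measure N L"
proof -
  have "0 \<le> measure N (B \<inter> L)" "measure N (B \<inter> L) \<le> measure N L"
    using assms by (auto intro!: N.finite_measure_mono)
  moreover have "0 \<le> \<beta> * measure N L" "\<beta> * measure N L \<le> measure N L"
    using \<beta>_bounds by (auto intro!: mult_left_le_one_le)
  ultimately show ?thesis by linarith
qed

lemma abs_I_le_lower: "\<bar>I x\<bar> \<le> measure N {..<x}"
  unfolding I_def by (rule abs_prob_product_le) simp

text \<open>The centred indicator has total integral zero, so \<open>I\<close> is also minus the
  integral over the upper tail. Thus on either side of \<mu> the smaller tail can be used.\<close>

lemma abs_I_le_upper: "\<bar>I x\<bar> \<le> measure N {x..}"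
proof -
  have "measure N (B \<inter> {..<x}) + measure N (B \<inter> {x..}) = \<beta>"
    unfolding \<beta>_def by (subst N.finite_measure_Union[symmetric]) (auto intro!: arg_cong[of _ _ "measure N"])
  moreover have "measure N {..<x} + measure N {x..} = 1"
  proof -
    have "{..<x} \<union> {x..} = UNIV" by auto
    then show ?thesis
      using N.prob_space by (subst N.finite_measure_Union[symmetric]) auto
  qed
  then have "measure N {..<x} = 1 - measure N {x..}" by simp
  moreover have "measure N (B \<inter> {..<x}) - \<beta> * (1 - r) = - (q - \<beta> * r)"
    if "measure N (B \<inter> {..<x}) + q = \<beta>" for q r
    using that by (simp add: algebra_simps)
  ultimately have "I x = - (measure N (B \<inter> {x..}) - \<beta> * measure N {x..})"
    unfolding I_def by presburger
  then show ?thesis using abs_prob_product_le[of "{x..}"] by simp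
qed

lemma abs_mult_f_le_1: "\<bar>(x - \<mu>) * f x\<bar> \<le> 1"
proof -
  consider "x < \<mu>" | "x = \<mu>" | "\<mu> < x" by linarith
  then have "\<bar>x - \<mu>\<bar> * \<bar>I x\<bar> \<le> \<sigma>\<^sup>2 * \<phi> x"
  proof cases
    case 1
    then have "\<bar>x - \<mu>\<bar> * \<bar>I x\<bar> \<le> (\<mu> - x) * measure N {..<x}"
      using abs_I_le_lower by (intro mult_mono) auto
    with lower_tail_le[OF 1] show ?thesis by simp
  next
    case 3
    then have "\<bar>x - \<mu>\<bar> * \<bar>I x\<bar> \<le> (x - \<mu>) * measure N {x..}"
      using abs_I_le_upper by (intro mult_mono) auto
    with upper_tail_le[OF 3] show ?thesis by simp
  qed (simp add: less_imp_le)
  then show ?thesis using \<sigma>_pos by (simp add: f_def abs_mult divide_le_eq)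
qed

text \<open>Beyond one standard deviation this follows from \<open>abs_mult_f_le_1\<close>. Within
  it, the density is at least \<open>exp (- 1 / 2) / (sqrt (2 * pi) * \<sigma>)\<close>, and the
  constant covers \<open>sqrt (2 * pi * exp 1) \<le> 5\<close>.\<close>

lemma abs_f_le: "\<bar>f x\<bar> \<le> 5 / \<sigma>"
proof (cases "\<sigma> \<le> \<bar>x - \<mu>\<bar>")
  case True
  have "\<sigma> * \<bar>f x\<bar> \<le> \<bar>x - \<mu>\<bar> * \<bar>f x\<bar>" by (intro mult_right_mono True) auto
  also have "\<dots> \<le> 1" using abs_mult_f_le_1[of x] by (simp add: abs_mult)
  finally have "\<bar>f x\<bar> * \<sigma> \<le> 5" by (simp add: mult.commute)
  then show ?thesis using \<sigma>_pos by (simp add: pos_le_divide_eq)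
next
  case False
  then have "(x - \<mu>)\<^sup>2 \<le> \<sigma>\<^sup>2" using \<sigma>_pos by (simp add: abs_le_square_iff[symmetric])
  then have "(x - \<mu>)\<^sup>2 / (2 * \<sigma>\<^sup>2) \<le> 1 / 2" using \<sigma>_pos by (simp add: field_simps)
  then have "exp (- (1 / 2)) \<le> exp (- (x - \<mu>)\<^sup>2 / (2 * \<sigma>\<^sup>2))" by simp
  then have "exp (- (1 / 2)) / (sqrt (2 * pi) * \<sigma>) \<le> \<phi> x"
    using \<sigma>_pos by (simp add: normal_density_def real_sqrt_mult divide_right_mono)
  moreover have "1 / 5 \<le> exp (- (1 / 2)) / sqrt (2 * pi)"
  proof -
    have "sqrt (2 * pi) * exp (1 / 2) \<le> 5"
    proof (rule power2_le_imp_le)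
      have "2 * pi * exp 1 \<le> 2 * 4 * 3"
        using pi_less_4 exp_le by (intro mult_mono) auto
      moreover have "(sqrt (2 * pi) * exp (1 / 2))\<^sup>2 = 2 * pi * exp 1"
        by (simp add: power_mult_distrib flip: exp_double)
      ultimately show "(sqrt (2 * pi) * exp (1 / 2))\<^sup>2 \<le> 5\<^sup>2" by simp
    qed simp
    then show ?thesis by (simp add: exp_minus field_simps)
  qed
  then have "1 / 5 / \<sigma> \<le> exp (- (1 / 2)) / sqrt (2 * pi) / \<sigma>"
    using \<sigma>_pos by (intro divide_right_mono) auto
  ultimately have "1 / 5 / \<sigma> \<le> \<phi> x" by simp
  then have "\<sigma>\<^sup>2 * (1 / 5 / \<sigma>) \<le> \<sigma>\<^sup>2 * \<phi> x" by (intro mult_left_mono) auto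
  then have le: "\<sigma> / 5 \<le> \<sigma>\<^sup>2 * \<phi> x" using \<sigma>_pos by (simp add: power2_eq_square)
  have "\<bar>I x\<bar> \<le> 1" using abs_I_le_lower[of x] N.prob_le_1[of "{..<x}"] by linarith
  then have "\<bar>f x\<bar> \<le> 1 / (\<sigma>\<^sup>2 * \<phi> x)"
    using \<sigma>_pos by (simp add: f_def divide_right_mono)
  also have "\<dots> \<le> 1 / (\<sigma> / 5)" using le \<sigma>_pos by (intro divide_left_mono) auto
  finally show ?thesis by simp
qed

lemma I_diff:
  assumes "real_of_int k - 1 / 2 \<le> x" "x \<le> y" "y \<le> real_of_int k + 1 / 2"
  shows "I y - I x = (h k - \<beta>) * (measure N {..<y} - measure N {..<x})"
proof -
  have "\<lfloor>t + 1 / 2\<rfloor> = k" if "t \<in> {x..<y}" for t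
    using that assms by (intro floor_unique) auto
  then have "B \<inter> {x..<y} = (if k \<in> A then {x..<y} else {})" by (auto simp: B_def)
  then have "measure N (B \<inter> {x..<y}) = h k * measure N {x..<y}" by (simp add: h_def)
  moreover have "measure N (B \<inter> {..<y}) - measure N (B \<inter> {..<x}) = measure N (B \<inter> {x..<y})"
    "measure N {..<y} - measure N {..<x} = measure N {x..<y}"
    using measure_lessThan_diff[of B x y] measure_lessThan_diff[of UNIV x y] assms by simp_all
  ultimately show ?thesis by (simp add: I_def algebra_simps)
qed

text \<open>\<open>f\<close> may have kinks at the ends of a cell. The function \<open>F\<close>
  continues the branch of \<open>f\<close> on cell \<open>k\<close> smoothly past them, so the mean
  value theorem applies up to the boundary.\<close>

lemma f_mean_value:
  assumes "real_of_int k - 1 / 2 \<le> x" "x < y" "y \<le> real_of_int k + 1 / 2"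
  shows "\<exists>\<xi>. x < \<xi> \<and> \<xi> < y \<and> \<sigma>\<^sup>2 * (f y - f x) = (y - x) * ((\<xi> - \<mu>) * f \<xi> + h k - \<beta>)"
proof -
  define F where "F t = (I x + (h k - \<beta>) * (measure N {..<t} - measure N {..<x})) / (\<sigma>\<^sup>2 * \<phi> t)" for t
  have F: "F t = f t" if "x \<le> t" "t \<le> y" for t
    using I_diff[of k x t] that assms by (simp add: F_def f_def)
  have "(F has_real_derivative ((t - \<mu>) * F t + h k - \<beta>) / \<sigma>\<^sup>2) (at t)" for t
  proof -
    have pos: "\<sigma>\<^sup>2 * \<phi> t \<noteq> 0" using \<sigma>_pos \<phi>_pos[of t, THEN less_imp_neq] by simp
    define c where "c = I x + (h k - \<beta>) * (measure N {..<t} - measure N {..<x})"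
    have "(F has_real_derivative ((h k - \<beta>) * \<phi> t * (\<sigma>\<^sup>2 * \<phi> t)
        - c * (\<sigma>\<^sup>2 * (- ((t - \<mu>) / \<sigma>\<^sup>2) * \<phi> t))) / ((\<sigma>\<^sup>2 * \<phi> t) * (\<sigma>\<^sup>2 * \<phi> t))) (at t)"
      unfolding F_def c_def using pos
      by (auto intro!: derivative_eq_intros has_real_derivative_normal_density \<sigma>_pos has_real_derivative_cdf)
    moreover have "((h k - \<beta>) * \<phi> t * (\<sigma>\<^sup>2 * \<phi> t)
        - c * (\<sigma>\<^sup>2 * (- ((t - \<mu>) / \<sigma>\<^sup>2) * \<phi> t))) / ((\<sigma>\<^sup>2 * \<phi> t) * (\<sigma>\<^sup>2 * \<phi> t))
        = ((t - \<mu>) * (c / (\<sigma>\<^sup>2 * \<phi> t)) + h k - \<beta>) / \<sigma>\<^sup>2"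
      using pos \<sigma>_pos by (simp add: field_simps)
    ultimately show ?thesis by (simp add: F_def c_def)
  qed
  then obtain \<xi> where "x < \<xi>" "\<xi> < y" "F y - F x = (y - x) * (((\<xi> - \<mu>) * F \<xi> + h k - \<beta>) / \<sigma>\<^sup>2)"
    using MVT2[of x y F "\<lambda>t. ((t - \<mu>) * F t + h k - \<beta>) / \<sigma>\<^sup>2"] assms by auto
  then show ?thesis using F[of x] F[of y] F[of \<xi>] assms \<sigma>_pos
    by (intro exI[of _ \<xi>]) simp
qed

lemma f_Lipschitz_cell:
  assumes "real_of_int k - 1 / 2 \<le> x" "x \<le> y" "y \<le> real_of_int k + 1 / 2"
  shows "\<bar>f y - f x\<bar> \<le> 2 / \<sigma>\<^sup>2 * (y - x)"
proof (cases "x = y")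
  case False
  then obtain \<xi> where \<xi>: "\<sigma>\<^sup>2 * (f y - f x) = (y - x) * ((\<xi> - \<mu>) * f \<xi> + h k - \<beta>)"
    using f_mean_value[of k x y] assms by auto
  have "\<bar>(\<xi> - \<mu>) * f \<xi> + h k - \<beta>\<bar> \<le> 2"
    using abs_mult_f_le_1[of \<xi>] h_minus_\<beta>[of k] by linarith
  then have "\<bar>\<sigma>\<^sup>2 * (f y - f x)\<bar> \<le> (y - x) * 2"
    unfolding \<xi> abs_mult using assms by (intro mult_mono) auto
  then have "\<sigma>\<^sup>2 * \<bar>f y - f x\<bar> \<le> (y - x) * 2" by (simp only: abs_mult abs_power2)
  then have "\<bar>f y - f x\<bar> \<le> (y - x) * 2 / \<sigma>\<^sup>2"
    using \<sigma>_pos by (subst pos_le_divide_eq) (simp_all only: zero_less_power mult.commute)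
  then show ?thesis by (simp add: mult.commute)
qed simp

lemma f_Lipschitz_unit:
  assumes "real_of_int k \<le> x" "x \<le> real_of_int k + 1"
  shows "\<bar>f x - f (real_of_int k)\<bar> \<le> 2 / \<sigma>\<^sup>2 * (x - real_of_int k)"
proof (cases "x \<le> real_of_int k + 1 / 2")
  case True
  then show ?thesis using f_Lipschitz_cell[of k "real_of_int k" x] assms by simp
next
  case False
  define z where "z = real_of_int k + 1 / 2"
  have "\<bar>f z - f (real_of_int k)\<bar> \<le> 2 / \<sigma>\<^sup>2 * (z - real_of_int k)"
    using f_Lipschitz_cell[of k "real_of_int k" z] by (simp add: z_def)
  moreover have "\<bar>f x - f z\<bar> \<le> 2 / \<sigma>\<^sup>2 * (x - z)"
    using f_Lipschitz_cell[of "k + 1" z x] False assms by (simp add: z_def)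
  ultimately have "\<bar>f x - f (real_of_int k)\<bar> \<le> 2 / \<sigma>\<^sup>2 * (z - real_of_int k) + 2 / \<sigma>\<^sup>2 * (x - z)"
    by linarith
  also have "\<dots> = 2 / \<sigma>\<^sup>2 * ((z - real_of_int k) + (x - z))" by (simp only: distrib_left)
  finally show ?thesis by simp
qed

lemma f_step_le: "\<bar>f (real_of_int k + 1) - f (real_of_int k)\<bar> \<le> 2 / \<sigma>\<^sup>2"
  using f_Lipschitz_unit[of k "real_of_int k + 1"] by simp

text \<open>The product is split so that the Lipschitz bound multiplies the distance of the integer
  \<open>k\<close>, not of \<open>x\<close>, from \<mu>; that distance is averaged later.\<close>

lemma mult_f_variation:
  assumes "real_of_int k \<le> x" "x \<le> real_of_int k + 1"
  shows "\<bar>(x - \<mu>) * f x - (real_of_int k - \<mu>) * f (real_of_int k)\<bar>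
    \<le> 5 / \<sigma> + 2 / \<sigma>\<^sup>2 * \<bar>real_of_int k - \<mu>\<bar>"
proof -
  have "(x - \<mu>) * f x - (real_of_int k - \<mu>) * f (real_of_int k)
     = (x - real_of_int k) * f x + (real_of_int k - \<mu>) * (f x - f (real_of_int k))"
    by (simp add: algebra_simps)
  moreover have "\<bar>(x - real_of_int k) * f x\<bar> \<le> 1 * (5 / \<sigma>)"
    unfolding abs_mult using assms abs_f_le by (intro mult_mono) auto
  moreover have "\<bar>(real_of_int k - \<mu>) * (f x - f (real_of_int k))\<bar> \<le> \<bar>real_of_int k - \<mu>\<bar> * (2 / \<sigma>\<^sup>2)"
  proof -
    have "2 / \<sigma>\<^sup>2 * (x - real_of_int k) \<le> 2 / \<sigma>\<^sup>2 * 1" using assms by (intro mult_left_mono) auto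
    then show ?thesis unfolding abs_mult using f_Lipschitz_unit[OF assms] by (intro mult_left_mono) auto
  qed
  ultimately show ?thesis by (simp add: mult.commute)
qed

text \<open>The step from \<open>k\<close> to \<open>k + 1\<close> runs half in cell
  \<open>k\<close> and half in cell \<open>k + 1\<close>, hence the mean of two values of
  \<open>h\<close>. The error is the variation of \<open>(x - \<mu>) * f x\<close> over the
  step.\<close>

lemma stein_equation:
  "\<bar>\<sigma>\<^sup>2 * (f (real_of_int k + 1) - f (real_of_int k))
      - ((real_of_int k - \<mu>) * f (real_of_int k) + (h k + h (k + 1)) / 2 - \<beta>)\<bar>
    \<le> 5 / \<sigma> + 2 / \<sigma>\<^sup>2 * \<bar>real_of_int k - \<mu>\<bar>"
proof -
  define z where "z = real_of_int k + 1 / 2"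
  let ?\<psi> = "\<lambda>x. (x - \<mu>) * f x"
  obtain \<xi> where \<xi>: "real_of_int k < \<xi>" "\<xi> < z"
    "\<sigma>\<^sup>2 * (f z - f (real_of_int k)) = (z - real_of_int k) * (?\<psi> \<xi> + h k - \<beta>)"
    using f_mean_value[of k "real_of_int k" z] by (auto simp: z_def)
  obtain \<zeta> where \<zeta>: "z < \<zeta>" "\<zeta> < real_of_int k + 1"
    "\<sigma>\<^sup>2 * (f (real_of_int k + 1) - f z) = (real_of_int k + 1 - z) * (?\<psi> \<zeta> + h (k + 1) - \<beta>)"
    using f_mean_value[of "k + 1" z "real_of_int k + 1"] by (auto simp: z_def)
  have "\<sigma>\<^sup>2 * (f (real_of_int k + 1) - f (real_of_int k))
     = \<sigma>\<^sup>2 * (f z - f (real_of_int k)) + \<sigma>\<^sup>2 * (f (real_of_int k + 1) - f z)"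
    by (simp add: algebra_simps)
  also have "\<dots> = (?\<psi> \<xi> + ?\<psi> \<zeta>) / 2 + (h k + h (k + 1)) / 2 - \<beta>"
    unfolding \<xi>(3) \<zeta>(3) by (simp add: z_def field_simps)
  finally have "\<sigma>\<^sup>2 * (f (real_of_int k + 1) - f (real_of_int k))
      - (?\<psi> (real_of_int k) + (h k + h (k + 1)) / 2 - \<beta>)
     = ((?\<psi> \<xi> - ?\<psi> (real_of_int k)) + (?\<psi> \<zeta> - ?\<psi> (real_of_int k))) / 2"
    by (simp add: field_simps)
  moreover have "\<bar>?\<psi> \<xi> - ?\<psi> (real_of_int k)\<bar> \<le> 5 / \<sigma> + 2 / \<sigma>\<^sup>2 * \<bar>real_of_int k - \<mu>\<bar>"
    using \<xi> by (intro mult_f_variation) (auto simp: z_def)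
  moreover have "\<bar>?\<psi> \<zeta> - ?\<psi> (real_of_int k)\<bar> \<le> 5 / \<sigma> + 2 / \<sigma>\<^sup>2 * \<bar>real_of_int k - \<mu>\<bar>"
    using \<zeta> by (intro mult_f_variation) (auto simp: z_def)
  moreover have "\<bar>c\<bar> \<le> r" if "c = (a + b) / 2" "\<bar>a\<bar> \<le> r" "\<bar>b\<bar> \<le> r" for a b c r :: real
    using that by (simp add: abs_le_iff)
  ultimately show ?thesis by blast
qed

end

subsection \<open>Approximation in the non-degenerate regime\<close>

lemma smooth_const_ge_1: "1 \<le> smooth_const d"
proof -
  have "1 * 1 * 1 * 1 \<le> 16 * (real d + 1) * ((real d + 1)\<^sup>2 + 1) * sqrt (var_const (Suc d))"
    using var_const_ge_1[of "Suc d"] by (intro mult_mono) auto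
  then show ?thesis by (simp add: smooth_const_def)
qed

lemma sqrt_le_self: "1 \<le> x \<Longrightarrow> sqrt x \<le> x"
  using real_sqrt_le_mono[of x "x * x"] by simp

text \<open>Size assumptions refer to \<open>k\<close>, one ball less, because the right side of the
  Stein identity lives there. A mean of at least 2 keeps the mean counts for \<open>k\<close> and
  \<open>Suc k\<close> balls, which differ by at most 1, within a factor 2.\<close>

locale urns_approximation = urns +
  fixes e k :: nat and A :: "int set"
  assumes e: "1 \<le> e"
    and k_large: "threshold (Suc e) \<le> real k"
    and m_large: "threshold (Suc e) \<le> real m"
    and mean_large: "2 \<le> real m * occ_prob (Suc k) (Suc e)"
    and variance_large: "1 \<le> expect (Suc k) (\<lambda>M. (num (Suc e) M - real m * occ_prob (Suc k) (Suc e))\<^sup>2)"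
begin

abbreviation d :: nat where "d \<equiv> Suc e"
abbreviation n :: nat where "n \<equiv> Suc k"
abbreviation T :: "(nat \<Rightarrow> nat) \<Rightarrow> real" where "T \<equiv> num d"

definition mu :: real where "mu = real m * occ_prob n d"
definition sig :: real where "sig = sqrt (expect n (\<lambda>M. (T M - mu)\<^sup>2))"
definition \<kappa> :: real where "\<kappa> = real m * occ_prob k d"
definition L :: real where "L = 1 + real n / m"
definition V :: real where "V = var_const (Suc d)"
definition a :: real where "a = smooth_const d"
definition r :: real where "r = sqrt L"

lemma sig_ge_1: "1 \<le> sig"
  using variance_large by (simp add: sig_def mu_def)

sublocale st: normal_stein mu sig A
  using sig_ge_1 by unfold_locales simp

lemma ge_1: "1 \<le> V" "1 \<le> a" "1 \<le> L" "1 \<le> r"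
  by (simp_all add: V_def a_def L_def r_def var_const_ge_1 smooth_const_ge_1)

lemma r_power: "r\<^sup>2 = L" "r ^ 4 = L\<^sup>2" "r ^ 6 = L ^ 3"
proof -
  show r2: "r\<^sup>2 = L" using ge_1 by (simp add: r_def)
  have "r ^ 4 = (r\<^sup>2)\<^sup>2" "r ^ 6 = (r\<^sup>2) ^ 3" by (simp_all flip: power_mult)
  then show "r ^ 4 = L\<^sup>2" "r ^ 6 = L ^ 3" by (simp_all add: r2)
qed

lemma k_ge: "2 * d + 1 \<le> k"
  using threshold_ge[of d] k_large by linarith

lemma mu_diff_\<kappa>: "\<bar>mu - \<kappa>\<bar> \<le> 1"
proof -
  have "mu = occ_prob k e + (real m - 1) * occ_prob k d"
    by (simp add: mu_def occ_prob_Suc[of k d] field_simps)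
  then have "mu - \<kappa> = occ_prob k e - occ_prob k d" by (simp add: \<kappa>_def algebra_simps)
  then show ?thesis
    using occ_prob_nonneg[of k e] occ_prob_nonneg[of k d] occ_prob_le_1[of k e] occ_prob_le_1[of k d]
    by (simp add: abs_le_iff)
qed

lemma \<kappa>_bounds: "1 \<le> \<kappa>" "mu \<le> 2 * \<kappa>" "\<kappa> \<le> 2 * mu" "\<kappa> \<le> m"
proof -
  show "1 \<le> \<kappa>" "mu \<le> 2 * \<kappa>" "\<kappa> \<le> 2 * mu"
    using mu_diff_\<kappa> mean_large unfolding mu_def[symmetric] by linarith+
  show "\<kappa> \<le> m" using mult_left_mono[OF occ_prob_le_1[of k d], of "real m"] by (simp add: \<kappa>_def)
qed

text \<open>Source of the powers of \<open>r\<close>: each replacement of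
  \<open>sqrt \<kappa>\<close> by \<open>sig\<close> costs one factor \<open>r\<close>.\<close>

lemma sqrt_\<kappa>_le: "sqrt \<kappa> \<le> 2 * a * r * sig"
proof -
  have "threshold d \<le> real n" using k_large by simp
  then have "sqrt mu \<le> a * r * sig"
    using num_variance_ge[OF e, of n] m_large by (simp add: mu_def a_def r_def L_def sig_def)
  have "sqrt \<kappa> \<le> sqrt (4 * mu)" using \<kappa>_bounds by simp
  also have "\<dots> = 2 * sqrt mu" by (simp add: real_sqrt_mult)
  finally show ?thesis using \<open>sqrt mu \<le> a * r * sig\<close> by simp
qed

lemma \<kappa>_le: "\<kappa> \<le> 4 * a\<^sup>2 * L * sig\<^sup>2"
proof -
  have "(sqrt \<kappa>)\<^sup>2 \<le> (2 * a * r * sig)\<^sup>2" by (intro power_mono sqrt_\<kappa>_le) (use \<kappa>_bounds in simp)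
  then show ?thesis using \<kappa>_bounds by (simp add: power_mult_distrib r_power)
qed

text \<open>The opposite direction rests on the upper variance bound and costs no power of
  \<open>r\<close>.\<close>

lemma inverse_sqrt_\<kappa>_le: "1 / sqrt \<kappa> \<le> 2 * V / sig"
proof -
  have "sig\<^sup>2 = expect n (\<lambda>M. (T M - mu)\<^sup>2)"
    unfolding sig_def by (intro real_sqrt_pow2 expect_nonneg) simp
  also have "\<dots> \<le> var_const d * mu" unfolding mu_def by (rule num_variance_le)
  also have "\<dots> \<le> V * (2 * \<kappa>)"
    unfolding V_def using var_const_ge_1 \<kappa>_bounds mean_large
    by (intro mult_mono var_const_mono) (auto simp: mu_def intro: order_trans[OF zero_le_one])
  also have "\<dots> \<le> (2 * V)\<^sup>2 * \<kappa>"
  proof -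
    have "2 * V * 1 \<le> 2 * V * (2 * V)" using ge_1 by (intro mult_left_mono) auto
    then have "2 * V * \<kappa> \<le> (2 * V * (2 * V)) * \<kappa>" using \<kappa>_bounds by (intro mult_right_mono) auto
    then show ?thesis by (simp add: power2_eq_square mult_ac)
  qed
  also have "\<dots> = (2 * V * sqrt \<kappa>)\<^sup>2" using \<kappa>_bounds by (simp add: power_mult_distrib)
  finally have "sig \<le> 2 * V * sqrt \<kappa>"
    using ge_1 \<kappa>_bounds by (intro power2_le_imp_le[of sig]) auto
  then show ?thesis using \<kappa>_bounds sig_ge_1 by (simp add: field_simps)
qed

section \<open>Averaging the discrete Stein equation\<close>

definition \<tau> :: real where "\<tau> = 2 * V * a * r / sig"
text \<open>Bounds the mean of \<open>\<epsilon>\<close> at \<open>T\<close> and at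
  \<open>T - 1\<close>: 5 and 8 from its two terms, 2 more for the shift.\<close>

definition err :: real where "err = 15 * V * a * r / sig"
definition \<epsilon> :: "real \<Rightarrow> real" where "\<epsilon> x = 5 / sig + 2 / sig\<^sup>2 * \<bar>x - mu\<bar>"
definition \<psi> :: "real \<Rightarrow> real" where "\<psi> x = (x - mu) * st.f x"
definition D :: "real \<Rightarrow> real" where "D x = st.f (x + 1) - st.f x"
definition H :: "real \<Rightarrow> real" where "H x = st.h \<lfloor>x\<rfloor>"
definition Hmid :: "real \<Rightarrow> real" where "Hmid x = (H x + H (x + 1)) / 2"

lemma H_bounds: "0 \<le> H x" "H x \<le> 1"
  by (simp_all add: H_def st.h_def)

lemma T_int: "\<exists>i. T M = real_of_int i"
  unfolding num_eq_card by (rule exI[of _ "int (card {u. u < m \<and> M u = d})"]) simp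

lemma
  assumes "x = real_of_int i"
  shows abs_D_le: "\<bar>D x\<bar> \<le> 2 / sig\<^sup>2"
    and D_equation: "\<bar>sig\<^sup>2 * D x - (\<psi> x + Hmid x - st.\<beta>)\<bar> \<le> \<epsilon> x"
    and \<psi>_step: "\<bar>\<psi> (x + 1) - \<psi> x\<bar> \<le> \<epsilon> x"
  using st.f_step_le[of i] st.stein_equation[of i] st.mult_f_variation[of i "x + 1"] assms
  by (simp_all add: D_def \<psi>_def Hmid_def H_def \<epsilon>_def algebra_simps)

lemma expect_shift_le_\<tau>:
  assumes "\<And>x. \<bar>g x\<bar> \<le> 1"
  shows "\<bar>expect k (\<lambda>M. g (T M)) - expect k (\<lambda>M. g (T M - 1))\<bar> \<le> \<tau>"
proof -
  have "\<bar>expect k (\<lambda>M. g (T M)) - expect k (\<lambda>M. g (T M - 1))\<bar>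
     \<le> smooth_const d * sqrt (1 + real k / m) / sqrt (real m * occ_prob k d)"
    using \<kappa>_bounds by (intro expect_shift_le e k_large m_large assms) (simp add: \<kappa>_def)
  also have "\<dots> \<le> a * r * (1 / sqrt \<kappa>)"
    using ge_1 \<kappa>_bounds unfolding a_def[symmetric] \<kappa>_def[symmetric] r_def L_def
    by (auto intro!: divide_right_mono mult_left_mono)
  also have "\<dots> \<le> a * r * (2 * V / sig)"
    using ge_1 by (intro mult_left_mono inverse_sqrt_\<kappa>_le) auto
  finally show ?thesis by (simp add: \<tau>_def mult_ac)
qed


lemma expect_\<epsilon>_le: "expect k (\<lambda>M. \<epsilon> (T M)) \<le> err" "expect k (\<lambda>M. \<epsilon> (T M - 1)) \<le> err"
proof -
  have "expect k (\<lambda>M. \<bar>T M - \<kappa>\<bar>) \<le> sqrt (expect k (\<lambda>M. (T M - \<kappa>)\<^sup>2))"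
    by (rule expect_abs_le_sqrt)
  also have "\<dots> \<le> sqrt (V * \<kappa>)"
    using num_variance_le[of k d] var_const_mono[of d "Suc d"] \<kappa>_bounds
    by (intro real_sqrt_le_mono order_trans[OF num_variance_le[of k d, folded \<kappa>_def]])
      (auto simp: V_def intro!: mult_right_mono)
  also have "\<dots> \<le> V * sqrt \<kappa>"
    using sqrt_le_self[OF ge_1(1)] \<kappa>_bounds by (simp add: real_sqrt_mult mult_right_mono)
  finally have dev: "expect k (\<lambda>M. \<bar>T M - \<kappa>\<bar>) \<le> V * sqrt \<kappa>" .
  have "expect k (\<lambda>M. \<bar>T M - mu\<bar>) \<le> expect k (\<lambda>M. \<bar>T M - \<kappa>\<bar> + 1)"
    by (intro expect_mono) (use mu_diff_\<kappa> in linarith)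
  also have "\<dots> \<le> V * sqrt \<kappa> + 1" using dev by (simp add: expect_add)
  also have "\<dots> \<le> 2 * V * sqrt \<kappa>"
    using mult_mono[of 1 V 1 "sqrt \<kappa>"] ge_1 \<kappa>_bounds by simp
  also have "\<dots> \<le> 2 * V * (2 * a * r * sig)"
    using ge_1 by (intro mult_left_mono sqrt_\<kappa>_le) auto
  finally have "2 / sig\<^sup>2 * expect k (\<lambda>M. \<bar>T M - mu\<bar>) \<le> 2 / sig\<^sup>2 * (2 * V * (2 * a * r * sig))"
    by (intro mult_left_mono) auto
  also have "\<dots> = 8 * (V * a * r) / sig" using sig_ge_1 by (simp add: power2_eq_square)
  finally have main: "expect k (\<lambda>M. \<epsilon> (T M)) \<le> 5 / sig + 8 * (V * a * r) / sig"
    unfolding \<epsilon>_def expect_add expect_cmult expect_const by simp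
  have "1 * 1 * 1 \<le> V * a * r" using ge_1 by (intro mult_mono) auto
  then have Var: "1 \<le> V * a * r" by simp
  have "5 / sig + 8 * (V * a * r) / sig = (5 + 8 * (V * a * r)) / sig" by (simp add: add_divide_distrib)
  also have "\<dots> \<le> 13 * (V * a * r) / sig" using Var sig_ge_1 by (intro divide_right_mono) auto
  finally have 1: "expect k (\<lambda>M. \<epsilon> (T M)) \<le> 13 * (V * a * r) / sig" using main by simp
  also have "\<dots> \<le> err" using Var sig_ge_1 by (simp add: err_def divide_right_mono mult_ac)
  finally show "expect k (\<lambda>M. \<epsilon> (T M)) \<le> err" .
  have "\<epsilon> (T M - 1) \<le> \<epsilon> (T M) + 2 / sig\<^sup>2" for M
  proof -
    have "2 / sig\<^sup>2 * \<bar>T M - 1 - mu\<bar> \<le> 2 / sig\<^sup>2 * (\<bar>T M - mu\<bar> + 1)"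
      by (intro mult_left_mono) auto
    then show ?thesis by (simp add: \<epsilon>_def distrib_left)
  qed
  then have "expect k (\<lambda>M. \<epsilon> (T M - 1)) \<le> expect k (\<lambda>M. \<epsilon> (T M) + 2 / sig\<^sup>2)" by (rule expect_mono)
  also have "\<dots> = expect k (\<lambda>M. \<epsilon> (T M)) + 2 / sig\<^sup>2" by (simp add: expect_add)
  also have "2 / sig\<^sup>2 \<le> 2 * (V * a * r) / sig"
    using Var sig_ge_1 mult_mono[of 1 "V * a * r" 1 sig] by (intro frac_le) (auto simp: power2_eq_square)
  also have "expect k (\<lambda>M. \<epsilon> (T M)) + 2 * (V * a * r) / sig \<le> err"
  proof -
    have "err = (13 * (V * a * r) + 2 * (V * a * r)) / sig" by (simp add: err_def)
    also have "\<dots> = 13 * (V * a * r) / sig + 2 * (V * a * r) / sig" by (rule add_divide_distrib)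
    finally show ?thesis using 1 by linarith
  qed
  finally show "expect k (\<lambda>M. \<epsilon> (T M - 1)) \<le> err" by simp
qed

text \<open>The left side of the Stein identity has \<open>n\<close> balls, the averaged Stein
  equation only \<open>k\<close>. The last ball changes the count by at most one, and \<psi> then
  changes by at most \<open>\<epsilon>\<close>.\<close>

lemma \<psi>_change: "\<bar>expect n (\<lambda>M. \<psi> (T M)) - expect k (\<lambda>M. \<psi> (T M))\<bar> \<le> 2 * err"
proof -
  have eq: "expect n (\<lambda>M. \<psi> (T M)) - expect k (\<lambda>M. \<psi> (T M))
    = expect k (\<lambda>M. share e M * (\<psi> (T M + 1) - \<psi> (T M)) + share d M * (\<psi> (T M - 1) - \<psi> (T M)))"
    by (simp only: expect_num_Suc[of k \<psi> e] expect_add add_diff_cancel_left' add.assoc)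
  have "\<bar>expect n (\<lambda>M. \<psi> (T M)) - expect k (\<lambda>M. \<psi> (T M))\<bar>
    \<le> expect k (\<lambda>M. \<bar>share e M * (\<psi> (T M + 1) - \<psi> (T M)) + share d M * (\<psi> (T M - 1) - \<psi> (T M))\<bar>)"
    unfolding eq by (rule expect_abs)
  also have "\<dots> \<le> expect k (\<lambda>M. \<epsilon> (T M) + \<epsilon> (T M - 1))"
  proof (rule expect_mono)
    fix M
    obtain i where i: "T M = real_of_int i" using T_int by blast
    have "T M - 1 = real_of_int (i - 1)" by (simp add: i)
    from \<psi>_step[OF this] have "\<bar>\<psi> (T M - 1) - \<psi> (T M)\<bar> \<le> \<epsilon> (T M - 1)" by (simp add: abs_minus_commute)
    then have 2: "\<bar>share d M\<bar> * \<bar>\<psi> (T M - 1) - \<psi> (T M)\<bar> \<le> 1 * \<epsilon> (T M - 1)"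
      by (intro mult_mono) (simp_all add: share_nonneg share_le_1)
    have 1: "\<bar>share e M\<bar> * \<bar>\<psi> (T M + 1) - \<psi> (T M)\<bar> \<le> 1 * \<epsilon> (T M)"
      by (intro mult_mono \<psi>_step[OF i]) (simp_all add: share_nonneg share_le_1)
    from 1 2 have "\<bar>share e M * (\<psi> (T M + 1) - \<psi> (T M))\<bar> \<le> \<epsilon> (T M)"
      "\<bar>share d M * (\<psi> (T M - 1) - \<psi> (T M))\<bar> \<le> \<epsilon> (T M - 1)"
      by (simp_all only: abs_mult mult_1_left)
    then show "\<bar>share e M * (\<psi> (T M + 1) - \<psi> (T M)) + share d M * (\<psi> (T M - 1) - \<psi> (T M))\<bar>
      \<le> \<epsilon> (T M) + \<epsilon> (T M - 1)" by linarith
  qed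
  also have "\<dots> \<le> 2 * err" using expect_\<epsilon>_le by (simp add: expect_add)
  finally show ?thesis .
qed

lemma D_mean: "\<bar>sig\<^sup>2 * expect k (\<lambda>M. D (T M)) - (expect k (\<lambda>M. \<psi> (T M)) + expect k (\<lambda>M. Hmid (T M)) - st.\<beta>)\<bar> \<le> err"
  and D_pred_mean: "\<bar>sig\<^sup>2 * expect k (\<lambda>M. D (T M - 1))
    - (expect k (\<lambda>M. \<psi> (T M - 1)) + expect k (\<lambda>M. Hmid (T M - 1)) - st.\<beta>)\<bar> \<le> err"
proof -
  have *: "\<bar>sig\<^sup>2 * expect k (\<lambda>M. D (g M)) - (expect k (\<lambda>M. \<psi> (g M)) + expect k (\<lambda>M. Hmid (g M)) - st.\<beta>)\<bar>
    \<le> expect k (\<lambda>M. \<epsilon> (g M))" if "\<And>M. \<exists>i. g M = real_of_int i" for g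
  proof -
    have eq: "sig\<^sup>2 * expect k (\<lambda>M. D (g M)) - (expect k (\<lambda>M. \<psi> (g M)) + expect k (\<lambda>M. Hmid (g M)) - st.\<beta>)
      = expect k (\<lambda>M. sig\<^sup>2 * D (g M) - (\<psi> (g M) + Hmid (g M) - st.\<beta>))"
      by (simp add: expect_add expect_diff expect_cmult)
    have "\<bar>sig\<^sup>2 * expect k (\<lambda>M. D (g M)) - (expect k (\<lambda>M. \<psi> (g M)) + expect k (\<lambda>M. Hmid (g M)) - st.\<beta>)\<bar>
      \<le> expect k (\<lambda>M. \<bar>sig\<^sup>2 * D (g M) - (\<psi> (g M) + Hmid (g M) - st.\<beta>)\<bar>)"
      unfolding eq by (rule expect_abs)
    also have "\<dots> \<le> expect k (\<lambda>M. \<epsilon> (g M))"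
      using that D_equation by (intro expect_mono) blast
    finally show ?thesis .
  qed
  have "\<exists>i. T M - 1 = real_of_int i" for M
  proof -
    obtain i where "T M = real_of_int i" using T_int by blast
    then show ?thesis by (intro exI[of _ "i - 1"]) simp
  qed
  from *[of "\<lambda>M. T M - 1", OF this] expect_\<epsilon>_le show "\<bar>sig\<^sup>2 * expect k (\<lambda>M. D (T M - 1))
    - (expect k (\<lambda>M. \<psi> (T M - 1)) + expect k (\<lambda>M. Hmid (T M - 1)) - st.\<beta>)\<bar> \<le> err"
    by linarith
  show "\<bar>sig\<^sup>2 * expect k (\<lambda>M. D (T M)) - (expect k (\<lambda>M. \<psi> (T M)) + expect k (\<lambda>M. Hmid (T M)) - st.\<beta>)\<bar> \<le> err"
    using *[of T, OF T_int] expect_\<epsilon>_le by linarith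
qed

text \<open>The derivative of \<open>f\<close> jumps between cells, so the second difference is
  small only in mean. The Stein equation at \<open>T\<close> and at \<open>T - 1\<close> costs
  \<open>2 * err\<close>, the change of \<psi> another \<open>err\<close>, and the indicator part is
  a shift of a bounded function, hence at most \<tau>.\<close>

lemma D_difference: "sig\<^sup>2 * \<bar>expect k (\<lambda>M. D (T M)) - expect k (\<lambda>M. D (T M - 1))\<bar> \<le> 3 * err + \<tau>"
proof -
  have "\<bar>expect k (\<lambda>M. \<psi> (T M)) - expect k (\<lambda>M. \<psi> (T M - 1))\<bar> \<le> expect k (\<lambda>M. \<bar>\<psi> (T M) - \<psi> (T M - 1)\<bar>)"
    unfolding expect_diff[symmetric] by (rule expect_abs)
  also have "\<dots> \<le> expect k (\<lambda>M. \<epsilon> (T M - 1))"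
  proof (rule expect_mono)
    fix M
    obtain i where i: "T M = real_of_int i" using T_int by blast
    have "T M - 1 = real_of_int (i - 1)" by (simp add: i)
    from \<psi>_step[OF this] show "\<bar>\<psi> (T M) - \<psi> (T M - 1)\<bar> \<le> \<epsilon> (T M - 1)" by simp
  qed
  also have "\<dots> \<le> err" by (rule expect_\<epsilon>_le)
  finally have 1: "\<bar>expect k (\<lambda>M. \<psi> (T M)) - expect k (\<lambda>M. \<psi> (T M - 1))\<bar> \<le> err" .
  have "\<bar>Hmid x\<bar> \<le> 1" for x using H_bounds[of x] H_bounds[of "x + 1"] by (simp add: Hmid_def)
  then have 2: "\<bar>expect k (\<lambda>M. Hmid (T M)) - expect k (\<lambda>M. Hmid (T M - 1))\<bar> \<le> \<tau>"
    by (rule expect_shift_le_\<tau>)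
  have "\<bar>sig\<^sup>2 * expect k (\<lambda>M. D (T M)) - sig\<^sup>2 * expect k (\<lambda>M. D (T M - 1))\<bar> \<le> 3 * err + \<tau>"
    using 1 2 D_mean D_pred_mean by linarith
  then show ?thesis by (simp add: abs_mult flip: right_diff_distrib)
qed

section \<open>Replacing the random coefficients by their means\<close>

definition tilt :: "nat \<Rightarrow> (nat \<Rightarrow> nat) \<Rightarrow> real" where
  "tilt j M = real n * tilted_share n d j M"

text \<open>Cauchy-Schwarz: the coefficient has standard deviation of order
  \<open>sqrt (L ^ 3 * \<kappa>)\<close>, which is of order \<open>r ^ 4 * sig\<close>, while
  \<open>g\<close> is at most \<open>2 / sig\<^sup>2\<close>.\<close>

lemma tilt_covariance_le:
  assumes "real n * occ_prob k j \<le> 4 * real d * L * \<kappa>" "j \<le> d" "\<And>M. \<bar>g M\<bar> \<le> 2 / sig\<^sup>2"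
  shows "\<bar>expect k (\<lambda>M. (tilt j M - expect k (tilt j)) * g M)\<bar> \<le> 2048 * V * real d * a * r ^ 4 / sig"
proof -
  define s where "s = sqrt (expect k (\<lambda>M. (tilt j M - expect k (tilt j))\<^sup>2))"
  have "expect k (\<lambda>M. (tilt j M - expect k (tilt j))\<^sup>2)
     = (real n)\<^sup>2 * expect k (\<lambda>M. (tilted_share n d j M - expect k (tilted_share n d j))\<^sup>2)"
    unfolding tilt_def[abs_def] expect_cmult
    by (simp only: right_diff_distrib[symmetric] power_mult_distrib expect_cmult)
  also have "\<dots> \<le> (real n)\<^sup>2 * (128 * V * (1 + real k / m) * (occ_prob k j / m))"
    unfolding V_def using assms(2) by (intro mult_left_mono tilted_share_variance_le) auto
  also have "\<dots> = 128 * V * (1 + real k / m) * ((real n / m) * (real n * occ_prob k j))"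
    by (simp add: power2_eq_square)
  also have "\<dots> \<le> 128 * V * L * (L * (4 * real d * L * \<kappa>))"
    using ge_1 by (intro mult_mono assms(1)) (auto simp: L_def divide_right_mono occ_prob_nonneg)
  also have "\<dots> = (512 * V * real d) * (L ^ 3 * \<kappa>)" by (simp add: power3_eq_cube)
  \<comment> \<open>The factor is at least 1; squaring it lets it leave the square root
    unchanged.\<close>
  also have "\<dots> \<le> (512 * V * real d)\<^sup>2 * (L ^ 3 * \<kappa>)"
  proof (rule mult_right_mono)
    have "1 * 1 * 1 \<le> 512 * V * real d" using ge_1 by (intro mult_mono) auto
    then show "512 * V * real d \<le> (512 * V * real d)\<^sup>2"
      using mult_left_mono[of 1 "512 * V * real d" "512 * V * real d"] by (simp add: power2_eq_square)
  qed (use ge_1 \<kappa>_bounds in auto)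
  finally have "s \<le> sqrt ((512 * V * real d)\<^sup>2 * (L ^ 3 * \<kappa>))"
    unfolding s_def by (rule real_sqrt_le_mono)
  also have "\<dots> = 512 * V * real d * (sqrt (L ^ 3) * sqrt \<kappa>)"
    using ge_1 by (simp add: real_sqrt_mult)
  also have "sqrt (L ^ 3) = r ^ 3" by (simp add: r_def real_sqrt_power)
  also have "512 * V * real d * (r ^ 3 * sqrt \<kappa>) \<le> 512 * V * real d * (r ^ 3 * (2 * a * r * sig))"
    using ge_1 by (intro mult_left_mono sqrt_\<kappa>_le) auto
  also have "\<dots> = 1024 * V * real d * a * r ^ 4 * sig"
    by (simp add: power3_eq_cube power4_eq_xxxx)
  finally have s: "s \<le> 1024 * V * real d * a * r ^ 4 * sig" .
  have g: "sqrt (expect k (\<lambda>M. (g M)\<^sup>2)) \<le> 2 / sig\<^sup>2"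
  proof (rule real_le_lsqrt)
    have "expect k (\<lambda>M. (g M)\<^sup>2) \<le> expect k (\<lambda>_. (2 / sig\<^sup>2)\<^sup>2)"
      using assms(3) by (intro expect_mono) (auto simp: abs_le_square_iff[symmetric])
    then show "expect k (\<lambda>M. (g M)\<^sup>2) \<le> (2 / sig\<^sup>2)\<^sup>2" by simp
  qed (auto intro: expect_nonneg)
  have "\<bar>expect k (\<lambda>M. (tilt j M - expect k (tilt j)) * g M)\<bar> \<le> s * sqrt (expect k (\<lambda>M. (g M)\<^sup>2))"
    unfolding s_def by (rule expect_Cauchy_Schwarz)
  also have "\<dots> \<le> (1024 * V * real d * a * r ^ 4 * sig) * (2 / sig\<^sup>2)"
    using ge_1 sig_ge_1 by (intro mult_mono s g) (auto intro!: expect_nonneg mult_nonneg_nonneg)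
  also have "\<dots> = 2048 * V * real d * a * r ^ 4 / sig" using sig_ge_1 by (simp add: power2_eq_square)
  finally show ?thesis .
qed


text \<open>With the identity function in \<open>stein_identity\<close> the increments are 1 and the
  left side is the variance, so the difference of the means is exact. The single mean is bounded
  crudely through the share.\<close>

lemma tilt_means:
  shows tilt_mean_diff: "expect k (tilt e) - expect k (tilt d) = sig\<^sup>2"
    and tilt_mean_le: "\<bar>expect k (tilt d)\<bar> \<le> 16 * a\<^sup>2 * r ^ 4 * sig\<^sup>2"
proof -
  have "expect n (\<lambda>M. T M - mu) = 0"
    using expect_num[of n d] by (simp add: expect_diff mu_def)
  then have "expect n (\<lambda>M. (T M - mu) * T M) = expect n (\<lambda>M. (T M - mu) * T M - mu * (T M - mu))"
    by (simp add: expect_diff expect_cmult)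
  also have "\<dots> = expect n (\<lambda>M. (T M - mu)\<^sup>2)"
    by (intro expect_cong) (simp add: power2_eq_square algebra_simps)
  also have "\<dots> = sig\<^sup>2"
    unfolding sig_def by (intro real_sqrt_pow2[symmetric] expect_nonneg) simp
  finally have "sig\<^sup>2 = real n * expect k (\<lambda>M. tilted_share n d e M * 1) - real n * expect k (\<lambda>M. tilted_share n d d M * 1)"
    using stein_identity[of k e "\<lambda>x. x"] by (simp add: mu_def)
  then show "expect k (tilt e) - expect k (tilt d) = sig\<^sup>2"
    unfolding tilt_def[abs_def] expect_cmult by simp
  have "\<bar>expect k (tilt d)\<bar> = real n * \<bar>expect k (tilted_share n d d)\<bar>"
    unfolding tilt_def[abs_def] expect_cmult abs_mult by simp
  also have "\<dots> \<le> real n * (4 * occ_prob k d)"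
    by (intro mult_left_mono abs_expect_tilted_share_le) simp
  also have "\<dots> = 4 * ((real n / m) * \<kappa>)" by (simp add: \<kappa>_def)
  also have "\<dots> \<le> 4 * (L * (4 * a\<^sup>2 * L * sig\<^sup>2))"
    using \<kappa>_bounds by (intro mult_left_mono mult_mono \<kappa>_le) (auto simp: L_def)
  also have "\<dots> = 16 * a\<^sup>2 * r ^ 4 * sig\<^sup>2" by (simp add: r_power power2_eq_square)
  finally show "\<bar>expect k (tilt d)\<bar> \<le> 16 * a\<^sup>2 * r ^ 4 * sig\<^sup>2" .
qed

definition cov_err :: real where "cov_err = 2048 * V * real d * a * r ^ 4 / sig"

lemma n_occ_prob_le: "real n * occ_prob k e \<le> 4 * real d * L * \<kappa>" "real n * occ_prob k d \<le> 4 * real d * L * \<kappa>"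
proof -
  have nk: "real n \<le> 2 * real k" using k_ge by simp
  have "real n * occ_prob k e \<le> 2 * (real k * occ_prob k e)"
    using mult_right_mono[OF nk occ_prob_nonneg] by (simp add: mult_ac)
  also have "\<dots> \<le> 2 * (2 * real d * \<kappa>)"
    unfolding \<kappa>_def using k_ge by (intro mult_left_mono occ_prob_pred_le) auto
  also have "\<dots> = 4 * real d * 1 * \<kappa>" by simp
  also have "\<dots> \<le> 4 * real d * L * \<kappa>"
    using ge_1 \<kappa>_bounds by (intro mult_right_mono mult_left_mono) auto
  finally show "real n * occ_prob k e \<le> 4 * real d * L * \<kappa>" .
  have "real n * occ_prob k d = 1 * (real n / m) * \<kappa>" by (simp add: \<kappa>_def)
  also have "\<dots> \<le> (4 * real d) * L * \<kappa>"
    using \<kappa>_bounds by (intro mult_right_mono mult_mono) (auto simp: L_def)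
  finally show "real n * occ_prob k d \<le> 4 * real d * L * \<kappa>" .
qed

text \<open>With means \<open>p\<close> and \<open>q\<close>, where \<open>p - q\<close> is the
  variance, the main terms are \<open>sig\<^sup>2 * expect k (\<lambda>M. D (T M)) + q * z\<close>.
  As \<open>q\<close> need not be small against the variance, \<open>z\<close> has to be controlled
  by \<open>D_difference\<close>.\<close>

lemma \<psi>_mean:
  "\<bar>expect n (\<lambda>M. \<psi> (T M)) - sig\<^sup>2 * expect k (\<lambda>M. D (T M))\<bar>
    \<le> 2 * cov_err + 16 * a\<^sup>2 * r ^ 4 * (3 * err + \<tau>)"
proof -
  define p q where "p = expect k (tilt e)" and "q = expect k (tilt d)"
  define x where "x = expect k (\<lambda>M. (tilt e M - p) * D (T M))"
  define y where "y = expect k (\<lambda>M. (tilt d M - q) * D (T M - 1))"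
  define z where "z = expect k (\<lambda>M. D (T M)) - expect k (\<lambda>M. D (T M - 1))"
  have "expect n (\<lambda>M. \<psi> (T M)) = real n * expect k (\<lambda>M. tilted_share n d e M * D (T M))
     - real n * expect k (\<lambda>M. tilted_share n d d M * D (T M - 1))"
    using stein_identity[of k e st.f] by (simp add: mu_def \<psi>_def D_def)
  also have "\<dots> = expect k (\<lambda>M. tilt e M * D (T M)) - expect k (\<lambda>M. tilt d M * D (T M - 1))"
    by (simp add: tilt_def mult.assoc expect_cmult)
  also have "\<dots> = (x + p * expect k (\<lambda>M. D (T M))) - (y + q * expect k (\<lambda>M. D (T M - 1)))"
    unfolding x_def y_def by (simp only: left_diff_distrib expect_diff expect_cmult)
  also have "\<dots> = sig\<^sup>2 * expect k (\<lambda>M. D (T M)) + (x - y + q * z)"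
    using tilt_mean_diff by (simp add: p_def q_def z_def algebra_simps flip: tilt_mean_diff)
  finally have eq: "expect n (\<lambda>M. \<psi> (T M)) - sig\<^sup>2 * expect k (\<lambda>M. D (T M)) = x - y + q * z"
    by simp
  have x: "\<bar>x\<bar> \<le> cov_err"
    unfolding x_def p_def cov_err_def
  proof (rule tilt_covariance_le)
    show "\<bar>D (T M)\<bar> \<le> 2 / sig\<^sup>2" for M using T_int abs_D_le by blast
  qed (use n_occ_prob_le in auto)
  have y: "\<bar>y\<bar> \<le> cov_err"
    unfolding y_def q_def cov_err_def
  proof (rule tilt_covariance_le)
    fix M
    obtain i where "T M = real_of_int i" using T_int by blast
    then show "\<bar>D (T M - 1)\<bar> \<le> 2 / sig\<^sup>2" by (intro abs_D_le[of _ "i - 1"]) simp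
  qed (use n_occ_prob_le in auto)
  have "\<bar>q * z\<bar> \<le> (16 * a\<^sup>2 * r ^ 4 * sig\<^sup>2) * \<bar>z\<bar>"
    unfolding abs_mult q_def by (intro mult_right_mono tilt_mean_le) simp
  also have "\<dots> = 16 * a\<^sup>2 * r ^ 4 * (sig\<^sup>2 * \<bar>z\<bar>)" by simp
  also have "\<dots> \<le> 16 * a\<^sup>2 * r ^ 4 * (3 * err + \<tau>)"
    unfolding z_def using ge_1 by (intro mult_left_mono D_difference) auto
  finally show ?thesis using x y eq by linarith
qed

text \<open>Separate the share into its mean and a fluctuation of order at most
  \<open>1 / sqrt \<kappa>\<close>, using \<open>\<kappa> \<le> m\<close>; the mean multiplies a
  quantity that is already small.\<close>

lemma share_weighted_shift_le:
  assumes "\<And>x. \<bar>g x\<bar> \<le> 1" "\<bar>expect k (\<lambda>M. g (T M))\<bar> \<le> \<tau>" "j \<le> d"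
  shows "\<bar>expect k (\<lambda>M. share j M * g (T M))\<bar> \<le> \<tau> + 2 * V\<^sup>2 / sig"
proof -
  define p where "p = occ_prob k j"
  have p: "0 \<le> p" "p \<le> 1" by (simp_all add: p_def occ_prob_nonneg occ_prob_le_1)
  have "expect k (\<lambda>M. (share j M - p)\<^sup>2) \<le> V * p / m"
    unfolding p_def V_def using assms(3) by (intro share_variance_le') simp
  also have "\<dots> \<le> V * 1 / \<kappa>"
    using p ge_1 \<kappa>_bounds by (intro frac_le mult_left_mono) auto
  finally have "sqrt (expect k (\<lambda>M. (share j M - p)\<^sup>2)) \<le> sqrt (V * 1 / \<kappa>)" by (rule real_sqrt_le_mono)
  also have "\<dots> = sqrt V * (1 / sqrt \<kappa>)" by (simp add: real_sqrt_divide)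
  also have "\<dots> \<le> V * (2 * V / sig)"
    using ge_1 \<kappa>_bounds by (intro mult_mono sqrt_le_self inverse_sqrt_\<kappa>_le) auto
  finally have s: "sqrt (expect k (\<lambda>M. (share j M - p)\<^sup>2)) \<le> 2 * V\<^sup>2 / sig"
    by (simp add: power2_eq_square mult_ac)
  have "expect k (\<lambda>M. (g (T M))\<^sup>2) \<le> expect k (\<lambda>_. 1)"
    by (intro expect_mono) (use assms(1) in \<open>simp add: abs_square_le_1\<close>)
  then have g: "sqrt (expect k (\<lambda>M. (g (T M))\<^sup>2)) \<le> 1" by simp
  have "expect k (\<lambda>M. share j M * g (T M)) = expect k (\<lambda>M. (share j M - p) * g (T M)) + p * expect k (\<lambda>M. g (T M))"
    by (simp add: left_diff_distrib expect_diff expect_cmult)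
  moreover have "\<bar>expect k (\<lambda>M. (share j M - p) * g (T M))\<bar>
      \<le> sqrt (expect k (\<lambda>M. (share j M - p)\<^sup>2)) * sqrt (expect k (\<lambda>M. (g (T M))\<^sup>2))"
    by (rule expect_Cauchy_Schwarz)
  moreover have "\<dots> \<le> sqrt (expect k (\<lambda>M. (share j M - p)\<^sup>2)) * 1"
    by (intro mult_left_mono g real_sqrt_ge_zero expect_nonneg) simp
  moreover have "\<bar>p * expect k (\<lambda>M. g (T M))\<bar> \<le> 1 * \<tau>"
    unfolding abs_mult using p assms(2) by (intro mult_mono) auto
  ultimately show ?thesis using s by linarith
qed

text \<open>Both the last ball and the passage to midpoints shift the argument of \<open>H\<close>
  by one, and such shifts are negligible in mean by smoothness.\<close>

lemma H_change: "\<bar>expect n (\<lambda>M. H (T M)) - expect k (\<lambda>M. Hmid (T M))\<bar> \<le> 3 * \<tau> + 4 * V\<^sup>2 / sig"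
proof -
  define g1 where "g1 x = H (x + 1) - H x" for x
  define g2 where "g2 x = H (x - 1) - H x" for x
  have g: "\<bar>g1 x\<bar> \<le> 1" "\<bar>g2 x\<bar> \<le> 1" for x
    using H_bounds[of x] H_bounds[of "x + 1"] H_bounds[of "x - 1"] by (simp_all add: g1_def g2_def abs_le_iff)
  have H1: "\<bar>H x\<bar> \<le> 1" for x using H_bounds[of x] by simp
  have 1: "\<bar>expect k (\<lambda>M. g1 (T M))\<bar> \<le> \<tau>"
    using expect_shift_le_\<tau>[of "\<lambda>x. H (x + 1)"] H1 by (simp add: g1_def expect_diff)
  have 2: "\<bar>expect k (\<lambda>M. g2 (T M))\<bar> \<le> \<tau>"
    using expect_shift_le_\<tau>[of H, OF H1] by (simp add: g2_def expect_diff abs_minus_commute)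
  have "expect n (\<lambda>M. H (T M)) = expect k (\<lambda>M. H (T M)) + expect k (\<lambda>M. share e M * g1 (T M))
      + expect k (\<lambda>M. share d M * g2 (T M))"
    unfolding g1_def g2_def by (simp only: expect_num_Suc[of k H e] expect_add)
  moreover have "expect k (\<lambda>M. Hmid (T M)) = expect k (\<lambda>M. H (T M) + (1 / 2) * g1 (T M))"
    by (intro expect_cong) (simp add: Hmid_def g1_def field_simps)
  then have "expect k (\<lambda>M. Hmid (T M)) = expect k (\<lambda>M. H (T M)) + (1 / 2) * expect k (\<lambda>M. g1 (T M))"
    unfolding expect_add expect_cmult .
  moreover have "\<bar>expect k (\<lambda>M. share e M * g1 (T M))\<bar> \<le> \<tau> + 2 * V\<^sup>2 / sig"
    by (rule share_weighted_shift_le[OF g(1) 1]) simp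
  moreover have "\<bar>expect k (\<lambda>M. share d M * g2 (T M))\<bar> \<le> \<tau> + 2 * V\<^sup>2 / sig"
    by (rule share_weighted_shift_le[OF g(2) 2]) simp
  moreover have "2 * V\<^sup>2 / sig + 2 * V\<^sup>2 / sig = 4 * V\<^sup>2 / sig" by (simp add: add_divide_distrib[symmetric])
  ultimately show ?thesis using 1 by linarith
qed

text \<open>The averaged Stein equation turns the mean of \<open>Hmid\<close> minus \<beta> into
  \<open>sig\<^sup>2\<close> times the mean of \<open>D\<close> minus the mean of \<psi>, and
  \<open>\<psi>_mean\<close> with \<open>\<psi>_change\<close> shows that this is small. All errors
  are measured by \<open>Z\<close>, which carries the largest power of each constant. The highest
  power of \<open>r\<close> that occurs is 5, and the errors add up to
  \<open>4903 * Z\<close>.\<close>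

lemma approximation:
  "\<bar>expect n (\<lambda>M. H (T M)) - st.\<beta>\<bar> \<le> 5000 * V\<^sup>2 * real d * a ^ 3 * L ^ 3 / sig"
proof -
  define Z where "Z = V\<^sup>2 * real d * a ^ 3 * L ^ 3 / sig"
  have bnd: "c * x / sig \<le> c * Z" if "x \<le> V\<^sup>2 * real d * a ^ 3 * r ^ 6" "0 \<le> c" for x c
  proof -
    have "c * x \<le> c * (V\<^sup>2 * real d * a ^ 3 * r ^ 6)" using that by (intro mult_left_mono)
    then have "c * x / sig \<le> c * (V\<^sup>2 * real d * a ^ 3 * r ^ 6) / sig"
      using sig_ge_1 by (intro divide_right_mono) auto
    then show ?thesis by (simp add: Z_def r_power mult_ac)
  qed
  have mono: "V ^ i1 * real d ^ i2 * a ^ i3 * r ^ i4 \<le> V\<^sup>2 * real d ^ 1 * a ^ 3 * r ^ 6"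
    if "i1 \<le> 2" "i2 \<le> 1" "i3 \<le> 3" "i4 \<le> 6" for i1 i2 i3 i4
    using ge_1 that by (intro mult_mono power_increasing) auto
  have "err \<le> 15 * Z"
    using bnd[of "V * a * r" 15] mono[of 1 0 1 1] by (simp add: err_def mult_ac)
  moreover have "\<tau> \<le> 2 * Z"
    using bnd[of "V * a * r" 2] mono[of 1 0 1 1] by (simp add: \<tau>_def mult_ac)
  moreover have "cov_err \<le> 2048 * Z"
    using bnd[of "V * real d * a * r ^ 4" 2048] mono[of 1 1 1 4]
    by (simp add: cov_err_def mult_ac del: of_nat_Suc)
  moreover have "4 * V\<^sup>2 / sig \<le> 4 * Z"
    using bnd[of "V\<^sup>2" 4] mono[of 2 0 0 0] by (simp add: mult_ac)
  moreover have "16 * a\<^sup>2 * r ^ 4 * (3 * err + \<tau>) \<le> 752 * Z"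
  proof -
    have "3 * err + \<tau> = 47 * (V * a * r) / sig"
      by (simp add: err_def \<tau>_def add_divide_distrib[symmetric])
    then have "16 * a\<^sup>2 * r ^ 4 * (3 * err + \<tau>) = 752 * (V * a ^ 3 * r ^ 5) / sig"
      by (simp add: power2_eq_square power3_eq_cube eval_nat_numeral)
    then show ?thesis
      using bnd[of "V * a ^ 3 * r ^ 5" 752] mono[of 1 0 3 5] by (simp add: mult_ac)
  qed
  moreover have "0 \<le> Z" using ge_1 sig_ge_1 by (simp add: Z_def)
  ultimately have "\<bar>expect n (\<lambda>M. H (T M)) - st.\<beta>\<bar> \<le> 5000 * Z"
    using H_change \<psi>_mean \<psi>_change D_mean by linarith
  then show ?thesis by (simp add: Z_def mult_ac)
qed

end

context urns
begin

subsection \<open>Return to the probability mass functions\<close>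

lemma expectation_urns_with_exactly:
  "measure_pmf.expectation (allocation_pmf n m) (\<lambda>\<omega>. F (real (urns_with_exactly d n m \<omega>)))
    = expect n (\<lambda>M. F (num d M))"
  using expectation_allocation[of n "\<lambda>M. F (num d M)"]
  by (simp add: num_eq_card urns_with_exactly_def)

lemma mean_formula:
  "real m * occ_prob n d = real m * real (n choose d) * (1 / real m ^ d) * (1 - 1 / real m) ^ (n - d)"
  by (simp add: occ_prob_def power_one_over)

lemma occ_prob2_multinomial:
  "occ_prob2 n d d = multinomial_dd n d * (1 / real m ^ (2 * d)) * (1 - 2 / real m) ^ (n - 2 * d)"
proof (cases "2 * d \<le> n")
  case True
  then have "real (n choose d) * real (n - d choose d) = multinomial_dd n d"
    by (simp add: multinomial_dd_def binomial_fact diff_diff_left mult_2)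
  then show ?thesis by (simp add: occ_prob2_def power_one_over mult_2)
qed (simp add: occ_prob2_def multinomial_dd_def binomial_eq_0)

lemma variance_formula:
  assumes "\<mu> = real m * occ_prob n d"
  shows "expect n (\<lambda>M. (num d M - \<mu>)\<^sup>2) = \<mu> - \<mu>\<^sup>2 + real m * (real m - 1) * multinomial_dd n d
    * (1 / real m ^ (2 * d)) * (1 - 2 / real m) ^ (n - 2 * d)"
proof -
  have "expect n (\<lambda>M. (num d M - \<mu>)\<^sup>2) = expect n (\<lambda>M. (real m)\<^sup>2 * (share d M - occ_prob n d)\<^sup>2)"
    by (intro expect_cong) (simp add: num_def assms power2_eq_square algebra_simps)
  also have "\<dots> = (real m)\<^sup>2 * (occ_prob n d / m + (1 - 1 / m) * occ_prob2 n d d - (occ_prob n d)\<^sup>2)"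
    by (simp only: expect_cmult expect_share_variance)
  also have "\<dots> = \<mu> - \<mu>\<^sup>2 + real m * (real m - 1) * occ_prob2 n d d"
    by (simp add: assms power2_eq_square field_simps)
  finally show ?thesis by (simp add: occ_prob2_multinomial mult_ac)
qed

text \<open>Every configuration supported on the \<open>m\<close> urns is reached with positive
  probability: remove a ball from a nonempty urn and induct. Vanishing outside the urns is required
  because the recursion starts from the zero function.\<close>

lemma expect_pos:
  assumes "(\<Sum>u<m. M u) = n" "\<And>u. m \<le> u \<Longrightarrow> M u = 0" "\<And>M. 0 \<le> F M" "0 < F M"
  shows "0 < expect n F"
  using assms
proof (induction n arbitrary: F M)
  case 0
  then have "M = (\<lambda>_. 0)" by (auto simp: fun_eq_iff not_less[symmetric])
  with 0 show ?case by simp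
next
  case (Suc n)
  have "\<exists>v<m. M v \<noteq> 0"
  proof (rule ccontr)
    assume "\<not> ?thesis"
    then have "(\<Sum>u<m. M u) = 0" by simp
    with Suc.prems(1) show False by simp
  qed
  then obtain v where v: "v < m" "M v \<noteq> 0" by blast
  define M' where "M' = M(v := M v - 1)"
  have M: "M = add_ball M' v" using v by (auto simp: M'_def add_ball_def)
  show ?case unfolding expect.simps
  proof (rule Suc.IH)
    show "(\<Sum>u<m. M' u) = n" using Suc.prems(1) sum_add_ball[OF v(1), of M'] M by simp
    show "M' u = 0" if "m \<le> u" for u using Suc.prems(2)[OF that] v that by (simp add: M'_def)
    show "0 \<le> avg (\<lambda>v. F (add_ball M v))" for M
      using avg_mono[of "\<lambda>_. 0" "\<lambda>v. F (add_ball M v)"] Suc.prems(3) by simp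
    have "F M \<le> (\<Sum>w<m. F (add_ball M' w))"
      using v Suc.prems(3) unfolding M by (intro member_le_sum[where i = v]) auto
    with Suc.prems(4) show "0 < avg (\<lambda>v. F (add_ball M' v))" by (simp add: avg_def)
  qed
qed

text \<open>Two reachable configurations with different counts suffice, since no constant \<mu> can
  equal both.\<close>

lemma num_variance_pos:
  assumes "2 \<le> d" "d \<le> n"
  shows "0 < expect n (\<lambda>M. (num d M - \<mu>)\<^sup>2)"
proof -
  \<comment> \<open>The balls go either all into urn 0, or \<open>c\<close> into urn 0 and the rest
    into urn 1. If \<open>n = d\<close>, only the first has an urn with \<open>d\<close> balls, as
    \<open>1\<close> and \<open>d - 1\<close> differ from \<open>d\<close> by
    \<open>2 \<le> d\<close>; otherwise only the second.\<close>
  define c where "c = (if n = d then 1 else d)"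
  define M1 where "M1 = (\<lambda>u::nat. if u = 0 then n else 0)"
  define M2 where "M2 = (\<lambda>u::nat. if u = 0 then c else if u = 1 then n - c else 0)"
  have "c \<le> n" using assms by (simp add: c_def)
  have split: "{..<m} = insert 0 (insert 1 {2..<m})" using m_ge_2 by auto
  have sums: "(\<Sum>u<m. M1 u) = n" "(\<Sum>u<m. M2 u) = n"
    using \<open>c \<le> n\<close> unfolding split by (simp_all add: M1_def M2_def)
  have zero: "m \<le> u \<Longrightarrow> M1 u = 0" "m \<le> u \<Longrightarrow> M2 u = 0" for u
    using m_ge_2 by (auto simp: M1_def M2_def)
  have num_0: "num d M = 0" if "\<And>u. M u \<noteq> d" for M using that by (simp add: num_eq_card)
  have num_pos: "num d M \<noteq> 0" if "M 0 = d" for M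
    unfolding num_eq_card using that by (auto simp: card_eq_0_iff intro: exI[of _ 0])
  have "num d M1 \<noteq> num d M2"
  proof (cases "n = d")
    case True
    have "num d M2 = 0" using True assms by (intro num_0) (auto simp: M2_def c_def)
    moreover have "num d M1 \<noteq> 0" using True by (intro num_pos) (simp add: M1_def)
    ultimately show ?thesis by simp
  next
    case False
    have "num d M1 = 0" using False assms by (intro num_0) (auto simp: M1_def)
    moreover have "num d M2 \<noteq> 0" using False by (intro num_pos) (simp add: M2_def c_def)
    ultimately show ?thesis by simp
  qed
  then consider "num d M1 \<noteq> \<mu>" | "num d M2 \<noteq> \<mu>" by (cases "num d M1 = \<mu>") auto
  then show ?thesis
  proof cases
    case 1
    show ?thesis by (rule expect_pos[of M1]) (use sums zero 1 in auto)
  next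
    case 2
    show ?thesis by (rule expect_pos[of M2]) (use sums zero 2 in auto)
  qed
qed

end

lemma prob_discretized_normal:
  assumes "0 < v"
  shows "measure_pmf.prob (discretized_normal \<mu> v) A
    = measure (density lborel (normal_density \<mu> (sqrt v))) {x. \<lfloor>x + 1 / 2\<rfloor> \<in> A}"
proof -
  define N where "N = density lborel (normal_density \<mu> (sqrt v))"
  define X where "X = (\<lambda>z::int. {real_of_int z - 1/2 ..< real_of_int z + 1/2})"
  interpret N: prob_space N
    unfolding N_def using assms by (intro prob_space_normal_density) simp
  have X: "x \<in> X z \<longleftrightarrow> \<lfloor>x + 1 / 2\<rfloor> = z" for x z
    unfolding floor_eq_iff by (auto simp: X_def)
  have pmf: "pmf (discretized_normal \<mu> v) z = measure N (X z)" for z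
    unfolding N_def X_def by (rule pmf_discretized_normal[OF assms])
  have "emeasure (measure_pmf (discretized_normal \<mu> v)) A
     = (\<integral>\<^sup>+z. ennreal (pmf (discretized_normal \<mu> v) z) \<partial>count_space A)"
    by (simp add: nn_integral_pmf)
  also have "\<dots> = (\<integral>\<^sup>+z. emeasure N (X z) \<partial>count_space A)"
    by (simp add: pmf N.emeasure_eq_measure)
  also have "\<dots> = emeasure N (\<Union>z\<in>A. X z)"
  proof (rule emeasure_UN_countable[symmetric])
    show "X z \<in> sets N" for z by (simp add: X_def N_def)
    show "disjoint_family_on X A" by (auto simp: disjoint_family_on_def X)
  qed simp
  also have "(\<Union>z\<in>A. X z) = {x. \<lfloor>x + 1 / 2\<rfloor> \<in> A}" by (auto simp: X)
  finally show ?thesis by (simp add: measure_def N_def)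
qed

section \<open>The constant, the degenerate regime and the total variation distance\<close>

lemma cube_one_plus_le: "0 \<le> x \<Longrightarrow> (1 + x) ^ 3 \<le> 4 * (1 + x ^ 3)" for x :: real
proof -
  assume "0 \<le> x"
  then have "0 \<le> 3 * ((1 - x)\<^sup>2 * (1 + x))" by simp
  also have "\<dots> = 4 * (1 + x ^ 3) - (1 + x) ^ 3"
    by (simp add: power2_eq_square power3_eq_cube algebra_simps)
  finally show ?thesis by simp
qed

text \<open>The first summand is the constant of \<open>approximation\<close> times 4 from
  \<open>cube_one_plus_le\<close>. The second exceeds \<sigma> outside that regime and makes the
  claimed bound at least 1 there.\<close>

definition tv_const :: "nat \<Rightarrow> real" where
  "tv_const d = 20000 * (var_const (Suc d))\<^sup>2 * real d * smooth_const d ^ 3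
    + var_const (Suc d) * (threshold d + 2)"

lemma (in urns) normal_approximation:
  fixes A :: "int set" and d n :: nat
  defines "\<mu> \<equiv> real m * occ_prob n d"
  defines "\<sigma> \<equiv> sqrt (expect n (\<lambda>M. (num d M - \<mu>)\<^sup>2))"
  assumes d: "2 \<le> d" "d \<le> n"
  shows "\<bar>expect n (\<lambda>M. of_bool (\<lfloor>num d M\<rfloor> \<in> A))
      - measure (density lborel (normal_density \<mu> \<sigma>)) {x. \<lfloor>x + 1 / 2\<rfloor> \<in> A}\<bar>
    \<le> tv_const d * (1 + (real n / m) ^ 3) / \<sigma>"
    (is "\<bar>?p - ?q\<bar> \<le> _")
proof -
  define v where "v = expect n (\<lambda>M. (num d M - \<mu>)\<^sup>2)"
  define C where "C = var_const (Suc d)"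
  define c1 where "c1 = 20000 * C\<^sup>2 * real d * smooth_const d ^ 3"
  define c2 where "c2 = C * (threshold d + 2)"
  have C: "1 \<le> C" by (simp add: C_def var_const_ge_1)
  have thr: "0 \<le> threshold d" using threshold_ge[of d] by linarith
  have c1: "0 \<le> c1" using smooth_const_ge_1[of d] by (simp add: c1_def)
  have "1 * 1 \<le> c2" unfolding c2_def using C thr by (intro mult_mono) auto
  then have c2: "1 \<le> c2" by simp
  have v_pos: "0 < v" unfolding v_def by (rule num_variance_pos[OF d])
  then have \<sigma>: "0 < \<sigma>" by (simp add: \<sigma>_def v_def)
  have cube: "0 \<le> (real n / m) ^ 3" by simp
  have const: "tv_const d = c1 + c2" by (simp add: tv_const_def c1_def c2_def C_def)
  obtain k where n_eq: "n = Suc k" using d by (cases n) auto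
  obtain e where d_eq: "d = Suc e" "1 \<le> e" using d by (cases d) auto
  show ?thesis
  proof (cases "threshold d \<le> real k \<and> threshold d \<le> real m \<and> 2 \<le> \<mu> \<and> 1 \<le> v")
    case True
    interpret urns_approximation m e k A
      by unfold_locales (use True d_eq n_eq in \<open>auto simp: \<mu>_def v_def\<close>)
    have eqs: "sig = \<sigma>" "mu = \<mu>" by (simp_all add: sig_def mu_def \<sigma>_def \<mu>_def d_eq n_eq)
    have "\<bar>?p - ?q\<bar> \<le> 5000 * C\<^sup>2 * real d * smooth_const d ^ 3 * (1 + real n / m) ^ 3 / \<sigma>"
    proof -
      have "?q = st.\<beta>" unfolding st.\<beta>_def st.N_def st.B_def by (simp only: eqs)
      moreover have "?p = expect (Suc k) (\<lambda>M. H (num (Suc e) M))"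
        by (simp only: H_def st.h_def d_eq n_eq)
      ultimately show ?thesis
        using approximation by (simp only: eqs C_def V_def a_def L_def d_eq n_eq)
    qed
    also have "\<dots> \<le> 5000 * C\<^sup>2 * real d * smooth_const d ^ 3 * (4 * (1 + (real n / m) ^ 3)) / \<sigma>"
      using \<sigma> C smooth_const_ge_1[of d]
      by (intro divide_right_mono mult_left_mono cube_one_plus_le) auto
    also have "\<dots> = c1 * (1 + (real n / m) ^ 3) / \<sigma>" by (simp add: c1_def)
    also have "\<dots> \<le> tv_const d * (1 + (real n / m) ^ 3) / \<sigma>"
      unfolding const using \<sigma> c2 cube by (intro divide_right_mono mult_right_mono) auto
    finally show ?thesis .
  next
    case False
    have \<mu>_le: "\<mu> \<le> m" "\<mu> \<le> n"
    proof -
      show "\<mu> \<le> m" using mult_left_mono[OF occ_prob_le_1[of n d], of "real m"] by (simp add: \<mu>_def)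
      have "\<mu> = expect n (num d)" by (simp add: \<mu>_def expect_num)
      also have "\<dots> \<le> expect n (\<lambda>_. real n)"
      proof (rule expect_mono)
        fix M assume M: "(\<Sum>u<m. M u) = n"
        have "1 * num d M \<le> real d * num d M" using d by (intro mult_right_mono num_nonneg) auto
        also have "\<dots> \<le> real n"
          using sum_two_counts_le[OF M, of d 0] d by simp
        finally show "num d M \<le> real n" by simp
      qed
      finally show "\<mu> \<le> n" by simp
    qed
    have "v \<le> c2"
    proof (cases "1 \<le> v")
      case True
      \<comment> \<open>Some other size condition fails; the mean is at most \<open>m\<close> and at
        most \<open>n = k + 1\<close>, so each failure bounds it.\<close>
      have "\<mu> \<le> threshold d + 2" using False True \<mu>_le thr n_eq by auto
      then have "var_const d * \<mu> \<le> C * (threshold d + 2)"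
        unfolding C_def using var_const_mono[of d "Suc d"] var_const_ge_1[of d] thr
        by (intro mult_mono) (auto simp: \<mu>_def intro!: mult_nonneg_nonneg occ_prob_nonneg)
      then show ?thesis
        using num_variance_le[of n d] by (simp add: v_def \<mu>_def c2_def)
    qed (use c2 in simp)
    then have "\<sigma> \<le> sqrt c2" unfolding \<sigma>_def v_def[symmetric] by (rule real_sqrt_le_mono)
    also have "\<dots> \<le> c2" by (rule sqrt_le_self[OF c2])
    also have "c2 * 1 \<le> tv_const d * (1 + (real n / m) ^ 3)"
      unfolding const using c1 c2 cube by (intro mult_mono) auto
    finally have "1 \<le> tv_const d * (1 + (real n / m) ^ 3) / \<sigma>" using \<sigma> by simp
    moreover have "0 \<le> ?p" by (intro expect_nonneg) simp
    moreover have "?p \<le> 1" using expect_mono[of n _ "\<lambda>_. 1"] by simp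
    moreover have "0 \<le> ?q" by simp
    moreover have "?q \<le> 1"
      by (rule prob_space.prob_le_1[OF prob_space_normal_density[OF \<sigma>]])
    ultimately show ?thesis by linarith
  qed
qed

theorem proposition2p8:
  fixes d :: nat
  assumes "d \<ge> 2"
  shows "\<exists>c::real. \<forall>n m :: nat. n \<ge> d \<longrightarrow> m \<ge> 2 \<longrightarrow>
    (let P = measure_pmf (allocation_pmf n m);
         S = (\<lambda>\<omega>. real (urns_with_exactly d n m \<omega>));
         \<mu> = real m * real (n choose d) * (1 / real m ^ d) * (1 - 1 / real m) ^ (n - d);
         \<sigma>2 = \<mu> - \<mu>\<^sup>2 + real m * (real m - 1) * multinomial_dd n d * (1 / real m ^ (2 * d))
                 * (1 - 2 / real m) ^ (n - 2 * d);
         \<sigma> = sqrt \<sigma>2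
     in prob_space.expectation P S = \<mu> \<and>
        prob_space.variance P S = \<sigma>2 \<and>
        tv_dist (distr P borel S)
                (distr (measure_pmf (discretized_normal \<mu> \<sigma>2)) borel real_of_int)
          \<le> c * (1 + (real n / real m) ^ 3) / \<sigma>)"
proof (intro exI[of _ "tv_const d"] allI impI)
  fix n m :: nat
  assume n: "n \<ge> d" and m: "m \<ge> 2"
  interpret urns m by unfold_locales (rule m)
  define P where "P = measure_pmf (allocation_pmf n m)"
  define S where "S = (\<lambda>\<omega>. real (urns_with_exactly d n m \<omega>))"
  define \<mu> where "\<mu> = real m * real (n choose d) * (1 / real m ^ d) * (1 - 1 / real m) ^ (n - d)"
  define v where "v = \<mu> - \<mu>\<^sup>2 + real m * (real m - 1) * multinomial_dd n d * (1 / real m ^ (2 * d))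
                 * (1 - 2 / real m) ^ (n - 2 * d)"
  have \<mu>: "\<mu> = real m * occ_prob n d" by (simp add: \<mu>_def mean_formula)
  have v: "v = expect n (\<lambda>M. (num d M - \<mu>)\<^sup>2)" unfolding v_def by (rule variance_formula[OF \<mu>, symmetric])
  have v_pos: "0 < v" unfolding v by (rule num_variance_pos[OF assms n])
  have E: "integral\<^sup>L P (\<lambda>\<omega>. F (S \<omega>)) = expect n (\<lambda>M. F (num d M))" for F
    unfolding P_def S_def by (rule expectation_urns_with_exactly)
  have mean: "integral\<^sup>L P S = \<mu>"
    using E[of "\<lambda>x. x"] expect_num[of n d] by (simp add: \<mu>)
  have var: "integral\<^sup>L P (\<lambda>\<omega>. (S \<omega> - integral\<^sup>L P S)\<^sup>2) = v"
    unfolding mean v by (rule E)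
  have "tv_dist (distr P borel S) (distr (measure_pmf (discretized_normal \<mu> v)) borel real_of_int)
      \<le> tv_const d * (1 + (real n / real m) ^ 3) / sqrt v"
    unfolding tv_dist_def
  proof (rule cSUP_least)
    fix X :: "real set" assume X: "X \<in> sets borel"
    \<comment> \<open>Both laws live on the integers, so only the integer points of \<open>X\<close>
      matter.\<close>
    define A where "A = {i. real_of_int i \<in> X}"
    have "measure (distr P borel S) X = measure P (S -` X \<inter> space P)"
      using X by (intro measure_distr) (simp_all add: P_def)
    also have "\<dots> = integral\<^sup>L P (\<lambda>\<omega>. indicator X (S \<omega>))"
    proof -
      have "(\<lambda>\<omega>. indicator X (S \<omega>)) = (indicator (S -` X) :: _ \<Rightarrow> real)"
        by (simp add: fun_eq_iff indicator_def)
      then show ?thesis by simp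
    qed
    also have "\<dots> = expect n (\<lambda>M. indicator X (num d M))" by (rule E)
    also have "\<dots> = expect n (\<lambda>M. of_bool (\<lfloor>num d M\<rfloor> \<in> A))"
      by (intro expect_cong) (simp add: A_def num_eq_card indicator_def)
    finally have 1: "measure (distr P borel S) X = expect n (\<lambda>M. of_bool (\<lfloor>num d M\<rfloor> \<in> A))" .
    have "measure (distr (measure_pmf (discretized_normal \<mu> v)) borel real_of_int) X
        = measure_pmf.prob (discretized_normal \<mu> v) A"
      using X by (subst measure_distr) (auto simp: A_def vimage_def)
    also have "\<dots> = measure (density lborel (normal_density \<mu> (sqrt v))) {x. \<lfloor>x + 1 / 2\<rfloor> \<in> A}"
      by (rule prob_discretized_normal[OF v_pos])
    finally show "\<bar>measure (distr P borel S) X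
         - measure (distr (measure_pmf (discretized_normal \<mu> v)) borel real_of_int) X\<bar>
        \<le> tv_const d * (1 + (real n / real m) ^ 3) / sqrt v"
      using normal_approximation[OF assms n, of A] unfolding 1 \<mu>[symmetric] v[symmetric] by simp
  qed auto
  with mean var show "let P = measure_pmf (allocation_pmf n m);
         S = (\<lambda>\<omega>. real (urns_with_exactly d n m \<omega>));
         \<mu> = real m * real (n choose d) * (1 / real m ^ d) * (1 - 1 / real m) ^ (n - d);
         \<sigma>2 = \<mu> - \<mu>\<^sup>2 + real m * (real m - 1) * multinomial_dd n d * (1 / real m ^ (2 * d))
                 * (1 - 2 / real m) ^ (n - 2 * d);
         \<sigma> = sqrt \<sigma>2
     in prob_space.expectation P S = \<mu> \<and>
        prob_space.variance P S = \<sigma>2 \<and>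
        tv_dist (distr P borel S)
                (distr (measure_pmf (discretized_normal \<mu> \<sigma>2)) borel real_of_int)
          \<le> tv_const d * (1 + (real n / real m) ^ 3) / \<sigma>"
    unfolding P_def S_def \<mu>_def[symmetric] v_def[symmetric] Let_def by blast
qed

end
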